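(* Let $q\in L^1(\mathbb{R}_+)$ be complex-valued and $\alpha\in\mathbb{C}\cup\{\infty\}$. For $k>0$ let $\mathbf{F}_{+\mathrm{i}}=\mathbf{F}_{+\mathrm{i}}(\cdot,k)$, $\mathbf{F}_{-1}=\mathbf{F}_{-1}(\cdot,k)$ be Jost solutions and let $\mathbf{e}=\mathbf{e}(\cdot,k)$ be the scalar Jost solution. Let $(\nu,\psi)$ be the spectral pair of $H(q,\alpha)$, and let $\lambda=k^2$. (i) Suppose $\lambda=k^2$ is not an eigenvalue of $\mathbf{H}$. Then $$\frac{\mathrm{d}\nu}{\mathrm{d}\lambda}(\lambda)=\frac{2k}{\pi}\,\frac{|\ell_\alpha^\perp(\mathbf{e})|^2}{\bigl|\det\{L_\alpha^\perp(\mathbf{F}_{+\mathrm{i}}),L_\alpha^\perp(\mathbf{F}_{-1})\}\bigr|^2},\qquad \psi(\lambda)=\frac{\ell_\alpha^\perp(\mathbf{e})}{\overline{\ell_\alpha^\perp(\mathbf{e})}}.$$ The determinant in the denominator does not depend on the choice of the Jost solution $\mathbf{F}_{+\mathrm{i}}$ and does not vanish. (ii) Suppose $\lambda=k^2$ is an eigenvalue of $\mathbf{H}$. Then $\ell_\alpha(\mathbf{e})\neq0$ and $$\nu(\{\lambda\})=\frac{|\ell_\alpha(\mathbf{e})|^2}{2\|\mathbf{e}\|_{L^2(\mathbb{R}_+)}^2},\qquad \psi(\lambda)=-\frac{\overline{\ell_\alpha(\mathbf{e})}}{\ell_\alpha(\mathbf{e})}.$$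
   Context: **Basic notation.** $\mathbb{R}_+=(0,\infty)$; $\overline{\infty}=\infty$; $\{a,b\}$ is the $2\times2$ matrix with columns $a,b\in\mathbb{C}^2$; $\epsilon=\begin{pmatrix}0&1\\1&0\end{pmatrix}$, $Q=\begin{pmatrix}0&q\\ \overline q&0\end{pmatrix}$, $e_+=(1,1)^T$, $e_-=(1,-1)^T$. Solutions of differential equations are functions that together with their first derivative are locally absolutely continuous on $[0,\infty)$ and satisfy the equation a.e. **Boundary functionals.** For scalar $f$: if $\alpha\neq\infty$, $\ell_\alpha(f)=\frac{\overline\alpha f'(0)-f(0)}{\sqrt{1+|\alpha|^2}}$, $\ell_\alpha^\perp(f)=\frac{f'(0)+\alpha f(0)}{\sqrt{1+|\alpha|^2}}$; if $\alpha=\infty$, $\ell_\alpha(f)=f'(0)$, $\ell_\alpha^\perp(f)=f(0)$. For $F=(F_1,F_2)^T$: $L_\alpha(F)=(\ell_{\overline\alpha}(F_1),\ell_\alpha(F_2))^T$, $L_\alpha^\perp(F)=(\ell^\perp_{\overline\alpha}(F_1),\ell^\perp_\alpha(F_2))^T$; these act on $2\times2$ matrix-valued functions column by column. **Operators.** $H=H(q,\alpha)$ acts in $L^2(\mathbb{R}_+)$ by $Hf=-f''+qf$ on the domain of all $f\in L^2(\mathbb{R}_+)$ with $f,f'$ (locally) absolutely continuous, $-f''+qf\in L^2(\mathbb{R}_+)$ and $\ell^\perp_\alpha(f)=0$ (such $f$ extend to $C^1$ functions on $[0,\infty)$). $H$ is closed and densely defined and $H(q,\alpha)^*=H(\overline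 q,\overline\alpha)$. The hermitisation $\mathbf{H}=\begin{pmatrix}0&H\\H^*&0\end{pmatrix}$ on $\mathrm{Dom}\,H^*\oplus\mathrm{Dom}\,H$ is self-adjoint in $L^2(\mathbb{R}_+;\mathbb{C}^2)$; it acts as $\mathbf{H}F=-\epsilon F''+QF$ with boundary condition $L_\alpha^\perp(F)=0$. **Spectral pair.** Let $\Phi(\cdot,\lambda),\Theta(\cdot,\lambda)$ be the $2\times2$ matrix-valued solutions of $-\epsilon F''+QF=\lambda F$ with $L_\alpha(\Phi)=-I$, $L_\alpha^\perp(\Phi)=0$, $L_\alpha(\Theta)=0$, $L_\alpha^\perp(\Theta)=\epsilon$. For every $\lambda\in\mathbb{C}\setminus\mathbb{R}$ there is a unique $2\times2$ matrix $M_\alpha(\lambda)$ such that both columns of $\Theta(\cdot,\lambda)-\Phi(\cdot,\lambda)M_\alpha(\lambda)$ are in $L^2(\mathbb{R}_+;\mathbb{C}^2)$. $M_\alpha$ is a matrix Herglotz–Nevanlinna function, so $M_\alpha(\lambda)=\mathrm{Re}\,M_\alpha(\mathrm{i})+\int_{\mathbb{R}}\bigl(\frac1{t-\lambda}-\frac{t}{1+t^2}\bigr)\mathrm{d}\Sigma(t)$, $\mathrm{Im}\,\lambda>0$, with a unique $2\times2$ matrix-valued measure $\Sigma$ on $\mathbb{R}$ (here $\mathrm{Re}\,M=\frac12(M+M^* )$). It has the structure $\mathrm{d}\Sigma=\begin{pmatrix}1&\psi\\ \overline\psi&1\end{pmatrix}\mathrm{d}\nu$, where $\nu$ is an even positive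 measure on $\mathbb{R}$ and $\psi\in L^\infty(\nu)$ is odd with $|\psi|\le1$ $\nu$-a.e. The pair $(\nu,\psi)$ is the spectral pair of $H$. On $(0,\infty)$ away from the eigenvalues of $\mathbf{H}$ (which can accumulate only at $0$), $\Sigma$ is absolutely continuous with a continuous density; pointwise values of $\mathrm{d}\nu/\mathrm{d}\lambda$ and $\psi$ there refer to this continuous version, i.e. $\frac{\mathrm{d}\Sigma}{\mathrm{d}\lambda}(\lambda)=\begin{pmatrix}1&\psi(\lambda)\\ \overline{\psi(\lambda)}&1\end{pmatrix}\frac{\mathrm{d}\nu}{\mathrm{d}\lambda}(\lambda)$. **Jost solutions.** For $k>0$, $\mathbf{F}_{-1}(\cdot,k)$ is the unique $\mathbb{C}^2$-valued solution of $-\epsilon F''+QF=k^2F$ with $F(x)=\mathrm{e}^{-kx}e_-+o(\mathrm{e}^{-kx})$, $F'(x)=-k\mathrm{e}^{-kx}e_-+o(\mathrm{e}^{-kx})$ as $x\to\infty$; $\mathbf{F}_{+\mathrm{i}}(\cdot,k)$ is any solution with $F(x)=\mathrm{e}^{\mathrm{i}kx}e_++o(1)$, $F'(x)=\mathrm{i}k\mathrm{e}^{\mathrm{i}kx}e_++o(1)$ (such solutions exist but are not unique). The scalar Jost solution $\mathbf{e}(\cdot,k)$ is the unique solution of the anti-linear equation $-\mathbf{e}''+q\mathbf{e}=-k^2\overline{\mathbf{e}}$ with $\mathbf{e}(x,k)=\mathrm{e}^{-kx}+o(\mathrm{e}^{-kx})$ as $x\to\infty$. *)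

theory Defs
  imports "HOL-Analysis.Analysis" "HOL-Library.Landau_Symbols"
begin

section \<open>Functions on the half-line\<close>

text \<open>
  Functions on the half-line are total functions on the reals of which only the values on
  \<open>{0..}\<close> matter.  Derivatives are taken within \<open>{0..}\<close>, so the one at 0 is the right derivative.
\<close>

definition hl_deriv :: "(real \<Rightarrow> 'a::real_normed_vector) \<Rightarrow> real \<Rightarrow> 'a" where
  "hl_deriv f x = vector_derivative f (at x within {0..})"

text \<open>
  A finite family of non-overlapping compact subintervals is a finite set of pairs of endpoints.
\<close>

definition abs_cont_on :: "real set \<Rightarrow> (real \<Rightarrow> 'a::metric_space) \<Rightarrow> bool" where
  "abs_cont_on S f \<longleftrightarrow>
     (\<forall>\<epsilon>>0. \<exists>\<delta>>0. \<forall>I.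
        finite I \<and> (\<forall>(u, v)\<in>I. u \<le> v \<and> {u..v} \<subseteq> S) \<and>
        pairwise (\<lambda>(u, v) (u', v'). {u<..<v} \<inter> {u'<..<v'} = {}) I \<and>
        (\<Sum>(u, v)\<in>I. v - u) < \<delta>
        \<longrightarrow> (\<Sum>(u, v)\<in>I. dist (f u) (f v)) < \<epsilon>)"

definition loc_abs_cont :: "(real \<Rightarrow> 'a::metric_space) \<Rightarrow> bool" where
  "loc_abs_cont f \<longleftrightarrow> (\<forall>b\<ge>0. abs_cont_on {0..b} f)"

definition loc_abs_cont1 :: "(real \<Rightarrow> 'a::real_normed_vector) \<Rightarrow> bool" where
  "loc_abs_cont1 f \<longleftrightarrow>
     loc_abs_cont f \<and> (\<forall>x\<ge>0. f differentiable (at x within {0..})) \<and> loc_abs_cont (hl_deriv f)"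

definition L2_halfline :: "(real \<Rightarrow> 'a::real_normed_vector) \<Rightarrow> bool" where
  "L2_halfline f \<longleftrightarrow>
     set_borel_measurable lebesgue {0<..} f \<and>
     set_integrable lebesgue {0<..} (\<lambda>x. (norm (f x))\<^sup>2)"

section \<open>Boundary functionals\<close>

text \<open>
  The boundary parameter ranges over the complex numbers together with infinity; \<open>None\<close> is infinity,
  and \<open>map_option cnj\<close> is conjugation, which fixes infinity.
\<close>

definition bd_ell :: "complex option \<Rightarrow> (real \<Rightarrow> complex) \<Rightarrow> complex" where
  "bd_ell \<alpha> f = (case \<alpha> of
       None \<Rightarrow> hl_deriv f 0
     | Some a \<Rightarrow> (cnj a * hl_deriv f 0 - f 0) / of_real (sqrt (1 + (cmod a)\<^sup>2)))"

definition bd_ell_perp :: "complex option \<Rightarrow> (real \<Rightarrow> complex) \<Rightarrow> complex" where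
  "bd_ell_perp \<alpha> f = (case \<alpha> of
       None \<Rightarrow> f 0
     | Some a \<Rightarrow> (hl_deriv f 0 + a * f 0) / of_real (sqrt (1 + (cmod a)\<^sup>2)))"

definition bd_L :: "complex option \<Rightarrow> (real \<Rightarrow> complex^2) \<Rightarrow> complex^2" where
  "bd_L \<alpha> F =
     vector [bd_ell (map_option cnj \<alpha>) (\<lambda>x. F x $ 1), bd_ell \<alpha> (\<lambda>x. F x $ 2)]"

definition bd_L_perp :: "complex option \<Rightarrow> (real \<Rightarrow> complex^2) \<Rightarrow> complex^2" where
  "bd_L_perp \<alpha> F =
     vector [bd_ell_perp (map_option cnj \<alpha>) (\<lambda>x. F x $ 1), bd_ell_perp \<alpha> (\<lambda>x. F x $ 2)]"

text \<open>The library's \<open>column j A\<close> and \<open>A $ i $ j\<close> use \<open>i\<close> for rows and \<open>j\<close> for columns.\<close>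

definition mat_bd_L :: "complex option \<Rightarrow> (real \<Rightarrow> complex^2^2) \<Rightarrow> complex^2^2" where
  "mat_bd_L \<alpha> F = (\<chi> i j. bd_L \<alpha> (\<lambda>x. column j (F x)) $ i)"

definition mat_bd_L_perp :: "complex option \<Rightarrow> (real \<Rightarrow> complex^2^2) \<Rightarrow> complex^2^2" where
  "mat_bd_L_perp \<alpha> F = (\<chi> i j. bd_L_perp \<alpha> (\<lambda>x. column j (F x)) $ i)"

section \<open>The operators\<close>

text \<open>
  \<open>schroedinger_op q \<alpha> f g\<close> says that \<open>f\<close> lies in the domain of \<open>H(q,\<alpha>)\<close> and that \<open>H f = g\<close>
  almost everywhere.  Elements of the domain are represented by their \<open>C\<^sup>1\<close> versions on the
  closed half-line.
\<close>

definition schroedinger_op ::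
    "(real \<Rightarrow> complex) \<Rightarrow> complex option \<Rightarrow> (real \<Rightarrow> complex) \<Rightarrow> (real \<Rightarrow> complex) \<Rightarrow> bool" where
  "schroedinger_op q \<alpha> f g \<longleftrightarrow>
     L2_halfline f \<and> L2_halfline g \<and> loc_abs_cont1 f \<and> bd_ell_perp \<alpha> f = 0 \<and>
     (AE x in lebesgue. x > 0 \<longrightarrow>
        (\<exists>f2. (hl_deriv f has_vector_derivative f2) (at x) \<and> - f2 + q x * f x = g x))"

text \<open>
  The hermitisation is the block operator with \<open>H\<close> in the upper right and the adjoint of \<open>H\<close>
  in the lower left corner, the adjoint of \<open>H(q,\<alpha>)\<close> being \<open>H(cnj q, cnj \<alpha>)\<close>.
\<close>

definition hermitisation ::
    "(real \<Rightarrow> complex) \<Rightarrow> complex option \<Rightarrow> (real \<Rightarrow> complex^2) \<Rightarrow> (real \<Rightarrow> complex^2) \<Rightarrow> bool" where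
  "hermitisation q \<alpha> F G \<longleftrightarrow>
     schroedinger_op q \<alpha> (\<lambda>x. F x $ 2) (\<lambda>x. G x $ 1) \<and>
     schroedinger_op (\<lambda>x. cnj (q x)) (map_option cnj \<alpha>) (\<lambda>x. F x $ 1) (\<lambda>x. G x $ 2)"

definition hermitisation_eigenvalue ::
    "(real \<Rightarrow> complex) \<Rightarrow> complex option \<Rightarrow> complex \<Rightarrow> bool" where
  "hermitisation_eigenvalue q \<alpha> z \<longleftrightarrow>
     (\<exists>F. hermitisation q \<alpha> F (\<lambda>x. z *s F x) \<and> \<not> (AE x in lebesgue. x > 0 \<longrightarrow> F x = 0))"

section \<open>Solutions of the hermitised equation and Jost solutions\<close>

definition eps_mat :: "complex^2^2" where
  "eps_mat = vector [vector [0, 1], vector [1, 0]]"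

definition pot_mat :: "complex \<Rightarrow> complex^2^2" where
  "pot_mat c = vector [vector [0, c], vector [cnj c, 0]]"

definition e_plus :: "complex^2" where "e_plus = vector [1, 1]"

definition e_minus :: "complex^2" where "e_minus = vector [1, -1]"

definition cols2 :: "complex^2 \<Rightarrow> complex^2 \<Rightarrow> complex^2^2" where
  "cols2 a b = (\<chi> i j. if j = 1 then a $ i else b $ i)"

definition herm_solution ::
    "(real \<Rightarrow> complex) \<Rightarrow> complex \<Rightarrow> (real \<Rightarrow> complex^2) \<Rightarrow> bool" where
  "herm_solution q z F \<longleftrightarrow>
     loc_abs_cont1 F \<and>
     (AE x in lebesgue. x > 0 \<longrightarrow>
        (\<exists>F2. (hl_deriv F has_vector_derivative F2) (at x) \<and>
              - (eps_mat *v F2) + pot_mat (q x) *v F x = z *s F x))"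

definition jost_minus1 :: "(real \<Rightarrow> complex) \<Rightarrow> real \<Rightarrow> (real \<Rightarrow> complex^2) \<Rightarrow> bool" where
  "jost_minus1 q k F \<longleftrightarrow>
     herm_solution q (of_real (k\<^sup>2)) F \<and>
     (\<lambda>x. norm (F x - exp (- (k * x)) *\<^sub>R e_minus)) \<in> o[at_top](\<lambda>x. exp (- (k * x))) \<and>
     (\<lambda>x. norm (hl_deriv F x - (- k * exp (- (k * x))) *\<^sub>R e_minus)) \<in> o[at_top](\<lambda>x. exp (- (k * x)))"

definition jost_plus_i :: "(real \<Rightarrow> complex) \<Rightarrow> real \<Rightarrow> (real \<Rightarrow> complex^2) \<Rightarrow> bool" where
  "jost_plus_i q k F \<longleftrightarrow>
     herm_solution q (of_real (k\<^sup>2)) F \<and>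
     (\<lambda>x. norm (F x - exp (\<i> * of_real (k * x)) *s e_plus)) \<in> o[at_top](\<lambda>x. 1) \<and>
     (\<lambda>x. norm (hl_deriv F x - (\<i> * of_real k * exp (\<i> * of_real (k * x))) *s e_plus))
       \<in> o[at_top](\<lambda>x. 1)"

definition scalar_jost :: "(real \<Rightarrow> complex) \<Rightarrow> real \<Rightarrow> (real \<Rightarrow> complex) \<Rightarrow> bool" where
  "scalar_jost q k e \<longleftrightarrow>
     loc_abs_cont1 e \<and>
     (AE x in lebesgue. x > 0 \<longrightarrow>
        (\<exists>e2. (hl_deriv e has_vector_derivative e2) (at x) \<and>
              - e2 + q x * e x = - of_real (k\<^sup>2) * cnj (e x))) \<and>
     (\<lambda>x. norm (e x - of_real (exp (- (k * x))))) \<in> o[at_top](\<lambda>x. exp (- (k * x)))"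

section \<open>The spectral pair\<close>

definition weyl_matrix ::
    "(real \<Rightarrow> complex) \<Rightarrow> complex option \<Rightarrow> complex \<Rightarrow> complex^2^2 \<Rightarrow> bool" where
  "weyl_matrix q \<alpha> z M \<longleftrightarrow>
     (\<exists>\<Phi> \<Theta>.
        (\<forall>j. herm_solution q z (\<lambda>x. column j (\<Phi> x))) \<and>
        (\<forall>j. herm_solution q z (\<lambda>x. column j (\<Theta> x))) \<and>
        mat_bd_L \<alpha> \<Phi> = - mat 1 \<and> mat_bd_L_perp \<alpha> \<Phi> = 0 \<and>
        mat_bd_L \<alpha> \<Theta> = 0 \<and> mat_bd_L_perp \<alpha> \<Theta> = eps_mat \<and>
        (\<forall>j. L2_halfline (\<lambda>x. column j (\<Theta> x - \<Phi> x ** M))))"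

definition mat_Re :: "complex^2^2 \<Rightarrow> complex^2^2" where
  "mat_Re M = (\<chi> i j. (M $ i $ j + cnj (M $ j $ i)) / 2)"

definition spectral_mat :: "complex \<Rightarrow> complex^2^2" where
  "spectral_mat c = vector [vector [1, c], vector [cnj c, 1]]"

text \<open>
  The matrix measure is never formed as an object of its own: it is represented by \<open>\<nu>\<close> and the
  density \<open>spectral_mat \<circ> \<psi>\<close>.  Integrability of \<open>1 / (1 + t\<^sup>2)\<close> is part of the
  Herglotz--Nevanlinna representation; with \<open>\<bar>\<psi>\<bar> \<le> 1\<close> it makes the integrals below converge.
  Being an element of \<open>L\<^sup>\<infinity>\<close>, \<open>\<psi>\<close> is only required to be odd almost everywhere.
\<close>

definition spectral_pair ::
    "(real \<Rightarrow> complex) \<Rightarrow> complex option \<Rightarrow> real measure \<Rightarrow> (real \<Rightarrow> complex) \<Rightarrow> bool" where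
  "spectral_pair q \<alpha> \<nu> \<psi> \<longleftrightarrow>
     sets \<nu> = sets borel \<and> distr \<nu> borel uminus = \<nu> \<and>
     integrable \<nu> (\<lambda>t. 1 / (1 + t\<^sup>2)) \<and>
     \<psi> \<in> borel_measurable borel \<and> (AE t in \<nu>. cmod (\<psi> t) \<le> 1) \<and> (AE t in \<nu>. \<psi> (- t) = - \<psi> t) \<and>
     (\<exists>M. (\<forall>z. z \<notin> \<real> \<longrightarrow> weyl_matrix q \<alpha> z (M z)) \<and>
          (\<forall>z. Im z > 0 \<longrightarrow> (\<forall>i j.
             M z $ i $ j = mat_Re (M \<i>) $ i $ j +
               (LINT t|\<nu>. (1 / (of_real t - z) - of_real (t / (1 + t\<^sup>2))) * spectral_mat (\<psi> t) $ i $ j))))"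

text \<open>
  On the positive half-line without the eigenvalues of the hermitisation, the matrix measure
  has a continuous Lebesgue density, written as \<open>n t *\<^sub>R spectral_mat (p t)\<close>.  Thus \<open>n\<close> and \<open>p\<close>
  carry the pointwise values there of the density of \<open>\<nu>\<close> and of \<open>\<psi>\<close>; the value \<open>p t\<close> is
  determined wherever \<open>n t \<noteq> 0\<close>.
\<close>

definition continuous_spectral_density ::
    "(real \<Rightarrow> complex) \<Rightarrow> complex option \<Rightarrow> real measure \<Rightarrow> (real \<Rightarrow> complex)
     \<Rightarrow> (real \<Rightarrow> real) \<Rightarrow> (real \<Rightarrow> complex) \<Rightarrow> bool" where
  "continuous_spectral_density q \<alpha> \<nu> \<psi> n p \<longleftrightarrow>
     (let S = {t. t > 0 \<and> \<not> hermitisation_eigenvalue q \<alpha> (of_real t)};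
          D = (\<lambda>t. n t *\<^sub>R spectral_mat (p t))
      in continuous_on S D \<and>
         (\<forall>B\<in>sets borel. B \<subseteq> S \<and> bounded B \<longrightarrow>
            set_integrable lborel B D \<and>
            (LINT t:B|\<nu>. spectral_mat (\<psi> t)) = (LINT t:B|lborel. D t)))"

end

theory Submission
  imports Defs
begin

text \<open>
  The Weyl matrix is computed from Wronskians alone, without constructing solutions at nonreal
  spectral parameters.  Let \<open>Y\<close> be a column of the Weyl solution at \<open>z = k\<^sup>2 + i d\<close>.  Diagonalising the free
  equation into two oscillating and two exponential modes shows that a solution decaying at
  infinity is bounded by its Cauchy data at 0, uniformly in \<open>z\<close>, and is asymptotically outgoing; hence
  its Wronskians at 0 with the two Jost solutions at \<open>k\<^sup>2\<close> tend to 0 relative to those data.  If \<open>k\<^sup>2\<close> is not an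
  eigenvalue, these are two independent linear conditions, which by Cramer's rule exclude eigenvalues
  near \<open>k\<^sup>2\<close> and give the limit of the Weyl matrix; its jump across the real axis is a sesquilinear
  Wronskian at infinity, and the Poisson integral turns it into the density.  If \<open>k\<^sup>2\<close> is an eigenvalue,
  one condition survives; it makes \<open>d Y\<close> converge to a multiple of the eigenfunction, and the multiple follows
  from the Wronskian of \<open>Y\<close> with the eigenfunction.
\<close>

section \<open>Absolute continuity\<close>

text \<open>The obstacle is uniformity up to the real axis. With m the square root of z in the
  closed first quadrant, the modes have exponents m, -m, i m and -i m, and Re (i m) tends to 0 as z
  approaches k^2, so no uniform exponential weight is available, and q is merely integrable. Only
  signs are used: modes whose exponent has nonnegative real part are integrated from infinity, where
  decay removes the boundary term, the others from a far point X, and the smallness of the tail of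
  |q| lets the supremum beyond X absorb itself. Gronwall covers [0, X]. The pairing behind every
  identity is the bilinear Wronskian, in which the potential cancels. With the antilinear map
  \<open>dag\<close> in one argument it becomes a flux: it vanishes at 0 for solutions obeying the
  boundary condition, ignores decaying components at infinity, and equals 4 i k for the outgoing
  Jost solution. This number excludes a zero determinant and, divided by 2 i pi, is the factor 2 k /
  pi of the density. The scalar Jost function enters through F_{-1} = (conj e, -e).\<close>

lemma abs_cont_onD:
  assumes "abs_cont_on S f" "e > 0"
  obtains d where "d > 0"
    "\<And>I. \<lbrakk>finite I; \<And>u v. (u, v) \<in> I \<Longrightarrow> u \<le> v \<and> {u..v} \<subseteq> S;
       pairwise (\<lambda>(u, v) (u', v'). {u<..<v} \<inter> {u'<..<v'} = {}) I; (\<Sum>(u, v)\<in>I. v - u) < d\<rbrakk>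
       \<Longrightarrow> (\<Sum>(u, v)\<in>I. dist (f u) (f v)) < e"
proof -
  obtain d where d: "d > 0" "\<forall>I. finite I \<and> (\<forall>(u, v)\<in>I. u \<le> v \<and> {u..v} \<subseteq> S) \<and>
        pairwise (\<lambda>(u, v) (u', v'). {u<..<v} \<inter> {u'<..<v'} = {}) I \<and>
        (\<Sum>(u, v)\<in>I. v - u) < d
        \<longrightarrow> (\<Sum>(u, v)\<in>I. dist (f u) (f v)) < e"
    using assms unfolding abs_cont_on_def by blast
  show ?thesis
  proof (rule that[OF d(1)])
    fix I :: "(real \<times> real) set"
    assume I: "finite I" "\<And>u v. (u, v) \<in> I \<Longrightarrow> u \<le> v \<and> {u..v} \<subseteq> S"
      "pairwise (\<lambda>(u, v) (u', v'). {u<..<v} \<inter> {u'<..<v'} = {}) I" "(\<Sum>(u, v)\<in>I. v - u) < d"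
    have "\<forall>(u, v)\<in>I. u \<le> v \<and> {u..v} \<subseteq> S" using I(2) by blast
    then show "(\<Sum>(u, v)\<in>I. dist (f u) (f v)) < e" using d(2) I by blast
  qed
qed

text \<open>The single source of the closure properties below (Lipschitz maps, congruence, sums,
  products, conjugation): it suffices that increments of \<open>h\<close> are controlled by those of
  \<open>f\<close> and \<open>g\<close>.\<close>

lemma abs_cont_on_comb:
  assumes f: "abs_cont_on S f" and g: "abs_cont_on S g" and C: "C \<ge> 0"
    and h: "\<And>u v. u \<in> S \<Longrightarrow> v \<in> S \<Longrightarrow> dist (h u) (h v) \<le> C * (dist (f u) (f v) + dist (g u) (g v))"
  shows "abs_cont_on S h"
  unfolding abs_cont_on_def
proof (intro allI impI)
  fix e :: real assume "e > 0"
  \<comment> \<open>\<open>C + 1\<close> instead of \<open>C\<close> admits \<open>C = 0\<close> and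
    leaves the slack \<open>2 * e'\<close> that makes the final inequality strict.\<close>
  define e' where "e' = e / (2 * (C + 1))"
  have e': "e' > 0" using \<open>e > 0\<close> C by (simp add: e'_def)
  obtain d1 where d1: "d1 > 0" "\<And>I. \<lbrakk>finite I; \<And>u v. (u, v) \<in> I \<Longrightarrow> u \<le> v \<and> {u..v} \<subseteq> S;
       pairwise (\<lambda>(u, v) (u', v'). {u<..<v} \<inter> {u'<..<v'} = {}) I; (\<Sum>(u, v)\<in>I. v - u) < d1\<rbrakk>
       \<Longrightarrow> (\<Sum>(u, v)\<in>I. dist (f u) (f v)) < e'"
    using abs_cont_onD[OF f e'] by blast
  obtain d2 where d2: "d2 > 0" "\<And>I. \<lbrakk>finite I; \<And>u v. (u, v) \<in> I \<Longrightarrow> u \<le> v \<and> {u..v} \<subseteq> S;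
       pairwise (\<lambda>(u, v) (u', v'). {u<..<v} \<inter> {u'<..<v'} = {}) I; (\<Sum>(u, v)\<in>I. v - u) < d2\<rbrakk>
       \<Longrightarrow> (\<Sum>(u, v)\<in>I. dist (g u) (g v)) < e'"
    using abs_cont_onD[OF g e'] by blast
  have "(\<Sum>(u, v)\<in>I. dist (h u) (h v)) < e"
    if I: "finite I" "\<forall>(u, v)\<in>I. u \<le> v \<and> {u..v} \<subseteq> S"
      "pairwise (\<lambda>(u, v) (u', v'). {u<..<v} \<inter> {u'<..<v'} = {}) I" "(\<Sum>(u, v)\<in>I. v - u) < min d1 d2" for I
  proof -
    have "(\<Sum>(u, v)\<in>I. dist (h u) (h v)) \<le> (\<Sum>(u, v)\<in>I. C * (dist (f u) (f v) + dist (g u) (g v)))"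
    proof (rule sum_mono, safe)
      fix u v assume "(u, v) \<in> I"
      then have "u \<in> S" "v \<in> S" using I(2) by fastforce+
      then show "dist (h u) (h v) \<le> C * (dist (f u) (f v) + dist (g u) (g v))" by (rule h)
    qed
    also have "\<dots> = C * ((\<Sum>(u, v)\<in>I. dist (f u) (f v)) + (\<Sum>(u, v)\<in>I. dist (g u) (g v)))"
      by (simp add: case_prod_beta sum_distrib_left sum.distrib[symmetric])
    also have "\<dots> \<le> C * (e' + e')"
    proof (rule mult_left_mono[OF add_mono C])
      show "(\<Sum>(u, v)\<in>I. dist (f u) (f v)) \<le> e'" by (rule less_imp_le[OF d1(2)]) (use I in auto)
      show "(\<Sum>(u, v)\<in>I. dist (g u) (g v)) \<le> e'" by (rule less_imp_le[OF d2(2)]) (use I in auto)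
    qed
    also have "\<dots> < e"
    proof -
      have "e' * (2 * (C + 1)) = e" using C by (simp add: e'_def)
      then have "C * (e' + e') = e - 2 * e'" by (simp add: algebra_simps)
      then show ?thesis using e' by simp
    qed
    finally show ?thesis .
  qed
  then show "\<exists>\<delta>>0. \<forall>I. finite I \<and> (\<forall>(u, v)\<in>I. u \<le> v \<and> {u..v} \<subseteq> S) \<and>
        pairwise (\<lambda>(u, v) (u', v'). {u<..<v} \<inter> {u'<..<v'} = {}) I \<and> (\<Sum>(u, v)\<in>I. v - u) < \<delta>
        \<longrightarrow> (\<Sum>(u, v)\<in>I. dist (h u) (h v)) < e"
    using d1(1) d2(1) by (intro exI[of _ "min d1 d2"]) auto
qed

lemma abs_cont_on_lipschitz:
  fixes f :: "real \<Rightarrow> 'a::metric_space"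
  assumes "C \<ge> 0" "\<And>u v. u \<in> S \<Longrightarrow> v \<in> S \<Longrightarrow> dist (f u) (f v) \<le> C * dist u v"
  shows "abs_cont_on S f"
proof -
  have id: "abs_cont_on S (\<lambda>x::real. x)"
    unfolding abs_cont_on_def
  proof (intro allI impI)
    fix e :: real assume "e > 0"
    then show "\<exists>\<delta>>0. \<forall>I. finite I \<and> (\<forall>(u, v)\<in>I. u \<le> v \<and> {u..v} \<subseteq> S) \<and>
        pairwise (\<lambda>(u, v) (u', v'). {u<..<v} \<inter> {u'<..<v'} = {}) I \<and> (\<Sum>(u, v)\<in>I. v - u) < \<delta>
        \<longrightarrow> (\<Sum>(u, v)\<in>I. dist u v) < e"
    proof (intro exI[of _ e] conjI allI impI)
      fix I :: "(real \<times> real) set"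
      assume *: "finite I \<and> (\<forall>(u, v)\<in>I. u \<le> v \<and> {u..v} \<subseteq> S) \<and>
        pairwise (\<lambda>(u, v) (u', v'). {u<..<v} \<inter> {u'<..<v'} = {}) I \<and> (\<Sum>(u, v)\<in>I. v - u) < e"
      have "(\<Sum>(u, v)\<in>I. dist u v) = (\<Sum>(u, v)\<in>I. v - u)"
        using * by (intro sum.cong) (auto simp: dist_real_def)
      then show "(\<Sum>(u, v)\<in>I. dist u v) < e" using * by simp
    qed
  qed
  have *: "dist (f u) (f v) \<le> C * (dist u v + dist u v)" if "u \<in> S" "v \<in> S" for u v
    using assms(2)[OF that] assms(1) by (smt (verit) mult_left_mono zero_le_dist)
  show ?thesis by (rule abs_cont_on_comb[OF id id assms(1) *])
qed

lemma abs_cont_on_continuous: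
  fixes f :: "real \<Rightarrow> 'a::metric_space"
  assumes "abs_cont_on {a..b} f"
  shows "continuous_on {a..b} f"
  unfolding continuous_on_iff
proof (intro ballI allI impI)
  fix x e :: real assume x: "x \<in> {a..b}" and "e > 0"
  obtain d where d: "d > 0" "\<And>I. \<lbrakk>finite I; \<And>u v. (u, v) \<in> I \<Longrightarrow> u \<le> v \<and> {u..v} \<subseteq> {a..b};
       pairwise (\<lambda>(u, v) (u', v'). {u<..<v} \<inter> {u'<..<v'} = {}) I; (\<Sum>(u, v)\<in>I. v - u) < d\<rbrakk>
       \<Longrightarrow> (\<Sum>(u, v)\<in>I. dist (f u) (f v)) < e"
    using abs_cont_onD[OF assms \<open>e > 0\<close>] by blast
  \<comment> \<open>The family consisting of the one interval between \<open>x\<close> and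
    \<open>y\<close> already tests continuity.\<close>
  have "dist (f y) (f x) < e" if "y \<in> {a..b}" "dist y x < d" for y
    using d(2)[of "{(min x y, max x y)}"] x that
    by (cases "x \<le> y") (auto simp: dist_real_def pairwise_def dist_commute min_def max_def)
  then show "\<exists>d>0. \<forall>x'\<in>{a..b}. dist x' x < d \<longrightarrow> dist (f x') (f x) < e"
    using d(1) by blast
qed

lemma abs_cont_on_subset:
  assumes "abs_cont_on S f" "T \<subseteq> S"
  shows "abs_cont_on T f"
  unfolding abs_cont_on_def
proof (intro allI impI)
  fix e :: real assume "e > 0"
  obtain d where d: "d > 0" "\<And>I. \<lbrakk>finite I; \<And>u v. (u, v) \<in> I \<Longrightarrow> u \<le> v \<and> {u..v} \<subseteq> S;
       pairwise (\<lambda>(u, v) (u', v'). {u<..<v} \<inter> {u'<..<v'} = {}) I; (\<Sum>(u, v)\<in>I. v - u) < d\<rbrakk>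
       \<Longrightarrow> (\<Sum>(u, v)\<in>I. dist (f u) (f v)) < e"
    using abs_cont_onD[OF assms(1) \<open>e > 0\<close>] by blast
  show "\<exists>\<delta>>0. \<forall>I. finite I \<and> (\<forall>(u, v)\<in>I. u \<le> v \<and> {u..v} \<subseteq> T) \<and>
        pairwise (\<lambda>(u, v) (u', v'). {u<..<v} \<inter> {u'<..<v'} = {}) I \<and> (\<Sum>(u, v)\<in>I. v - u) < \<delta>
        \<longrightarrow> (\<Sum>(u, v)\<in>I. dist (f u) (f v)) < e"
    by (intro exI[of _ d] conjI allI impI d) (use assms(2) in \<open>auto dest!: bspec\<close>)
qed

text \<open>
  The Riemann sums of the exceptional tags are controlled by absolute continuity, because the
  indicator of a null set has integral 0 and so the intervals with exceptional tags of a fine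
  division have small total length.
\<close>

lemma has_integral_abs_cont:
  fixes f :: "real \<Rightarrow> 'a::banach"
  assumes ab: "a \<le> b" and ac: "abs_cont_on {a..b} f" and E: "negligible E"
    and der: "\<And>x. x \<in> {a..b} - E \<Longrightarrow> (f has_vector_derivative f' x) (at x within {a..b})"
  shows "(f' has_integral (f b - f a)) {a..b}"
proof -
  \<comment> \<open>Nothing is known of \<open>f'\<close> on \<open>E\<close>; with value 0 there,
    an exceptional tag contributes only the increment of \<open>f\<close> to the Riemann sum, and a
    null set does not affect the integral.\<close>
  define g where "g x = (if x \<in> E then 0 else f' x)" for x
  have "(g has_integral (f b - f a)) {a..b}"
    unfolding has_integral_real
  proof (intro allI impI)
    fix e :: real assume "e > 0"
    define e1 where "e1 = e / (2 * (b - a + 1))"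
    have e1: "e1 > 0" using \<open>e > 0\<close> ab by (simp add: e1_def)
    have "\<forall>x. \<exists>d>0. x \<in> {a..b} - E \<longrightarrow>
         (\<forall>y\<in>{a..b}. norm (y-x) < d \<longrightarrow> norm (f y - f x - (y-x) *\<^sub>R f' x) \<le> e1 * norm (y-x))"
    proof
      fix x
      show "\<exists>d>0. x \<in> {a..b} - E \<longrightarrow>
         (\<forall>y\<in>{a..b}. norm (y-x) < d \<longrightarrow> norm (f y - f x - (y-x) *\<^sub>R f' x) \<le> e1 * norm (y-x))"
      proof (cases "x \<in> {a..b} - E")
        case True
        then show ?thesis
          using der[OF True, unfolded has_vector_derivative_def has_derivative_within_alt] e1 by blast
      qed (auto intro: exI[of _ 1])
    qed
    then obtain r where r: "\<And>x. 0 < r x"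
      "\<And>x y. \<lbrakk>x \<in> {a..b} - E; y \<in> {a..b}; norm (y-x) < r x\<rbrakk>
                        \<Longrightarrow> norm (f y - f x - (y-x) *\<^sub>R f' x) \<le> e1 * norm (y-x)"
      by metis
    obtain d where d: "d > 0" "\<And>I. \<lbrakk>finite I; \<And>u v. (u, v) \<in> I \<Longrightarrow> u \<le> v \<and> {u..v} \<subseteq> {a..b};
       pairwise (\<lambda>(u, v) (u', v'). {u<..<v} \<inter> {u'<..<v'} = {}) I; (\<Sum>(u, v)\<in>I. v - u) < d\<rbrakk>
       \<Longrightarrow> (\<Sum>(u, v)\<in>I. dist (f u) (f v)) < e / 2"
      using abs_cont_onD[OF ac half_gt_zero[OF \<open>e > 0\<close>]] by blast
    have "((indicator E :: real \<Rightarrow> real) has_integral 0) {a..b}"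
      using E unfolding negligible_def box_real[symmetric] by blast
    from this[unfolded has_integral_real, rule_format, OF d(1)]
    obtain \<gamma> where \<gamma>: "gauge \<gamma>" "\<And>p. p tagged_division_of {a..b} \<Longrightarrow> \<gamma> fine p \<Longrightarrow>
        norm (\<Sum>(x,K)\<in>p. measure lborel K *\<^sub>R (indicator E x :: real)) < d"
      by fastforce
    show "\<exists>\<gamma>. gauge \<gamma> \<and> (\<forall>p. p tagged_division_of {a..b} \<and> \<gamma> fine p \<longrightarrow>
          norm ((\<Sum>(x,K)\<in>p. measure lborel K *\<^sub>R g x) - (f b - f a)) < e)"
    proof (intro exI[of _ "\<lambda>x. \<gamma> x \<inter> ball x (r x)"] conjI allI impI)
      show "gauge (\<lambda>x. \<gamma> x \<inter> ball x (r x))"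
        using \<gamma>(1) r(1) gauge_Int gauge_ball_dependent by blast
      fix p assume "p tagged_division_of {a..b} \<and> (\<lambda>x. \<gamma> x \<inter> ball x (r x)) fine p"
      then have p: "p tagged_division_of {a..b}" and f1: "\<gamma> fine p" and f2: "(\<lambda>x. ball x (r x)) fine p"
        by (auto simp: fine_Int)
      have fin: "finite p" using p by blast
      have ba: "b - a = (\<Sum>(x,K)\<in>p. Sup K - Inf K)" "f b - f a = (\<Sum>(x,K)\<in>p. f(Sup K) - f(Inf K))"
        using additive_tagged_division_1[where f= "\<lambda>x. x"] additive_tagged_division_1[where f= f] ab p
        by auto
      have shape: "\<exists>u v. K = {u..v} \<and> u \<le> v \<and> x \<in> {u..v} \<and> {u..v} \<subseteq> {a..b}" if "(x, K) \<in> p" for x K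
        using tagged_division_ofD(2,3,4)[OF p that] by (metis atLeastAtMost_iff box_real(2) order_trans)
      \<comment> \<open>Degenerate intervals are discarded so that the endpoint map is injective on
        \<open>P\<close>: distinct members have disjoint open interiors, and equal endpoints would
        force nonempty interiors to coincide. Their increments of \<open>f\<close> vanish
        anyway.\<close>
      define P where "P = {(x,K)\<in>p. x \<in> E \<and> Inf K < Sup K}"
      define B where "B = (\<lambda>(x::real,K). (Inf K, Sup K)) ` P"
      have P: "P \<subseteq> p" "finite P" using fin by (auto simp: P_def intro: finite_subset)
      have disj: "{Inf K<..<Sup K} \<inter> {Inf L<..<Sup L} = {}" if h: "(x,K) \<in> p" "(y,L) \<in> p" "(x,K) \<noteq> (y,L)" for x y K L
      proof -
        obtain u v where K: "K = {u..v}" "u \<le> v" using shape[OF h(1)] by blast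
        obtain u' v' where L: "L = {u'..v'}" "u' \<le> v'" using shape[OF h(2)] by blast
        have "interior K \<inter> interior L = {}" using tagged_division_ofD(5)[OF p h] .
        then show ?thesis using K L by (simp add: interior_atLeastAtMost_real)
      qed
      have inj: "inj_on (\<lambda>(x::real,K). (Inf K, Sup K)) P"
      proof (rule inj_onI, clarify)
        fix x K y L assume A: "(x, K) \<in> P" "(y, L) \<in> P" "Inf K = Inf L" "Sup K = Sup L"
        then have "{Inf K<..<Sup K} \<inter> {Inf L<..<Sup L} \<noteq> {}"
          by (simp add: P_def)
        then show "x = y \<and> K = L" using disj[of x K y L] A P(1) by blast
      qed
      have "(\<Sum>(u, v)\<in>B. dist (f u) (f v)) < e / 2"
      proof (rule d(2))
        show "finite B" using P by (simp add: B_def)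
        show "u \<le> v \<and> {u..v} \<subseteq> {a..b}" if uv: "(u, v) \<in> B" for u v
        proof -
          obtain x K where "(x, K) \<in> p" "u = Inf K" "v = Sup K" using uv by (auto simp: B_def P_def)
          moreover from this obtain u' v' where "K = {u'..v'}" "u' \<le> v'" "{u'..v'} \<subseteq> {a..b}" using shape by blast
          ultimately show ?thesis by simp
        qed
        show "pairwise (\<lambda>(u, v) (u', v'). {u<..<v} \<inter> {u'<..<v'} = {}) B"
        proof (rule pairwiseI)
          fix s t assume "s \<in> B" "t \<in> B" and st: "s \<noteq> t"
          then obtain x K y L where *: "(x, K) \<in> P" "(y, L) \<in> P" "s = (Inf K, Sup K)" "t = (Inf L, Sup L)"
            unfolding B_def by auto
          have "(x, K) \<noteq> (y, L)" using * st by blast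
          then show "(case s of (u, v) \<Rightarrow> \<lambda>(u', v'). {u<..<v} \<inter> {u'<..<v'} = {}) t"
            using disj[of x K y L] P(1) * by blast
        qed
        have "(\<Sum>(u, v)\<in>B. v - u) = (\<Sum>(x,K)\<in>P. Sup K - Inf K)"
          unfolding B_def by (subst sum.reindex[OF inj]) (simp add: case_prod_beta)
        also have "\<dots> = (\<Sum>(x,K)\<in>P. measure lborel K *\<^sub>R (indicator E x :: real))"
        proof (rule sum.cong, goal_cases)
          case (2 z)
          then obtain x K where z: "z = (x,K)" "(x,K) \<in> p" "x \<in> E" by (auto simp: P_def)
          then obtain u v where "K = {u..v}" "u \<le> v" using shape by blast
          then show ?case using z by simp
        qed auto
        also have "\<dots> \<le> (\<Sum>(x,K)\<in>p. measure lborel K *\<^sub>R (indicator E x :: real))"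
          by (rule sum_mono2) (use P fin in \<open>auto simp: indicator_def\<close>)
        also have "\<dots> < d" using \<gamma>(2)[OF p f1] by simp
        finally show "(\<Sum>(u, v)\<in>B. v - u) < d" .
      qed
      moreover have "(\<Sum>(u, v)\<in>B. dist (f u) (f v)) = (\<Sum>(x,K)\<in>P. dist (f (Inf K)) (f (Sup K)))"
        unfolding B_def by (subst sum.reindex[OF inj]) (simp add: case_prod_beta)
      moreover have "(\<Sum>(x,K)\<in>P. dist (f (Inf K)) (f (Sup K))) = (\<Sum>(x,K)\<in>p. if x \<in> E then dist (f (Inf K)) (f (Sup K)) else 0)"
      proof (rule sum.mono_neutral_cong_left, goal_cases)
        case 3
        show ?case
        proof clarify
          fix x K assume A: "(x, K) \<in> p" "(x,K) \<notin> P"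
          then obtain u v where K: "K = {u..v}" "u \<le> v" using shape by blast
          show "(if x \<in> E then dist (f (Inf K)) (f (Sup K)) else 0) = 0"
            using A K by (auto simp: P_def)
        qed
      qed (use P fin in \<open>auto simp: P_def\<close>)
      ultimately have sumE: "(\<Sum>(x,K)\<in>p. if x \<in> E then dist (f (Inf K)) (f (Sup K)) else 0) < e / 2"
        by simp
      have "norm ((\<Sum>(x,K)\<in>p. measure lborel K *\<^sub>R g x) - (f b - f a)) =
          norm (\<Sum>(x, K) \<in> p. (measure lborel K *\<^sub>R g x) - (f (Sup K) - f (Inf K)))"
        by (simp add: ba(2) sum_subtractf case_prod_beta)
      also have "\<dots> \<le> (\<Sum>(x,K)\<in>p. e1 * (Sup K - Inf K) + (if x \<in> E then dist (f (Inf K)) (f (Sup K)) else 0))"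
      proof (rule sum_norm_le, clarify)
        fix x K assume xK: "(x, K) \<in> p"
        then obtain u v where K: "K = {u..v}" "u \<le> v" "x \<in> {u..v}" "{u..v} \<subseteq> {a..b}" using shape by blast
        show "norm (measure lborel K *\<^sub>R g x - (f (Sup K) - f (Inf K)))
          \<le> e1 * (Sup K - Inf K) + (if x \<in> E then dist (f (Inf K)) (f (Sup K)) else 0)"
        proof (cases "x \<in> E")
          case True
          then show ?thesis using K e1 by (simp add: g_def dist_norm norm_minus_commute)
        next
          case False
          have ball: "\<forall>y\<in>K. y \<in> ball x (r x)" using f2 xK by blast
          \<comment> \<open>The increment is split at the tag, where the linear approximation is
            good on both sides; the two errors add up to \<open>e1\<close> times the length because
            \<open>x\<close> lies between \<open>u\<close> and \<open>v\<close>.\<close>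
          have "norm ((v - u) *\<^sub>R f' x - (f v - f u)) = norm (f u - f x - (u - x) *\<^sub>R f' x - (f v - f x - (v - x) *\<^sub>R f' x))"
            by (auto simp: algebra_simps)
          also have "\<dots> \<le> norm (f u - f x - (u - x) *\<^sub>R f' x) + norm (f v - f x - (v - x) *\<^sub>R f' x)"
            by (rule norm_triangle_ineq4)
          also have "\<dots> \<le> e1 * norm (u - x) + e1 * norm (v - x)"
          proof (intro add_mono r(2))
            show "norm (u - x) < r x" "norm (v - x) < r x"
              using bspec[OF ball, of u] bspec[OF ball, of v] K(1,2) by (simp_all add: dist_real_def abs_minus_commute)
          qed (use K False in auto)
          also have "\<dots> = e1 * (v - u)" using K by (simp add: algebra_simps)
          finally show ?thesis using K False by (simp add: g_def)
        qed
      qed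
      also have "\<dots> = e1 * (b - a) + (\<Sum>(x,K)\<in>p. if x \<in> E then dist (f (Inf K)) (f (Sup K)) else 0)"
        unfolding ba(1) by (simp add: sum.distrib sum_distrib_left case_prod_beta)
      also have "\<dots> < e1 * (b - a) + e / 2" using sumE by simp
      also have "\<dots> \<le> e" using \<open>e > 0\<close> ab by (simp add: e1_def field_simps)
      finally show "norm ((\<Sum>(x,K)\<in>p. measure lborel K *\<^sub>R g x) - (f b - f a)) < e" .
    qed
  qed
  then show ?thesis
    by (rule has_integral_spike[OF E, rotated]) (simp add: g_def)
qed

lemma abs_cont_on_cong: "(\<And>x. x \<in> S \<Longrightarrow> f x = g x) \<Longrightarrow> abs_cont_on S f \<Longrightarrow> abs_cont_on S g"
  by (rule abs_cont_on_comb[where f = f and g = f and C = 1]) auto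

lemma loc_abs_cont_cong: "(\<And>x. x \<ge> 0 \<Longrightarrow> f x = g x) \<Longrightarrow> loc_abs_cont f \<Longrightarrow> loc_abs_cont g"
  unfolding loc_abs_cont_def by (auto intro: abs_cont_on_cong[of _ f])

lemma loc_abs_cont_continuous:
  fixes f :: "real \<Rightarrow> 'a::metric_space"
  assumes "loc_abs_cont f"
  shows "continuous_on {0..} f"
proof -
  have "continuous (at x within {0..}) f" if "x \<ge> 0" for x
  proof -
    have "continuous_on {0..x+1} f"
      using assms that unfolding loc_abs_cont_def by (intro abs_cont_on_continuous) auto
    then have "continuous (at x within {0..x+1}) f"
      using that by (simp add: continuous_on_eq_continuous_within)
    moreover have "at x within {0..x+1} = at x within {0..}"
      by (rule at_within_nhd[of _ "{..<x+1}"]) (use that in auto)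
    ultimately show ?thesis by simp
  qed
  then show ?thesis by (simp add: continuous_on_eq_continuous_within)
qed

text \<open>The constant may depend on \<open>b\<close>, as products require: their factors are
  bounded on compact intervals only.\<close>

lemma loc_abs_cont_comb:
  assumes "loc_abs_cont f" "loc_abs_cont g"
    and "\<And>b. b \<ge> 0 \<Longrightarrow> \<exists>C\<ge>0. \<forall>u\<in>{0..b}. \<forall>v\<in>{0..b}. dist (h u) (h v) \<le> C * (dist (f u) (f v) + dist (g u) (g v))"
  shows "loc_abs_cont h"
  unfolding loc_abs_cont_def
proof (intro allI impI)
  fix b :: real assume b: "b \<ge> 0"
  obtain C where "C \<ge> 0" "\<And>u v. u \<in> {0..b} \<Longrightarrow> v \<in> {0..b} \<Longrightarrow> dist (h u) (h v) \<le> C * (dist (f u) (f v) + dist (g u) (g v))"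
    using assms(3)[OF b] by blast
  moreover have "abs_cont_on {0..b} f" "abs_cont_on {0..b} g"
    using assms(1,2) b unfolding loc_abs_cont_def by blast+
  ultimately show "abs_cont_on {0..b} h" by (rule abs_cont_on_comb[rotated 2])
qed

lemma loc_abs_cont_mult:
  fixes f g :: "real \<Rightarrow> 'a::real_normed_algebra"
  assumes f: "loc_abs_cont f" and g: "loc_abs_cont g"
  shows "loc_abs_cont (\<lambda>x. f x * g x)"
proof (rule loc_abs_cont_comb[OF f g])
  fix b :: real assume "b \<ge> 0"
  have "bounded (f ` {0..b})" "bounded (g ` {0..b})"
    using loc_abs_cont_continuous[OF f] loc_abs_cont_continuous[OF g]
    by (auto intro!: compact_imp_bounded compact_continuous_image elim: continuous_on_subset)
  then obtain A B where A: "A > 0" "\<And>x. x \<in> {0..b} \<Longrightarrow> norm (f x) \<le> A"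
    and B: "B > 0" "\<And>x. x \<in> {0..b} \<Longrightarrow> norm (g x) \<le> B"
    unfolding bounded_pos by auto
  have "dist (f u * g u) (f v * g v) \<le> max A B * (dist (f u) (f v) + dist (g u) (g v))"
    if "u \<in> {0..b}" "v \<in> {0..b}" for u v
  proof -
    have "dist (f u * g u) (f v * g v) = norm ((f u - f v) * g u + f v * (g u - g v))"
      by (simp add: dist_norm algebra_simps)
    also have "\<dots> \<le> norm (f u - f v) * norm (g u) + norm (f v) * norm (g u - g v)"
      by (intro norm_triangle_mono norm_mult_ineq)
    also have "\<dots> \<le> norm (f u - f v) * max A B + max A B * norm (g u - g v)"
      using A(2)[OF that(2)] B(2)[OF that(1)] by (intro add_mono mult_left_mono mult_right_mono) auto
    finally show ?thesis by (simp add: dist_norm algebra_simps)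
  qed
  then show "\<exists>C\<ge>0. \<forall>u\<in>{0..b}. \<forall>v\<in>{0..b}. dist (f u * g u) (f v * g v) \<le> C * (dist (f u) (f v) + dist (g u) (g v))"
    using A(1) by (intro exI[of _ "max A B"]) auto
qed

lemma loc_abs_cont_add:
  fixes f g :: "real \<Rightarrow> 'a::real_normed_vector"
  assumes "loc_abs_cont f" "loc_abs_cont g"
  shows "loc_abs_cont (\<lambda>x. f x + g x)"
  by (rule loc_abs_cont_comb[OF assms]) (auto intro!: exI[of _ 1] simp: dist_triangle_add)

lemma loc_abs_cont_diff:
  fixes f g :: "real \<Rightarrow> 'a::real_normed_vector"
  assumes "loc_abs_cont f" "loc_abs_cont g"
  shows "loc_abs_cont (\<lambda>x. f x - g x)"
proof (rule loc_abs_cont_comb[OF assms])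
  have "dist (f u - g u) (f v - g v) \<le> 1 * (dist (f u) (f v) + dist (g u) (g v))" for u v
    using norm_triangle_ineq4[of "f u - f v" "g u - g v"] by (simp add: dist_norm algebra_simps)
  then show "\<exists>C\<ge>0. \<forall>u\<in>{0..b}. \<forall>v\<in>{0..b}. dist (f u - g u) (f v - g v) \<le> C * (dist (f u) (f v) + dist (g u) (g v))" for b
    by (intro exI[of _ 1]) auto
qed

lemma loc_abs_cont_const: "loc_abs_cont (\<lambda>x. c)"
  unfolding loc_abs_cont_def by (auto intro: abs_cont_on_lipschitz[where C = 0])

lemma loc_abs_cont_contraction:
  assumes "loc_abs_cont f" "\<And>u v. dist (h u) (h v) \<le> dist (f u) (f v)"
  shows "loc_abs_cont h"
  by (rule loc_abs_cont_comb[OF assms(1) assms(1)]) (use assms(2) in \<open>auto intro!: exI[of _ "1::real"] intro: order_trans[OF assms(2)]\<close>)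

lemma loc_abs_cont_cnj: "loc_abs_cont f \<Longrightarrow> loc_abs_cont (\<lambda>x. cnj (f x))"
  by (rule loc_abs_cont_contraction) (auto simp: dist_norm simp flip: complex_cnj_diff)

lemma vector_derivative_norm_bound:
  fixes f :: "real \<Rightarrow> 'a::real_normed_vector"
  assumes "convex S" "\<And>x. x \<in> S \<Longrightarrow> (f has_vector_derivative d x) (at x within S)"
    "\<And>x. x \<in> S \<Longrightarrow> norm (d x) \<le> B" "u \<in> S" "v \<in> S"
  shows "norm (f v - f u) \<le> B * norm (v - u)"
proof (rule differentiable_bound[OF assms(1) _ _ assms(5,4)])
  show "(f has_derivative (\<lambda>h. h *\<^sub>R d x)) (at x within S)" if "x \<in> S" for x
    using assms(2)[OF that] by (simp add: has_vector_derivative_def)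
  show "onorm (\<lambda>h. h *\<^sub>R d x) \<le> B" if "x \<in> S" for x
  proof (rule onorm_le)
    fix h :: real
    show "norm (h *\<^sub>R d x) \<le> B * norm h"
      using mult_right_mono[OF assms(3)[OF that], of "\<bar>h\<bar>"] by (simp add: mult.commute)
  qed
qed

lemma loc_abs_cont_C1:
  fixes f :: "real \<Rightarrow> 'a::real_normed_vector"
  assumes der: "\<And>x. x \<ge> 0 \<Longrightarrow> (f has_vector_derivative d x) (at x within {0..})"
    and d: "continuous_on {0..} d"
  shows "loc_abs_cont f"
  unfolding loc_abs_cont_def
proof (intro allI impI)
  fix b :: real assume "b \<ge> 0"
  have "bounded (d ` {0..b})"
    using d by (auto intro!: compact_imp_bounded compact_continuous_image elim: continuous_on_subset)
  then obtain B where B: "B > 0" "\<And>x. x \<in> {0..b} \<Longrightarrow> norm (d x) \<le> B"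
    unfolding bounded_pos by auto
  have "norm (f v - f u) \<le> B * norm (v - u)" if "u \<in> {0..b}" "v \<in> {0..b}" for u v
  proof (rule vector_derivative_norm_bound[where S = "{0..b}" and d = d])
    show "(f has_vector_derivative d x) (at x within {0..b})" if "x \<in> {0..b}" for x
      using der[of x] that by (auto elim: has_vector_derivative_within_subset)
  qed (use that B in auto)
  then show "abs_cont_on {0..b} f"
    using B(1) by (intro abs_cont_on_lipschitz[of B]) (auto simp: dist_norm)
qed

section \<open>Null sets and derivatives on the half-line\<close>

lemma AE_lebesgue_negligible:
  assumes "AE x in lebesgue. P x"
  obtains E where "negligible E" "\<And>x. x \<notin> E \<Longrightarrow> P x"
proof -
  obtain E where "E \<in> null_sets lebesgue" "{x \<in> space lebesgue. \<not> P x} \<subseteq> E"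
    using assms by (auto simp: eventually_ae_filter)
  then show ?thesis using that[of E] by (auto simp: negligible_iff_null_sets)
qed

lemma has_integral_loc_abs_cont:
  fixes f :: "real \<Rightarrow> 'a::banach"
  assumes ac: "loc_abs_cont f" and st: "0 \<le> s" "s \<le> t"
    and der: "AE x in lebesgue. x > 0 \<longrightarrow> (f has_vector_derivative f' x) (at x)"
  shows "(f' has_integral (f t - f s)) {s..t}"
proof -
  obtain E where E: "negligible E" "\<And>x. x \<notin> E \<Longrightarrow> x > 0 \<longrightarrow> (f has_vector_derivative f' x) (at x)"
    using AE_lebesgue_negligible[OF der] by blast
  have "abs_cont_on {0..t} f" using ac st unfolding loc_abs_cont_def by simp
  then have "abs_cont_on {s..t} f" using st by (auto elim: abs_cont_on_subset)
  then show ?thesis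
  \<comment> \<open>The derivative is prescribed for \<open>x > 0\<close> only, so the point 0 joins
    the exceptional set.\<close>
  proof (rule has_integral_abs_cont[OF st(2), where E = "insert 0 E"])
    show "(f has_vector_derivative f' x) (at x within {s..t})" if "x \<in> {s..t} - insert 0 E" for x
      using E(2)[of x] that st has_vector_derivative_at_within by fastforce
  qed (use E in auto)
qed

text \<open>The form in which the equation is used quantitatively: a bound on the derivative that
  holds almost everywhere bounds the increment. All Gronwall and mode estimates rest on it.\<close>

lemma loc_abs_cont_diff_bound:
  fixes f :: "real \<Rightarrow> 'a::banach"
  assumes ac: "loc_abs_cont f" and st: "0 \<le> s" "s \<le> t"
    and der: "AE x in lebesgue. x > 0 \<longrightarrow> (f has_vector_derivative f' x) (at x)"
    and B: "B integrable_on {s..t}" "AE x in lebesgue. x > 0 \<longrightarrow> x \<in> {s..t} \<longrightarrow> norm (f' x) \<le> B x"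
  shows "norm (f t - f s) \<le> integral {s..t} B"
proof -
  obtain E where E: "negligible E" "\<And>x. x \<notin> E \<Longrightarrow> x > 0 \<longrightarrow> x \<in> {s..t} \<longrightarrow> norm (f' x) \<le> B x"
    using AE_lebesgue_negligible[OF B(2)] by blast
  \<comment> \<open>The comparison of integrals wants a pointwise inequality, so derivative and
    bound are both set to 0 on the exceptional null set.\<close>
  define g where "g x = (if x \<in> insert 0 E then 0 else f' x)" for x
  define C where "C x = (if x \<in> insert 0 E then 0 else B x)" for x
  have neg: "negligible (insert 0 E)" using E by simp
  have g: "(g has_integral (f t - f s)) {s..t}"
    using has_integral_loc_abs_cont[OF ac st der]
    by (rule has_integral_spike[OF neg, rotated]) (auto simp: g_def)
  have C: "(C has_integral integral {s..t} B) {s..t}"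
    using integrable_integral[OF B(1)]
    by (rule has_integral_spike[OF neg, rotated]) (auto simp: C_def)
  have "norm (integral {s..t} g) \<le> integral {s..t} C"
  proof (rule integral_norm_bound_integral)
    show "norm (g x) \<le> C x" if "x \<in> {s..t}" for x
      using E(2)[of x] that st by (auto simp: g_def C_def)
  qed (use g C in blast)+
  then show ?thesis using g C by (simp add: integral_unique)
qed

lemma at_within_halfline_neq_bot: "x \<ge> 0 \<Longrightarrow> at (x::real) within {0..} \<noteq> bot"
proof -
  assume "x \<ge> 0"
  then have "at_right x \<le> at x within {0..}" by (intro at_le) auto
  then show ?thesis using trivial_limit_at_right_real[of x] by (metis le_bot)
qed

lemma hl_deriv_eqI:
  "x \<ge> 0 \<Longrightarrow> (f has_vector_derivative d) (at x within {0..}) \<Longrightarrow> hl_deriv f x = d"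
  unfolding hl_deriv_def by (rule vector_derivative_within[OF at_within_halfline_neq_bot])

lemma loc_abs_cont1D:
  fixes f :: "real \<Rightarrow> 'a::real_normed_vector"
  assumes "loc_abs_cont1 f"
  shows "x \<ge> 0 \<Longrightarrow> (f has_vector_derivative hl_deriv f x) (at x within {0..})"
    and "loc_abs_cont (hl_deriv f)"
  using assms unfolding loc_abs_cont1_def hl_deriv_def by (auto simp: vector_derivative_works)

lemma loc_abs_cont1_nth:
  fixes F :: "real \<Rightarrow> complex^2"
  assumes "loc_abs_cont1 F"
  shows "loc_abs_cont1 (\<lambda>x. F x $ i)" "x \<ge> 0 \<Longrightarrow> hl_deriv (\<lambda>x. F x $ i) x = hl_deriv F x $ i"
    "loc_abs_cont (\<lambda>x. hl_deriv F x $ i)"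
    "x \<ge> 0 \<Longrightarrow> ((\<lambda>x. F x $ i) has_vector_derivative hl_deriv F x $ i) (at x within {0..})"
proof -
  have d: "((\<lambda>x. F x $ i) has_vector_derivative hl_deriv F x $ i) (at x within {0..})" if "x \<ge> 0" for x
    using loc_abs_cont1D(1)[OF assms that] bounded_linear.has_vector_derivative bounded_linear_vec_nth by blast
  then show "x \<ge> 0 \<Longrightarrow> ((\<lambda>x. F x $ i) has_vector_derivative hl_deriv F x $ i) (at x within {0..})" .
  have eq: "hl_deriv (\<lambda>x. F x $ i) x = hl_deriv F x $ i" if "x \<ge> 0" for x
    using d[OF that] that hl_deriv_eqI by blast
  then show "x \<ge> 0 \<Longrightarrow> hl_deriv (\<lambda>x. F x $ i) x = hl_deriv F x $ i" .
  have ac: "loc_abs_cont (\<lambda>x. hl_deriv F x $ i)"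
    by (rule loc_abs_cont_contraction[OF loc_abs_cont1D(2)[OF assms]]) (rule dist_vec_nth_le)
  then show "loc_abs_cont (\<lambda>x. hl_deriv F x $ i)" .
  then have "loc_abs_cont (hl_deriv (\<lambda>x. F x $ i))" by (rule loc_abs_cont_cong[rotated]) (simp add: eq)
  moreover have "loc_abs_cont (\<lambda>x. F x $ i)"
    by (rule loc_abs_cont_contraction[of F]) (use assms dist_vec_nth_le in \<open>auto simp: loc_abs_cont1_def\<close>)
  moreover have "\<forall>x\<ge>0. (\<lambda>x. F x $ i) differentiable at x within {0..}"
    using d differentiableI_vector by blast
  ultimately show "loc_abs_cont1 (\<lambda>x. F x $ i)" unfolding loc_abs_cont1_def by blast
qed

text \<open>Applying epsilon to the hermitised equation swaps its two rows, so each component of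
  \<open>D\<close> has its own potential term and the spectral parameter couples the components.
  Carrying \<open>D\<close> explicitly allows linear combinations, conjugates and functions
  assembled from scalar ones to be formed without recomputing derivatives.\<close>

definition cauchy_sol ::
    "(real \<Rightarrow> complex) \<Rightarrow> complex \<Rightarrow> (real \<Rightarrow> complex^2) \<Rightarrow> (real \<Rightarrow> complex^2) \<Rightarrow> bool" where
  "cauchy_sol q z F D \<longleftrightarrow>
     (\<forall>x\<ge>0. \<forall>i. ((\<lambda>x. F x $ i) has_vector_derivative D x $ i) (at x within {0..})) \<and>
     (\<forall>i. loc_abs_cont (\<lambda>x. D x $ i)) \<and>
     (AE x in lebesgue. x > 0 \<longrightarrow>
        ((\<lambda>x. D x $ 1) has_vector_derivative cnj (q x) * F x $ 1 - z * F x $ 2) (at x) \<and>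
        ((\<lambda>x. D x $ 2) has_vector_derivative q x * F x $ 2 - z * F x $ 1) (at x))"

lemma cauchy_sol_der: "cauchy_sol q z F D \<Longrightarrow> x \<ge> 0 \<Longrightarrow> ((\<lambda>x. F x $ i) has_vector_derivative D x $ i) (at x within {0..})"
  by (simp add: cauchy_sol_def)

lemma cauchy_sol_der_at:
  assumes "cauchy_sol q z F D" "x > 0"
  shows "((\<lambda>x. F x $ i) has_vector_derivative D x $ i) (at x)"
proof -
  have "at x within {0..} = at x"
    by (rule at_within_nhd[of _ "{0<..}"]) (use assms(2) in auto)
  then show ?thesis using cauchy_sol_der[OF assms(1), of x i] assms(2) by simp
qed

lemma cauchy_sol_ac: "cauchy_sol q z F D \<Longrightarrow> loc_abs_cont (\<lambda>x. D x $ i)"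
  by (simp add: cauchy_sol_def)

lemma cauchy_sol_cont':
  assumes "cauchy_sol q z F D" shows "continuous_on {0..} (\<lambda>x. D x $ i)"
  using cauchy_sol_ac[OF assms] by (rule loc_abs_cont_continuous)

lemma cauchy_sol_ac':
  assumes "cauchy_sol q z F D" shows "loc_abs_cont (\<lambda>x. F x $ i)"
  using cauchy_sol_der[OF assms] cauchy_sol_cont'[OF assms] by (rule loc_abs_cont_C1)

lemma cauchy_sol_cont:
  assumes "cauchy_sol q z F D" shows "continuous_on {0..} (\<lambda>x. F x $ i)"
  using cauchy_sol_ac'[OF assms] by (rule loc_abs_cont_continuous)

lemma cauchy_sol_AE:
  assumes "cauchy_sol q z F D"
  shows "AE x in lebesgue. x > 0 \<longrightarrow>
        ((\<lambda>x. D x $ 1) has_vector_derivative cnj (q x) * F x $ 1 - z * F x $ 2) (at x) \<and>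
        ((\<lambda>x. D x $ 2) has_vector_derivative q x * F x $ 2 - z * F x $ 1) (at x)"
  using assms by (simp add: cauchy_sol_def)

lemma cauchy_sol_lin:
  assumes F: "cauchy_sol q z F D" and G: "cauchy_sol q z G E"
  shows "cauchy_sol q z (\<lambda>x. a *s F x + b *s G x) (\<lambda>x. a *s D x + b *s E x)"
  unfolding cauchy_sol_def
proof (intro conjI allI impI)
  show "((\<lambda>x. (a *s F x + b *s G x) $ i) has_vector_derivative (a *s D x + b *s E x) $ i) (at x within {0..})"
    if "x \<ge> 0" for x i
    using cauchy_sol_der[OF F that, of i] cauchy_sol_der[OF G that, of i]
    by (auto intro!: derivative_eq_intros)
  show "loc_abs_cont (\<lambda>x. (a *s D x + b *s E x) $ i)" for i
    by (simp add: loc_abs_cont_add loc_abs_cont_mult loc_abs_cont_const cauchy_sol_ac[OF F] cauchy_sol_ac[OF G])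
  show "AE x in lebesgue. x > 0 \<longrightarrow>
        ((\<lambda>x. (a *s D x + b *s E x) $ 1) has_vector_derivative cnj (q x) * (a *s F x + b *s G x) $ 1 - z * (a *s F x + b *s G x) $ 2) (at x) \<and>
        ((\<lambda>x. (a *s D x + b *s E x) $ 2) has_vector_derivative q x * (a *s F x + b *s G x) $ 2 - z * (a *s F x + b *s G x) $ 1) (at x)"
    using cauchy_sol_AE[OF F] cauchy_sol_AE[OF G]
    by eventually_elim (auto intro!: derivative_eq_intros simp: algebra_simps)
qed

text \<open>The antilinear map F -> epsilon conj(F). It turns solutions at z into solutions at conj
  z, commutes with the boundary functionals, and makes the bilinear Wronskian sesquilinear when
  applied to one argument.\<close>

definition dag :: "complex^2 \<Rightarrow> complex^2" where "dag v = vector [cnj (v $ 2), cnj (v $ 1)]"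

lemma dag_nth [simp]: "dag v $ 1 = cnj (v $ 2)" "dag v $ 2 = cnj (v $ 1)"
  by (simp_all add: dag_def vector_2)

lemma cauchy_sol_dag:
  assumes F: "cauchy_sol q z F D"
  shows "cauchy_sol q (cnj z) (\<lambda>x. dag (F x)) (\<lambda>x. dag (D x))"
  unfolding cauchy_sol_def
proof (intro conjI allI impI)
  show "((\<lambda>x. dag (F x) $ i) has_vector_derivative dag (D x) $ i) (at x within {0..})"
    if "x \<ge> 0" for x i
    using exhaust_2[of i] cauchy_sol_der[OF F that]
    by (auto intro!: has_vector_derivative_cnj)
  show "loc_abs_cont (\<lambda>x. dag (D x) $ i)" for i
    using exhaust_2[of i] by (auto intro!: loc_abs_cont_cnj cauchy_sol_ac[OF F])
  show "AE x in lebesgue. x > 0 \<longrightarrow>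
        ((\<lambda>x. dag (D x) $ 1) has_vector_derivative cnj (q x) * dag (F x) $ 1 - cnj z * dag (F x) $ 2) (at x) \<and>
        ((\<lambda>x. dag (D x) $ 2) has_vector_derivative q x * dag (F x) $ 2 - cnj z * dag (F x) $ 1) (at x)"
    using cauchy_sol_AE[OF F]
  proof eventually_elim
    case (elim x)
    show ?case
    proof
      assume "x > 0"
      then have "((\<lambda>x. D x $ 1) has_vector_derivative cnj (q x) * F x $ 1 - z * F x $ 2) (at x)"
        "((\<lambda>x. D x $ 2) has_vector_derivative q x * F x $ 2 - z * F x $ 1) (at x)" using elim by auto
      from this[THEN has_vector_derivative_cnj]
      show "((\<lambda>x. dag (D x) $ 1) has_vector_derivative cnj (q x) * dag (F x) $ 1 - cnj z * dag (F x) $ 2) (at x) \<and>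
        ((\<lambda>x. dag (D x) $ 2) has_vector_derivative q x * dag (F x) $ 2 - cnj z * dag (F x) $ 1) (at x)"
        by simp
    qed
  qed
qed

lemma herm_solution_sol:
  assumes "herm_solution q z F"
  shows "cauchy_sol q z F (hl_deriv F)"
  unfolding cauchy_sol_def
proof (intro conjI allI impI)
  have ac: "loc_abs_cont1 F" using assms by (simp add: herm_solution_def)
  show "((\<lambda>x. F x $ i) has_vector_derivative hl_deriv F x $ i) (at x within {0..})"
    if "x \<ge> 0" for x i using loc_abs_cont1_nth(4)[OF ac that] .
  show "loc_abs_cont (\<lambda>x. hl_deriv F x $ i)" for i by (rule loc_abs_cont1_nth(3)[OF ac])
  have "AE x in lebesgue. x > 0 \<longrightarrow>
        (\<exists>F2. (hl_deriv F has_vector_derivative F2) (at x) \<and>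
              - (eps_mat *v F2) + pot_mat (q x) *v F x = z *s F x)"
    using assms by (simp add: herm_solution_def)
  then show "AE x in lebesgue. x > 0 \<longrightarrow>
        ((\<lambda>x. hl_deriv F x $ 1) has_vector_derivative cnj (q x) * F x $ 1 - z * F x $ 2) (at x) \<and>
        ((\<lambda>x. hl_deriv F x $ 2) has_vector_derivative q x * F x $ 2 - z * F x $ 1) (at x)"
  proof eventually_elim
    case (elim x)
    show ?case
    proof
      assume "x > 0"
      then obtain F2 where F2: "(hl_deriv F has_vector_derivative F2) (at x)"
        "- (eps_mat *v F2) + pot_mat (q x) *v F x = z *s F x" using elim by blast
      have "(- (eps_mat *v F2) + pot_mat (q x) *v F x) $ i = (z *s F x) $ i" for i
        using F2(2) by simp
      from this[of 1] this[of 2]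
      have "F2 $ 2 = q x * F x $ 2 - z * F x $ 1" "F2 $ 1 = cnj (q x) * F x $ 1 - z * F x $ 2"
        by (simp_all add: eps_mat_def pot_mat_def matrix_vector_mult_def sum_2 vector_2 algebra_simps)
      moreover have "((\<lambda>x. hl_deriv F x $ i) has_vector_derivative F2 $ i) (at x)" for i
        using F2(1) bounded_linear.has_vector_derivative bounded_linear_vec_nth by blast
      ultimately show "((\<lambda>x. hl_deriv F x $ 1) has_vector_derivative cnj (q x) * F x $ 1 - z * F x $ 2) (at x) \<and>
        ((\<lambda>x. hl_deriv F x $ 2) has_vector_derivative q x * F x $ 2 - z * F x $ 1) (at x)"
        by metis
    qed
  qed
qed

section \<open>Growth of solutions\<close>

text \<open>The partial integrals increase to a finite supremum; past a point within
  \<open>e\<close> of it at most \<open>e\<close> can be added. No order of \<open>x\<close> and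
  \<open>y\<close> is required, the integral over an empty interval being 0.\<close>

lemma integral_tail_small:
  fixes f :: "real \<Rightarrow> real"
  assumes f: "f integrable_on {0..}" "\<And>x. x \<ge> 0 \<Longrightarrow> f x \<ge> 0" and e: "e > 0"
  shows "\<exists>X\<ge>0. \<forall>x\<ge>X. \<forall>y. integral {x..y} f \<le> e"
proof -
  have sub: "f integrable_on {s..t}" if "0 \<le> s" for s t
    using integrable_on_subinterval[OF f(1), of s t] that by auto
  define g where "g x = integral {0..x} f" for x
  have bdd: "bdd_above (g ` {0..})"
  proof (rule bdd_aboveI2)
    show "g x \<le> integral {0..} f" if "x \<in> {0..}" for x
      unfolding g_def by (rule integral_subset_le) (use sub f in auto)
  qed
  obtain X where X: "X \<ge> 0" "g X > (SUP x\<in>{0..}. g x) - e"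
    using less_cSUP_iff[OF _ bdd, of "(SUP x\<in>{0..}. g x) - e"] e by auto
  have "integral {x..y} f \<le> e" if "x \<ge> X" for x y
  proof (cases "x \<le> y")
    case True
    have "g y = g x + integral {x..y} f"
      unfolding g_def using Henstock_Kurzweil_Integration.integral_combine[of 0 x y f] sub that X True by simp
    moreover have "g y \<le> (SUP x\<in>{0..}. g x)" using True that X by (intro cSUP_upper bdd) auto
    moreover have "g X \<le> g x" unfolding g_def by (rule integral_subset_le) (use sub f that X in auto)
    ultimately show ?thesis using X by simp
  qed (use e in simp)
  then show ?thesis using X(1) by blast
qed

text \<open>The constant depends on \<open>h\<close> and \<open>X\<close> alone, which gives
  uniformity over solutions and spectral parameters. On an interval where \<open>h\<close>
  integrates to at most 1/2, the maximum of \<open>N\<close> exceeds either end value by at most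
  half of itself, hence is at most twice that value; chaining such intervals works in both
  directions and gives a power of 2.\<close>

lemma gronwall_two_sided:
  fixes h :: "real \<Rightarrow> real"
  assumes h: "h integrable_on {0..X}"
  shows "\<exists>C\<ge>1. \<forall>N. continuous_on {0..X} N \<longrightarrow> (\<forall>x\<in>{0..X}. N x \<ge> 0) \<longrightarrow>
     (\<forall>s t S. 0 \<le> s \<longrightarrow> s \<le> t \<longrightarrow> t \<le> X \<longrightarrow> (\<forall>x\<in>{s..t}. N x \<le> S) \<longrightarrow> \<bar>N t - N s\<bar> \<le> S * integral {s..t} h) \<longrightarrow>
     (\<forall>s\<in>{0..X}. \<forall>t\<in>{0..X}. N s \<le> C * (N t :: real))"
proof -
  have "uniformly_continuous_on {0..X} (\<lambda>x. integral {0..x} h)"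
    by (intro compact_uniformly_continuous indefinite_integral_continuous_1 h) auto
  then obtain d where d: "d > 0" "\<And>x y. x \<in> {0..X} \<Longrightarrow> y \<in> {0..X} \<Longrightarrow> dist y x < d \<Longrightarrow>
      dist (integral {0..y} h) (integral {0..x} h) < 1/2"
    unfolding uniformly_continuous_on_def by (metis half_gt_zero zero_less_one)
  have half: "integral {s..t} h \<le> 1/2" if st: "0 \<le> s" "s \<le> t" "t \<le> X" "t - s < d" for s t
  proof -
    have "integral {0..t} h = integral {0..s} h + integral {s..t} h"
      using Henstock_Kurzweil_Integration.integral_combine[of 0 s t h] st integrable_on_subinterval[OF h, of 0 t] by auto
    then show ?thesis using d(2)[of s t] st by (auto simp: dist_real_def)
  qed
  \<comment> \<open>Steps of length \<open>d/2\<close> stay strictly below the modulus of continuity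
    \<open>d\<close>, and \<open>n\<close> of them cross the whole interval.\<close>
  obtain n :: nat where n: "X < n * (d/2)"
    using reals_Archimedean3[of "d/2"] d(1) by auto
  show ?thesis
  proof (intro exI[of _ "2^n"] conjI allI impI)
    fix N :: "real \<Rightarrow> real"
    assume N: "continuous_on {0..X} N" "\<forall>x\<in>{0..X}. N x \<ge> 0"
      and step: "\<forall>s t S. 0 \<le> s \<longrightarrow> s \<le> t \<longrightarrow> t \<le> X \<longrightarrow> (\<forall>x\<in>{s..t}. N x \<le> S) \<longrightarrow> \<bar>N t - N s\<bar> \<le> S * integral {s..t} h"
    have one: "N s \<le> 2 * N t \<and> N t \<le> 2 * N s" if st: "0 \<le> s" "s \<le> t" "t \<le> X" "t - s < d" for s t
    proof -
      have "continuous_on {s..t} N" using N(1) st by (auto elim: continuous_on_subset)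
      then obtain m where m: "m \<in> {s..t}" "\<And>x. x \<in> {s..t} \<Longrightarrow> N x \<le> N m"
        using continuous_attains_sup[of "{s..t}" N] st by auto
      have m0: "N m \<ge> 0" using N(2) m st by auto
      have "\<bar>N m - N s\<bar> \<le> N m * integral {s..m} h" "\<bar>N t - N m\<bar> \<le> N m * integral {m..t} h"
        using step[rule_format, of s m "N m"] step[rule_format, of m t "N m"] st m by auto
      moreover have "N m * integral {s..m} h \<le> N m * (1/2)" "N m * integral {m..t} h \<le> N m * (1/2)"
        using half st m m0 by (auto intro!: mult_left_mono simp del: times_divide_eq_right)
      ultimately have "N m \<le> 2 * N s" "N m \<le> 2 * N t" by auto
      then show ?thesis using m(2)[of s] m(2)[of t] st by auto
    qed
    have "N s \<le> 2^j * N t" if "s \<in> {0..X}" "t \<in> {0..X}" "\<bar>s - t\<bar> \<le> j * (d/2)" for j s t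
      using that
    proof (induction j arbitrary: s)
      case 0
      then show ?case by simp
    next
      case (Suc j)
      define u where "u = (if s \<le> t then min t (s + d/2) else max t (s - d/2))"
      have u: "u \<in> {0..X}" "\<bar>u - t\<bar> \<le> j * (d/2)" "\<bar>s - u\<bar> < d"
        using Suc.prems d(1) unfolding u_def by (auto simp: min_def max_def algebra_simps split: if_splits)
      have "N s \<le> 2 * N u"
        using one[of s u] one[of u s] u Suc.prems by (cases "s \<le> u") auto
      moreover have "N u \<le> 2^j * N t" using Suc.IH[OF u(1) Suc.prems(2) u(2)] .
      ultimately show ?case by simp
    qed
    moreover have "\<bar>s - t\<bar> \<le> n * (d/2)" if "s \<in> {0..X}" "t \<in> {0..X}" for s t
      using that n unfolding atLeastAtMost_iff by linarith
    ultimately have "N s \<le> 2^n * N t" if "s \<in> {0..X}" "t \<in> {0..X}" for s t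
      using that by blast
    then show "\<forall>s\<in>{0..X}. \<forall>t\<in>{0..X}. N s \<le> 2^n * N t" by blast
  qed auto
qed

definition data_norm :: "complex^2 \<Rightarrow> complex^2 \<Rightarrow> real" where
  "data_norm v w = cmod (v $ 1) + cmod (v $ 2) + cmod (w $ 1) + cmod (w $ 2)"

lemma data_norm_nonneg: "data_norm v w \<ge> 0"
  by (simp add: data_norm_def)

lemma data_norm_eq_0: "data_norm v w = 0 \<longleftrightarrow> v = 0 \<and> w = 0"
  by (auto simp: data_norm_def vec_eq_iff forall_2 add_nonneg_eq_0_iff)

lemma data_norm_bounds:
  "cmod (v $ i) \<le> data_norm v w" "cmod (w $ i) \<le> data_norm v w"
  using exhaust_2[of i] by (auto simp: data_norm_def add_increasing add_increasing2)

lemma data_norm_triangle: "data_norm (v + v') (w + w') \<le> data_norm v w + data_norm v' w'"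
  unfolding data_norm_def using norm_triangle_ineq[of "v$1" "v'$1"] norm_triangle_ineq[of "v$2" "v'$2"]
     norm_triangle_ineq[of "w$1" "w'$1"] norm_triangle_ineq[of "w$2" "w'$2"] by simp

lemma data_norm_scale: "data_norm (c *s v) (c *s w) = cmod c * data_norm v w"
  by (simp add: data_norm_def norm_mult algebra_simps)

text \<open>Stands in for square integrability: solutions in L^2 have this property, and it is
  exactly what removes boundary terms at infinity. It constrains the derivative as well as the
  value.\<close>

definition decays :: "(real \<Rightarrow> complex^2) \<Rightarrow> (real \<Rightarrow> complex^2) \<Rightarrow> bool" where
  "decays F D \<longleftrightarrow> ((\<lambda>x. data_norm (F x) (D x)) \<longlongrightarrow> 0) at_top"

lemma decays_lin:
  assumes "decays F D" "decays G E"
  shows "decays (\<lambda>x. a *s F x + b *s G x) (\<lambda>x. a *s D x + b *s E x)"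
  unfolding decays_def
proof (rule tendsto_sandwich[where f = "\<lambda>_. 0"])
  show "((\<lambda>x. cmod a * data_norm (F x) (D x) + cmod b * data_norm (G x) (E x)) \<longlongrightarrow> 0) at_top"
    using assms unfolding decays_def by (auto intro!: tendsto_eq_intros)
  show "\<forall>\<^sub>F x in at_top. data_norm (a *s F x + b *s G x) (a *s D x + b *s E x) \<le> cmod a * data_norm (F x) (D x) + cmod b * data_norm (G x) (E x)"
    by (rule always_eventually, rule allI, rule order_trans[OF data_norm_triangle]) (simp add: data_norm_scale)
qed (auto intro!: always_eventually data_norm_nonneg)

lemma cauchy_sol_zero: "cauchy_sol q z (\<lambda>_. 0) (\<lambda>_. 0)"
  by (auto simp: cauchy_sol_def loc_abs_cont_const intro!: derivative_eq_intros)

lemma data_norm_sol_cont: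
  assumes "cauchy_sol q z F D"
  shows "continuous_on {0..} (\<lambda>x. data_norm (F x) (D x))"
  unfolding data_norm_def by (intro continuous_intros cauchy_sol_cont[OF assms] cauchy_sol_cont'[OF assms])

text \<open>Variation of constants with the integrating factor exp((c - x) m). The sign condition
  says that this factor has modulus at most 1 on the interval, so the source enters with weight at
  most 1. Taking \<open>c\<close> as the right or left endpoint gives the next two lemmas.\<close>

lemma exp_weighted_diff_bound:
  fixes u :: "real \<Rightarrow> complex"
  assumes ac: "loc_abs_cont u" and st: "0 \<le> s" "s \<le> t"
    and m: "\<And>x. x \<in> {s..t} \<Longrightarrow> (c - x) * Re m \<le> 0"
    and der: "AE x in lebesgue. x > 0 \<longrightarrow> (u has_vector_derivative m * u x + r x) (at x)"
    and B: "B integrable_on {s..t}" "\<And>x. x \<in> {s..t} \<Longrightarrow> cmod (r x) \<le> B x"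
  shows "cmod (exp (of_real (c - t) * m) * u t - exp (of_real (c - s) * m) * u s) \<le> integral {s..t} B"
proof (rule loc_abs_cont_diff_bound[OF _ st _ B(1)])
  have d: "((\<lambda>x. exp (of_real (c - x) * m)) has_vector_derivative - m * exp (of_real (c - x) * m)) (at x)" for x
  proof -
    have "((\<lambda>w. exp ((of_real c - w) * m)) has_field_derivative - m * exp ((of_real c - of_real x) * m)) (at (of_real x))"
      by (auto intro!: derivative_eq_intros)
    from has_vector_derivative_real_field[OF this] show ?thesis by simp
  qed
  have "loc_abs_cont (\<lambda>x. exp (of_real (c - x) * m))"
  proof (rule loc_abs_cont_C1)
    show "continuous_on {0..} (\<lambda>x. - m * exp (of_real (c - x) * m))"
      by (intro continuous_intros)
  qed (rule has_vector_derivative_at_within[OF d])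
  then show "loc_abs_cont (\<lambda>x. exp (of_real (c - x) * m) * u x)" by (intro loc_abs_cont_mult ac)
  show "AE x in lebesgue. x > 0 \<longrightarrow> ((\<lambda>x. exp (of_real (c - x) * m) * u x) has_vector_derivative exp (of_real (c - x) * m) * r x) (at x)"
    using der
  proof eventually_elim
    case (elim x)
    then show ?case using d[of x]
      by (auto intro!: derivative_eq_intros simp: algebra_simps)
  qed
  show "AE x in lebesgue. x > 0 \<longrightarrow> x \<in> {s..t} \<longrightarrow> cmod (exp (of_real (c - x) * m) * r x) \<le> B x"
  proof (intro AE_I2 impI)
    fix x assume x: "x \<in> {s..t}"
    have "cmod (exp (of_real (c - x) * m)) \<le> 1" using m[OF x] by simp
    then have "cmod (exp (of_real (c - x) * m)) * cmod (r x) \<le> cmod (r x)"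
      by (intro mult_left_le_one_le norm_ge_zero)
    then show "cmod (exp (of_real (c - x) * m) * r x) \<le> B x"
      using B(2)[OF x] unfolding norm_mult by linarith
  qed
qed

lemma mode_forward:
  fixes u :: "real \<Rightarrow> complex"
  assumes ac: "loc_abs_cont u" and st: "0 \<le> s" "s \<le> t" and m: "Re m \<le> 0"
    and der: "AE x in lebesgue. x > 0 \<longrightarrow> (u has_vector_derivative m * u x + r x) (at x)"
    and B: "B integrable_on {s..t}" "\<And>x. x \<in> {s..t} \<Longrightarrow> cmod (r x) \<le> B x"
  shows "cmod (u t) \<le> cmod (u s) + integral {s..t} B"
proof -
  have le: "(t - x) * Re m \<le> 0" if "x \<in> {s..t}" for x
    using that m by (simp add: mult_nonneg_nonpos)
  have "cmod (u t - exp (of_real (t - s) * m) * u s) \<le> integral {s..t} B"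
    using exp_weighted_diff_bound[OF ac st le der B] by simp
  moreover have "cmod (exp (of_real (t - s) * m) * u s) \<le> cmod (u s)"
    using le[of s] st by (simp add: norm_mult mult_left_le_one_le)
  ultimately show ?thesis
    using norm_triangle_sub[of "u t" "exp (of_real (t - s) * m) * u s"] by linarith
qed

text \<open>A nondecaying mode is controlled from the right. For a decaying solution the right
  endpoint can later be sent to infinity, which leaves the source term alone.\<close>

lemma mode_backward:
  fixes u :: "real \<Rightarrow> complex"
  assumes ac: "loc_abs_cont u" and st: "0 \<le> s" "s \<le> t" and m: "Re m \<ge> 0"
    and der: "AE x in lebesgue. x > 0 \<longrightarrow> (u has_vector_derivative m * u x + r x) (at x)"
    and B: "B integrable_on {s..t}" "\<And>x. x \<in> {s..t} \<Longrightarrow> cmod (r x) \<le> B x"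
  shows "cmod (u s) \<le> cmod (u t) + integral {s..t} B"
proof -
  have le: "(s - x) * Re m \<le> 0" if "x \<in> {s..t}" for x
    using that m by (simp add: mult_nonpos_nonneg)
  have "cmod (exp (of_real (s - t) * m) * u t - u s) \<le> integral {s..t} B"
    using exp_weighted_diff_bound[OF ac st le der B] by simp
  moreover have "cmod (exp (of_real (s - t) * m) * u t) \<le> cmod (u t)"
    using le[of t] st by (simp add: norm_mult mult_left_le_one_le)
  ultimately show ?thesis
    using norm_triangle_sub[of "u s" "exp (of_real (s - t) * m) * u t"] by (simp add: norm_minus_commute)
qed

section \<open>The bilinear Wronskian\<close>

definition wronskian :: "(real \<Rightarrow> complex^2) \<Rightarrow> (real \<Rightarrow> complex^2) \<Rightarrow> (real \<Rightarrow> complex^2) \<Rightarrow> (real \<Rightarrow> complex^2) \<Rightarrow> real \<Rightarrow> complex" where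
  "wronskian F D G E x = F x $ 1 * E x $ 1 + F x $ 2 * E x $ 2 - D x $ 1 * G x $ 1 - D x $ 2 * G x $ 2"

text \<open>The potential cancels because it multiplies each component of the first order system
  separately, with the same factor for \<open>F\<close> and \<open>G\<close>. What remains is the
  difference of the spectral parameters times the pairing through epsilon.\<close>

lemma wronskian_has_integral:
  assumes F: "cauchy_sol q z F D" and G: "cauchy_sol q w G E" and st: "0 \<le> s" "s \<le> t"
  shows "((\<lambda>x. (z - w) * (F x $ 1 * G x $ 2 + F x $ 2 * G x $ 1)) has_integral wronskian F D G E t - wronskian F D G E s) {s..t}"
proof (rule has_integral_loc_abs_cont[OF _ st])
  show "loc_abs_cont (wronskian F D G E)"
    unfolding wronskian_def
    by (intro loc_abs_cont_add loc_abs_cont_diff loc_abs_cont_mult cauchy_sol_ac[OF F] cauchy_sol_ac[OF G] cauchy_sol_ac'[OF F] cauchy_sol_ac'[OF G])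
  show "AE x in lebesgue. x > 0 \<longrightarrow> (wronskian F D G E has_vector_derivative
          (z - w) * (F x $ 1 * G x $ 2 + F x $ 2 * G x $ 1)) (at x)"
    using cauchy_sol_AE[OF F] cauchy_sol_AE[OF G]
  proof eventually_elim
    case (elim x)
    show ?case
    proof
      assume "x > 0"
      then show "(wronskian F D G E has_vector_derivative (z - w) * (F x $ 1 * G x $ 2 + F x $ 2 * G x $ 1)) (at x)"
        using elim cauchy_sol_der_at[OF F \<open>x > 0\<close>] cauchy_sol_der_at[OF G \<open>x > 0\<close>] unfolding wronskian_def
        by (auto intro!: derivative_eq_intros simp: algebra_simps)
    qed
  qed
qed

lemma wronskian_const:
  assumes F: "cauchy_sol q z F D" and G: "cauchy_sol q z G E" and "x \<ge> 0"
  shows "wronskian F D G E x = wronskian F D G E 0"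
  using wronskian_has_integral[OF F G order_refl \<open>x \<ge> 0\<close>] has_integral_0_eq by fastforce

section \<open>A priori estimates for an integrable potential\<close>

locale potential =
  fixes q :: "real \<Rightarrow> complex"
  assumes q: "set_integrable lebesgue {0<..} q"
begin

lemma norm_q_integrable: "(\<lambda>x. cmod (q x)) integrable_on {0..}"
proof -
  have "set_integrable lebesgue {0<..} (\<lambda>x. cmod (q x))"
    using set_integrable_norm[OF q] by simp
  then have "(\<lambda>x. cmod (q x)) integrable_on {0<..}"
    by (rule set_lebesgue_integral_eq_integral)
  then show ?thesis
    by (rule integrable_spike_set) (auto intro: negligible_subset[of "{0}"])
qed

lemma norm_q_integrable': "0 \<le> s \<Longrightarrow> (\<lambda>x. cmod (q x)) integrable_on {s..t}"
  using integrable_on_subinterval[OF norm_q_integrable, of s t] by auto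

lemma norm_q_tail: "e > 0 \<Longrightarrow> \<exists>X\<ge>0. \<forall>x\<ge>X. \<forall>y. integral {x..y} (\<lambda>x. cmod (q x)) \<le> e"
  by (rule integral_tail_small[OF norm_q_integrable]) auto

text \<open>The difference of solutions at \<open>z\<close> and \<open>w\<close> solves an
  inhomogeneous equation with source (z - w) G. Adding the constant \<open>cmod (z - w) * B\<close>
  to the norm of the difference hides this source inside the quantity being estimated, so the
  homogeneous Gronwall inequality applies.\<close>

lemma cauchy_sol_diff_gronwall:
  "\<exists>C\<ge>1. \<forall>z w F D G E B. cmod z \<le> Z \<longrightarrow> cauchy_sol q z F D \<longrightarrow> cauchy_sol q w G E \<longrightarrow> B \<ge> 0 \<longrightarrow> (\<forall>x\<in>{0..X}. data_norm (G x) (E x) \<le> B) \<longrightarrow>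
     (\<forall>s\<in>{0..X}. \<forall>t\<in>{0..X}. data_norm (F s - G s) (D s - E s) + cmod (z - w) * B \<le>
         C * (data_norm (F t - G t) (D t - E t) + cmod (z - w) * B))"
proof -
  \<comment> \<open>The rate is collected from four components: each value grows at rate at most 1,
    each derivative at rate at most |q| + Z + 1, the last 1 coming from the source.\<close>
  define h where "h x = 2 * cmod (q x) + (2 * Z + 4)" for x
  have hint: "h integrable_on {s..t}" if "0 \<le> s" for s t
    unfolding h_def using norm_q_integrable'[OF that, of t]
    by (intro integrable_add integrable_on_mult_right) auto
  obtain C where C: "C \<ge> 1" and gr: "\<And>N s t. \<lbrakk>continuous_on {0..X} N; \<And>x. x\<in>{0..X} \<Longrightarrow> N x \<ge> 0;
     \<And>s t S. \<lbrakk>0 \<le> s; s \<le> t; t \<le> X; \<And>x. x\<in>{s..t} \<Longrightarrow> N x \<le> S\<rbrakk> \<Longrightarrow> \<bar>N t - N s\<bar> \<le> S * integral {s..t} h;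
     s\<in>{0..X}; t\<in>{0..X}\<rbrakk> \<Longrightarrow> N s \<le> C * (N t :: real)"
    using gronwall_two_sided[OF hint[OF order_refl], of X] by (metis (no_types, lifting))
  show ?thesis
  proof (intro exI[of _ C] conjI C allI impI ballI)
    fix z w F D G E B s0 t0
    assume z: "cmod z \<le> Z" and F: "cauchy_sol q z F D" and G: "cauchy_sol q w G E" and B: "B \<ge> 0" "\<forall>x\<in>{0..X}. data_norm (G x) (E x) \<le> B"
      and st0: "s0 \<in> {0..X}" "t0 \<in> {0..X}"
    define N where "N x = data_norm (F x - G x) (D x - E x) + cmod (z - w) * B" for x
    have "N s0 \<le> C * N t0"
    proof (rule gr[OF _ _ _ st0])
      show "continuous_on {0..X} N"
        unfolding N_def data_norm_def vector_minus_component
        by (intro continuous_intros continuous_on_subset[OF cauchy_sol_cont[OF F]] continuous_on_subset[OF cauchy_sol_cont[OF G]]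
             continuous_on_subset[OF cauchy_sol_cont'[OF F]] continuous_on_subset[OF cauchy_sol_cont'[OF G]]) auto
      show N0: "0 \<le> N x" for x using B(1) by (simp add: N_def data_norm_nonneg)
      fix s t S assume st: "0 \<le> s" "s \<le> t" "t \<le> X" and S: "\<And>x. x\<in>{s..t} \<Longrightarrow> N x \<le> S"
      have S0: "S \<ge> 0" using S[of s] st N0[of s] by auto
      have comp: "cmod ((F x - G x) $ i) \<le> S" "cmod ((D x - E x) $ i) \<le> S" if "x \<in> {s..t}" for x i
      proof -
        have "data_norm (F x - G x) (D x - E x) \<le> S" using S[OF that] B(1) unfolding N_def
          by (smt (verit) mult_nonneg_nonneg norm_ge_zero)
        then show "cmod ((F x - G x) $ i) \<le> S" "cmod ((D x - E x) $ i) \<le> S"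
          using data_norm_bounds order_trans by blast+
      qed
      have gB: "cmod (z - w) * cmod (G x $ i) \<le> S" if "x \<in> {s..t}" for x i
      proof -
        have "cmod (G x $ i) \<le> B" using B(2) that st data_norm_bounds(1)[where w = "E x" and v = "G x"] by (meson atLeastAtMost_iff order_trans)
        then have "cmod (z - w) * cmod (G x $ i) \<le> cmod (z - w) * B" by (intro mult_left_mono) auto
        also have "\<dots> \<le> S" using S[OF that] data_norm_nonneg[of "F x - G x" "D x - E x"] by (simp add: N_def)
        finally show ?thesis .
      qed
      have c1: "(\<lambda>_. S) integrable_on {s..t}" by auto
      have f: "cmod (((F t - G t) $ i) - ((F s - G s) $ i)) \<le> integral {s..t} (\<lambda>_. S)" for i
      proof (rule loc_abs_cont_diff_bound[where f = "\<lambda>x. (F x - G x) $ i" and f' = "\<lambda>x. (D x - E x) $ i", OF _ st(1,2) _ c1])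
        show "loc_abs_cont (\<lambda>x. (F x - G x) $ i)"
          by (simp add: loc_abs_cont_diff cauchy_sol_ac'[OF F] cauchy_sol_ac'[OF G])
        show "AE x in lebesgue. x > 0 \<longrightarrow> ((\<lambda>x. (F x - G x) $ i) has_vector_derivative (D x - E x) $ i) (at x)"
          using cauchy_sol_der_at[OF F] cauchy_sol_der_at[OF G] by (auto intro!: AE_I2 derivative_eq_intros)
      qed (use comp in auto)
      have hi: "(\<lambda>x. S * (cmod (q x) + (Z + 1))) integrable_on {s..t}"
        by (intro integrable_on_mult_right integrable_add norm_q_integrable' st) auto
      have d: "cmod (((D t - E t) $ i) - ((D s - E s) $ i)) \<le> integral {s..t} (\<lambda>x. S * (cmod (q x) + (Z + 1)))" for i
      proof -
        \<comment> \<open>With \<open>j\<close> the other index and \<open>p\<close> the potential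
          or its conjugate, both rows of the system take one form.\<close>
        define j :: 2 where "j = (if i = 1 then 2 else 1)"
        define p where "p x = (if i = 1 then cnj (q x) else q x)" for x
        have ae: "AE x in lebesgue. x > 0 \<longrightarrow>
           ((\<lambda>x. (D x - E x) $ i) has_vector_derivative p x * (F x - G x) $ i - z * (F x - G x) $ j - (z - w) * G x $ j) (at x)"
          using cauchy_sol_AE[OF F] cauchy_sol_AE[OF G]
        proof eventually_elim
          case (elim x)
          show ?case using elim exhaust_2[of i]
            by (auto simp: p_def j_def algebra_simps intro!: derivative_eq_intros)
        qed
        show ?thesis
        proof (rule loc_abs_cont_diff_bound[where f = "\<lambda>x. (D x - E x) $ i", OF _ st(1,2) ae hi])
          show "loc_abs_cont (\<lambda>x. (D x - E x) $ i)"
            by (simp add: loc_abs_cont_diff cauchy_sol_ac[OF F] cauchy_sol_ac[OF G])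
          show "AE x in lebesgue. x > 0 \<longrightarrow> x \<in> {s..t} \<longrightarrow>
              cmod (p x * (F x - G x) $ i - z * (F x - G x) $ j - (z - w) * G x $ j) \<le> S * (cmod (q x) + (Z + 1))"
          proof (intro AE_I2 impI)
            fix x assume x: "x \<in> {s..t}"
            have "cmod (p x * (F x - G x) $ i - z * (F x - G x) $ j - (z - w) * G x $ j)
               \<le> cmod (p x) * cmod ((F x - G x) $ i) + cmod z * cmod ((F x - G x) $ j) + cmod (z - w) * cmod (G x $ j)"
              unfolding norm_mult[symmetric]
              by (rule order_trans[OF norm_triangle_ineq4 add_right_mono[OF norm_triangle_ineq4]])
            also have "\<dots> \<le> cmod (q x) * S + Z * S + S"
              using comp(1)[OF x] gB[OF x] z S0
              by (intro add_mono mult_mono) (auto simp: p_def order_trans[OF norm_ge_zero])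
            finally show "cmod (p x * (F x - G x) $ i - z * (F x - G x) $ j - (z - w) * G x $ j) \<le> S * (cmod (q x) + (Z + 1))"
              by (simp add: algebra_simps)
          qed
        qed
      qed
      have tri: "\<bar>cmod a - cmod b\<bar> \<le> cmod (a - b)" for a b :: complex
        by (rule norm_triangle_ineq3)
      have "\<bar>N t - N s\<bar> \<le> 2 * integral {s..t} (\<lambda>_. S) + 2 * integral {s..t} (\<lambda>x. S * (cmod (q x) + (Z + 1)))"
        using f[of 1] f[of 2] d[of 1] d[of 2]
          tri[of "(F t - G t) $ 1" "(F s - G s) $ 1"] tri[of "(F t - G t) $ 2" "(F s - G s) $ 2"]
          tri[of "(D t - E t) $ 1" "(D s - E s) $ 1"] tri[of "(D t - E t) $ 2" "(D s - E s) $ 2"]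
        unfolding N_def data_norm_def by linarith
      also have "\<dots> = integral {s..t} (\<lambda>x. 2 * S + 2 * (S * (cmod (q x) + (Z + 1))))"
        using hi by (subst integral_add) (auto intro!: integrable_on_mult_right)
      also have "(\<lambda>x. 2 * S + 2 * (S * (cmod (q x) + (Z + 1)))) = (\<lambda>x. S * h x)"
        by (auto simp: h_def algebra_simps)
      finally show "\<bar>N t - N s\<bar> \<le> S * integral {s..t} h" by simp
    qed
    then show "data_norm (F s0 - G s0) (D s0 - E s0) + cmod (z - w) * B \<le> C * (data_norm (F t0 - G t0) (D t0 - E t0) + cmod (z - w) * B)"
      by (simp add: N_def)
  qed
qed

lemma cauchy_sol_gronwall:
  "\<exists>C\<ge>1. \<forall>z F D. cmod z \<le> Z \<longrightarrow> cauchy_sol q z F D \<longrightarrow>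
     (\<forall>s\<in>{0..X}. \<forall>t\<in>{0..X}. data_norm (F s) (D s) \<le> C * data_norm (F t) (D t))"
proof -
  obtain C where C: "C \<ge> 1" "\<And>z w F D G E B s t. \<lbrakk>cmod z \<le> Z; cauchy_sol q z F D; cauchy_sol q w G E; B \<ge> 0; \<And>x. x\<in>{0..X} \<Longrightarrow> data_norm (G x) (E x) \<le> B;
     s\<in>{0..X}; t\<in>{0..X}\<rbrakk> \<Longrightarrow> data_norm (F s - G s) (D s - E s) + cmod (z - w) * B \<le>
         C * (data_norm (F t - G t) (D t - E t) + cmod (z - w) * B)"
    using cauchy_sol_diff_gronwall[of Z X] by (metis (no_types, lifting))
  have z0: "data_norm 0 0 = 0" by (simp add: data_norm_eq_0)
  show ?thesis
    using C(1) C(2)[OF _ _ cauchy_sol_zero[of q], where B = 0] by (intro exI[of _ C]) (auto simp: z0)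
qed

text \<open>As \<open>q\<close> is only integrable, the second derivative need not be square
  integrable, so the argument is local. In the outer thirds of a far window [x, x + 3] there are
  points where F is small; D varies little on the window, so the mean value theorem makes D small,
  and then F is small throughout. The variation of D involves the maximum \<open>S\<close> of F
  itself, which is absorbed.\<close>

lemma square_integrable_decays:
  assumes F: "cauchy_sol q z F D" and L2: "(\<lambda>x. (norm (F x))\<^sup>2) integrable_on {0..}"
  shows "decays F D"
  unfolding decays_def
proof (rule tendstoI)
  fix e0 :: real assume "e0 > 0"
  \<comment> \<open>138 + 64 |z| is a convenient bound for what remains once \<open>S\<close> has
    been absorbed in \<open>main\<close>; the factor 2 makes the last inequality strict.\<close>
  define e where "e = e0 / (2 * (138 + 64 * cmod z))"
  have e: "e > 0" using \<open>e0 > 0\<close> by (simp add: e_def add_pos_nonneg)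
  \<comment> \<open>The maximum \<open>S\<close> will be bounded by six times \<open>osc\<close>
    (two components, distance at most 3) plus small terms. With 1/12 the share of \<open>S\<close>
    in this is one half.\<close>
  obtain X1 where X1: "X1 \<ge> 0" "\<And>x y. x \<ge> X1 \<Longrightarrow> integral {x..y} (\<lambda>x. cmod (q x)) \<le> 1/12"
    using norm_q_tail[of "1/12"] by auto
  obtain X2 where X2: "X2 \<ge> 0" "\<And>x y. x \<ge> X2 \<Longrightarrow> integral {x..y} (\<lambda>x. (norm (F x))\<^sup>2) \<le> e\<^sup>2"
    using integral_tail_small[OF L2, of "e\<^sup>2"] e by auto
  have Fint: "(\<lambda>x. (norm (F x))\<^sup>2) integrable_on {s..t}" if "0 \<le> s" for s t
    using integrable_on_subinterval[OF L2, of s t] that by auto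
  \<comment> \<open>Otherwise |F|^2 would integrate to at least 4 e^2 over a unit interval, against
    a tail of at most e^2.\<close>
  have small: "\<exists>s\<in>{a..a+1}. norm (F s) \<le> 2 * e" if a: "a \<ge> X2" for a
  proof (rule ccontr)
    assume "\<not> ?thesis"
    then have *: "(2 * e)\<^sup>2 \<le> (norm (F s))\<^sup>2" if "s \<in> {a..a+1}" for s
      using that e by (intro power_mono) force+
    have "integral {a..a+1} (\<lambda>x. (2 * e)\<^sup>2) \<le> integral {a..a+1} (\<lambda>x. (norm (F x))\<^sup>2)"
      by (rule integral_le) (use Fint X2(1) a * in auto)
    moreover have "integral {a..a+1} (\<lambda>x. (2 * e)\<^sup>2) = 4 * e\<^sup>2" by (simp add: power_mult_distrib)
    ultimately have "4 * e\<^sup>2 \<le> e\<^sup>2" using X2(2)[OF a, of "a+1"] by linarith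
    then show False using e by simp
  qed
  have main: "data_norm (F x) (D x) \<le> (138 + 64 * cmod z) * e" if x: "x \<ge> max X1 X2" for x
  proof -
    let ?I = "{x..x+3}"
    have x0: "x \<ge> 0" "x \<ge> X1" "x \<ge> X2" using x X1(1) by auto
    define ph where "ph y = cmod (F y $ 1) + cmod (F y $ 2)" for y
    have ph2: "ph y \<le> 2 * norm (F y)" for y
      unfolding ph_def using Finite_Cartesian_Product.norm_nth_le[of "F y" 1] Finite_Cartesian_Product.norm_nth_le[of "F y" 2] by simp
    have phi: "cmod (F y $ i) \<le> ph y" for y i using exhaust_2[of i] by (auto simp: ph_def)
    have "continuous_on ?I ph"
      unfolding ph_def using x0 by (intro continuous_intros continuous_on_subset[OF cauchy_sol_cont[OF F]]) auto
    then obtain m where m: "m \<in> ?I" "\<And>y. y \<in> ?I \<Longrightarrow> ph y \<le> ph m"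
      using continuous_attains_sup[of ?I ph] by auto
    define S where "S = ph m"
    have S0: "S \<ge> 0" by (simp add: S_def ph_def)
    obtain s where s: "s \<in> {x..x+1}" "norm (F s) \<le> 2 * e" using small[of x] x0 by auto
    obtain t where t: "t \<in> {x+2..x+2+1}" "norm (F t) \<le> 2 * e" using small[of "x+2"] x0 by auto
    \<comment> \<open>|F| is replaced by e + |F|^2 / e, so that the L^2 tail can be used without the
      Cauchy-Schwarz inequality; over a window of length 3 this integrates to at most 4 e.\<close>
    define b where "b y = S * cmod (q y) + cmod z * (e + (norm (F y))\<^sup>2 / e)" for y
    have bint: "b integrable_on {u..v}" if "0 \<le> u" for u v
    proof -
      have "(\<lambda>y. S * cmod (q y) + cmod z * (e + (1/e) * (norm (F y))\<^sup>2)) integrable_on {u..v}"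
        by (intro integrable_add integrable_on_mult_right norm_q_integrable' Fint that) auto
      then show ?thesis by (simp add: b_def[abs_def])
    qed
    have b0: "b y \<ge> 0" for y unfolding b_def using S0 e by simp
    define osc where "osc = S / 12 + 4 * cmod z * e"
    have bI: "integral ?I b \<le> osc"
    proof -
      have "integral ?I b = integral ?I (\<lambda>y. S * cmod (q y) + cmod z * (e + (1/e) * (norm (F y))\<^sup>2))"
        by (simp add: b_def[abs_def])
      also have "\<dots> = S * integral ?I (\<lambda>y. cmod (q y)) + cmod z * (3 * e + (1/e) * integral ?I (\<lambda>y. (norm (F y))\<^sup>2))"
        by (subst integral_add, (intro integrable_add integrable_on_mult_right norm_q_integrable' Fint x0 integrable_const_ivl)+)
           (subst integral_mult_right, subst integral_mult_right, subst integral_add,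
             (intro integrable_add integrable_on_mult_right norm_q_integrable' Fint x0 integrable_const_ivl)+, simp)
      also have "\<dots> \<le> S * (1/12) + cmod z * (3 * e + (1/e) * e\<^sup>2)"
        using X1(2)[of x "x+3"] X2(2)[of x "x+3"] x0 S0 e by (intro add_mono mult_left_mono) auto
      also have "\<dots> = osc" using e by (simp add: osc_def power2_eq_square)
      finally show ?thesis .
    qed
    have ddiff: "cmod (D v $ i - D u $ i) \<le> osc" if uv: "u \<in> ?I" "v \<in> ?I" "u \<le> v" for u v i
    proof -
      have "cmod (D v $ i - D u $ i) \<le> integral {u..v} b"
      proof -
        define j :: 2 where "j = (if i = 1 then 2 else 1)"
        define p where "p x = (if i = 1 then cnj (q x) else q x)" for x
        have ae: "AE x in lebesgue. x > 0 \<longrightarrow> ((\<lambda>x. D x $ i) has_vector_derivative p x * F x $ i - z * F x $ j) (at x)"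
          using cauchy_sol_AE[OF F]
        proof eventually_elim
          case (elim x)
          then show ?case using exhaust_2[of i] by (auto simp: p_def j_def)
        qed
        have u0: "0 \<le> u" using uv x0 by auto
        show ?thesis
        proof (rule loc_abs_cont_diff_bound[OF cauchy_sol_ac[OF F] u0 uv(3) ae bint[OF u0]], intro AE_I2 impI)
          fix y assume y: "y \<in> {u..v}"
          have "cmod (p y * F y $ i - z * F y $ j) \<le> cmod (q y) * cmod (F y $ i) + cmod z * cmod (F y $ j)"
            by (rule order_trans[OF norm_triangle_ineq4]) (simp add: norm_mult p_def)
          also have "\<dots> \<le> cmod (q y) * S + cmod z * (e + (norm (F y))\<^sup>2 / e)"
          proof (intro add_mono mult_left_mono norm_ge_zero)
            show "cmod (F y $ i) \<le> S" using phi[of y i] m(2)[of y] y uv by (auto simp: S_def)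
            show "cmod (F y $ j) \<le> e + (norm (F y))\<^sup>2 / e"
            proof -
              have "cmod (F y $ j) \<le> norm (F y)" by (rule Finite_Cartesian_Product.norm_nth_le)
              moreover have "norm (F y) * e \<le> e * e + (norm (F y))\<^sup>2"
                by (smt (verit) mult_left_mono mult_right_mono e norm_ge_zero power2_eq_square zero_le_square mult_nonneg_nonneg)
              then have "norm (F y) \<le> e + (norm (F y))\<^sup>2 / e" using e by (simp add: field_simps)
              ultimately show ?thesis by simp
            qed
          qed
          finally show "cmod (p y * F y $ i - z * F y $ j) \<le> b y"
            by (simp add: b_def mult.commute)
        qed
      qed
      also have "\<dots> \<le> integral ?I b"
        by (rule integral_subset_le) (use uv bint x0 b0 in auto)
      finally show ?thesis using bI by simp
    qed
    have ddiff': "cmod (D v $ i - D u $ i) \<le> osc" if "u \<in> ?I" "v \<in> ?I" for u v i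
      using ddiff[of u v i] ddiff[of v u i] that by (cases "u \<le> v") (auto simp: norm_minus_commute)
    have dbound: "cmod (D y $ i) \<le> 8 * e + osc" if y: "y \<in> ?I" for y i
    proof -
      have st: "1 \<le> t - s" using s t by auto
      \<comment> \<open>Subtracting the line of slope D(y) leaves a function whose derivative is at
        most \<open>osc\<close>, so (t - s) D(y) is close to F(t) - F(s), which is small.\<close>
      have "cmod ((F t $ i - t *\<^sub>R D y $ i) - (F s $ i - s *\<^sub>R D y $ i)) \<le> osc * norm (t - s)"
      proof (rule vector_derivative_norm_bound[where S = ?I and d = "\<lambda>x. D x $ i - D y $ i"])
        show "((\<lambda>x. F x $ i - x *\<^sub>R D y $ i) has_vector_derivative D u $ i - D y $ i) (at u within ?I)" if u: "u \<in> ?I" for u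
        proof -
          have "((\<lambda>x. F x $ i) has_vector_derivative D u $ i) (at u within ?I)"
            using cauchy_sol_der[OF F, of u i] u x0 by (auto elim: has_vector_derivative_within_subset)
          then show ?thesis by (auto intro!: derivative_eq_intros)
        qed
      qed (use ddiff' y s t in auto)
      then have "cmod ((t - s) *\<^sub>R D y $ i) \<le> cmod (F t $ i - F s $ i) + osc * (t - s)"
        using norm_triangle_sub[of "(t - s) *\<^sub>R D y $ i" "F t $ i - F s $ i"] st
        by (simp add: algebra_simps norm_minus_commute)
      moreover have "cmod (F t $ i - F s $ i) \<le> 8 * e"
        using norm_triangle_ineq4[of "F t $ i" "F s $ i"] s t e
          Finite_Cartesian_Product.norm_nth_le[of "F t" i] Finite_Cartesian_Product.norm_nth_le[of "F s" i] by linarith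
      moreover have "8 * e \<le> 8 * e * (t - s)" using e st by simp
      moreover have "cmod ((t - s) *\<^sub>R D y $ i) = (t - s) * cmod (D y $ i)" using st by simp
      moreover have "(t - s) * (8 * e + osc) = 8 * e * (t - s) + osc * (t - s)" by (simp add: algebra_simps)
      ultimately have "(t - s) * cmod (D y $ i) \<le> (t - s) * (8 * e + osc)" by linarith
      then show ?thesis using st by (simp add: mult_le_cancel_left)
    qed
    have fdiff: "cmod (F m $ i - F s $ i) \<le> (8 * e + osc) * norm (m - s)" for i
    proof (rule vector_derivative_norm_bound[where S = ?I and d = "\<lambda>x. D x $ i"])
      show "((\<lambda>x. F x $ i) has_vector_derivative D u $ i) (at u within ?I)" if u: "u \<in> ?I" for u
        using cauchy_sol_der[OF F, of u i] u x0 by (auto elim: has_vector_derivative_within_subset)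
    qed (use dbound m s in auto)
    have osc0: "osc \<ge> 0" using S0 e by (simp add: osc_def)
    have "(8 * e + osc) * norm (m - s) \<le> (8 * e + osc) * 3"
      using m s e osc0 by (intro mult_left_mono) auto
    then have "S \<le> ph s + 2 * (8 * e + osc) * 3"
      using fdiff[of 1] fdiff[of 2] norm_triangle_sub[of "F m $ 1" "F s $ 1"] norm_triangle_sub[of "F m $ 2" "F s $ 2"]
      unfolding S_def ph_def by linarith
    moreover have "ph s \<le> 4 * e" using ph2[of s] s by simp
    ultimately have S: "S \<le> (104 + 48 * cmod z) * e" by (simp add: osc_def algebra_simps)
    have "data_norm (F x) (D x) \<le> S + 2 * (8 * e + osc)"
      using m(2)[of x] dbound[of x 1] dbound[of x 2] unfolding data_norm_def S_def ph_def by simp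
    also have "\<dots> \<le> (138 + 64 * cmod z) * e" using S e by (simp add: osc_def algebra_simps)
    finally show ?thesis .
  qed
  have pos: "138 + 64 * cmod z > 0" by (simp add: add_pos_nonneg)
  have "e * (2 * (138 + 64 * cmod z)) = e0" using pos unfolding e_def times_divide_eq_left by (intro nonzero_mult_div_cancel_right) simp
  then have "(138 + 64 * cmod z) * e < e0" using \<open>e0 > 0\<close> by (simp add: algebra_simps)
  then have "dist (data_norm (F x) (D x)) 0 < e0" if "x \<ge> max X1 X2" for x
    using main[OF that] data_norm_nonneg[of "F x" "D x"] by simp
  then show "\<forall>\<^sub>F x in at_top. dist (data_norm (F x) (D x)) 0 < e0"
    unfolding eventually_at_top_linorder by blast
qed

end

section \<open>Modes of the free equation\<close>

text \<open>
  In the variables \<open>F\<^sub>1 + F\<^sub>2\<close> and \<open>F\<^sub>1 - F\<^sub>2\<close> the free equation decouples into oscillation and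
  exponential growth or decay; the functions below diagonalise it as a first order system.
\<close>

definition osc_mode :: "complex \<Rightarrow> (real \<Rightarrow> complex^2) \<Rightarrow> (real \<Rightarrow> complex^2) \<Rightarrow> real \<Rightarrow> complex" where
  "osc_mode m F D x = (D x $ 1 + D x $ 2) + m * (F x $ 1 + F x $ 2)"

definition exp_mode :: "complex \<Rightarrow> (real \<Rightarrow> complex^2) \<Rightarrow> (real \<Rightarrow> complex^2) \<Rightarrow> real \<Rightarrow> complex" where
  "exp_mode m F D x = (D x $ 1 - D x $ 2) + m * (F x $ 1 - F x $ 2)"

lemma mode_bound:
  "cmod (osc_mode m F D x) \<le> (1 + cmod m) * data_norm (F x) (D x)"
  "cmod (exp_mode m F D x) \<le> (1 + cmod m) * data_norm (F x) (D x)"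
proof -
  have p: "cmod (v $ 1 + v $ 2) \<le> cmod (v $ 1) + cmod (v $ 2)" "cmod (v $ 1 - v $ 2) \<le> cmod (v $ 1) + cmod (v $ 2)" for v :: "complex^2"
    by (rule norm_triangle_ineq norm_triangle_ineq4)+
  have *: "cmod (a + m * b) \<le> (1 + cmod m) * data_norm (F x) (D x)"
    if "cmod a \<le> cmod (D x $ 1) + cmod (D x $ 2)" "cmod b \<le> cmod (F x $ 1) + cmod (F x $ 2)" for a b
  proof -
    have "cmod (a + m * b) \<le> cmod a + cmod m * cmod b"
      by (metis norm_mult norm_triangle_ineq)
    also have "\<dots> \<le> data_norm (F x) (D x) + cmod m * data_norm (F x) (D x)"
    proof -
      have "cmod a \<le> data_norm (F x) (D x)" "cmod b \<le> data_norm (F x) (D x)"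
        using that norm_ge_zero[of "F x $ 1"] norm_ge_zero[of "F x $ 2"] norm_ge_zero[of "D x $ 1"] norm_ge_zero[of "D x $ 2"]
        unfolding data_norm_def by linarith+
      then show ?thesis by (intro add_mono mult_left_mono) auto
    qed
    finally show ?thesis by (simp add: algebra_simps)
  qed
  show "cmod (osc_mode m F D x) \<le> (1 + cmod m) * data_norm (F x) (D x)"
    unfolding osc_mode_def by (rule *) (rule p)+
  show "cmod (exp_mode m F D x) \<le> (1 + cmod m) * data_norm (F x) (D x)"
    unfolding exp_mode_def by (rule *) (rule p)+
qed

text \<open>The modes for opposite exponents return derivative and value by half their sum and
  difference; dividing the value part by the exponent costs 1 / |m|. All four exponents have the
  same modulus.\<close>

lemma data_norm_le_modes:
  assumes "m \<noteq> 0"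
  shows "data_norm (F x) (D x) \<le> (1 / cmod m + 1) *
    (cmod (osc_mode (\<i> * m) F D x) + cmod (osc_mode (- (\<i> * m)) F D x) + cmod (exp_mode m F D x) + cmod (exp_mode (- m) F D x))"
proof -
  define A A' B B' where "A = F x $ 1 + F x $ 2" and "A' = D x $ 1 + D x $ 2"
    and "B = F x $ 1 - F x $ 2" and "B' = D x $ 1 - D x $ 2"
  have half: "cmod a + cmod b \<le> cmod (a + b) + cmod (a - b)" for a b :: complex
  proof -
    have "cmod (2 * a) \<le> cmod (a + b) + cmod (a - b)" "cmod (2 * b) \<le> cmod (a + b) + cmod (a - b)"
      using norm_triangle_ineq[of "a+b" "a-b"] norm_triangle_ineq4[of "a+b" "a-b"] by simp_all
    then show ?thesis by (simp add: norm_mult)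
  qed
  have split: "cmod a + cmod b \<le> (1 / cmod n + 1) * (cmod (b + n * a) + cmod (b + (- n) * a))" if "n \<noteq> 0" for a b n :: complex
  proof -
    have "cmod b + cmod (n * a) \<le> cmod (b + n * a) + cmod (b + (- n) * a)" using half[of b "n * a"] by simp
    then have 1: "cmod b \<le> cmod (b + n * a) + cmod (b + (- n) * a)"
      and 2: "cmod n * cmod a \<le> cmod (b + n * a) + cmod (b + (- n) * a)"
      by (auto simp: norm_mult intro: order_trans[rotated])
    from 2 have "cmod a \<le> (1 / cmod n) * (cmod (b + n * a) + cmod (b + (- n) * a))"
      using that by (simp add: field_simps)
    with 1 show ?thesis by (simp add: distrib_right)
  qed
  have "data_norm (F x) (D x) \<le> (cmod A + cmod A') + (cmod B + cmod B')"
    using half[of "F x $ 1" "F x $ 2"] half[of "D x $ 1" "D x $ 2"]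
    unfolding data_norm_def A_def A'_def B_def B'_def by linarith
  also have "\<dots> \<le> (1 / cmod (\<i> * m) + 1) * (cmod (A' + (\<i> * m) * A) + cmod (A' + (- (\<i> * m)) * A)) +
       (1 / cmod m + 1) * (cmod (B' + m * B) + cmod (B' + (- m) * B))"
    using assms by (intro add_mono split) auto
  finally show ?thesis
    by (simp add: norm_mult osc_mode_def exp_mode_def A_def A'_def B_def B'_def algebra_simps)
qed

text \<open>For A = F1 + F2 the free equation reads A'' = - z A, and A' + m A is an eigenmode with
  exponent m precisely when m^2 = - z. The potential only contributes a source. For F1 - F2 the sign
  of z is reversed.\<close>

lemma osc_mode_eq:
  assumes F: "cauchy_sol q z F D" and m: "m ^ 2 = - z"
  shows "loc_abs_cont (osc_mode m F D)"
    "AE x in lebesgue. x > 0 \<longrightarrow> (osc_mode m F D has_vector_derivative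
        m * osc_mode m F D x + (cnj (q x) * F x $ 1 + q x * F x $ 2)) (at x)"
proof -
  show "loc_abs_cont (osc_mode m F D)"
    unfolding osc_mode_def
    by (intro loc_abs_cont_add loc_abs_cont_mult loc_abs_cont_const cauchy_sol_ac[OF F] cauchy_sol_ac'[OF F])
  show "AE x in lebesgue. x > 0 \<longrightarrow> (osc_mode m F D has_vector_derivative
        m * osc_mode m F D x + (cnj (q x) * F x $ 1 + q x * F x $ 2)) (at x)"
    using cauchy_sol_AE[OF F]
  proof eventually_elim
    case (elim x)
    show ?case
    proof
      assume x: "x > 0"
      have z: "z = - (m * m)" using m by (simp add: power2_eq_square)
      show "(osc_mode m F D has_vector_derivative
        m * osc_mode m F D x + (cnj (q x) * F x $ 1 + q x * F x $ 2)) (at x)"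
        unfolding osc_mode_def using elim x cauchy_sol_der_at[OF F x]
        by (auto intro!: derivative_eq_intros simp: algebra_simps z)
    qed
  qed
qed

lemma exp_mode_eq:
  assumes F: "cauchy_sol q z F D" and m: "m ^ 2 = z"
  shows "loc_abs_cont (exp_mode m F D)"
    "AE x in lebesgue. x > 0 \<longrightarrow> (exp_mode m F D has_vector_derivative
        m * exp_mode m F D x + (cnj (q x) * F x $ 1 - q x * F x $ 2)) (at x)"
proof -
  show "loc_abs_cont (exp_mode m F D)"
    unfolding exp_mode_def
    by (intro loc_abs_cont_add loc_abs_cont_diff loc_abs_cont_mult loc_abs_cont_const cauchy_sol_ac[OF F] cauchy_sol_ac'[OF F])
  show "AE x in lebesgue. x > 0 \<longrightarrow> (exp_mode m F D has_vector_derivative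
        m * exp_mode m F D x + (cnj (q x) * F x $ 1 - q x * F x $ 2)) (at x)"
    using cauchy_sol_AE[OF F]
  proof eventually_elim
    case (elim x)
    show ?case
    proof
      assume x: "x > 0"
      have z: "z = m * m" using m by (simp add: power2_eq_square)
      show "(exp_mode m F D has_vector_derivative
        m * exp_mode m F D x + (cnj (q x) * F x $ 1 - q x * F x $ 2)) (at x)"
        unfolding exp_mode_def using elim x cauchy_sol_der_at[OF F x]
        by (auto intro!: derivative_eq_intros simp: algebra_simps z)
    qed
  qed
qed

context potential
begin

lemma source_bound:
  assumes "data_norm (F x) (D x) \<le> S"
  shows "cmod (cnj (q x) * F x $ 1 + q x * F x $ 2) \<le> S * cmod (q x)"
    "cmod (cnj (q x) * F x $ 1 - q x * F x $ 2) \<le> S * cmod (q x)"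
proof -
  have "cmod (q x) * cmod (F x $ 1) + cmod (q x) * cmod (F x $ 2) \<le> S * cmod (q x)"
  proof -
    have "cmod (F x $ 1) + cmod (F x $ 2) \<le> S"
      using assms norm_ge_zero[of "D x $ 1"] norm_ge_zero[of "D x $ 2"] unfolding data_norm_def by linarith
    from mult_left_mono[OF this, of "cmod (q x)"] show ?thesis by (simp add: algebra_simps)
  qed
  then show "cmod (cnj (q x) * F x $ 1 + q x * F x $ 2) \<le> S * cmod (q x)"
    "cmod (cnj (q x) * F x $ 1 - q x * F x $ 2) \<le> S * cmod (q x)"
    using norm_triangle_ineq[of "cnj (q x) * F x $ 1" "q x * F x $ 2"]
      norm_triangle_ineq4[of "cnj (q x) * F x $ 1" "q x * F x $ 2"]
    by (simp_all add: norm_mult)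
qed

lemma osc_mode_forward:
  assumes F: "cauchy_sol q z F D" and m: "m ^ 2 = - z" "Re m \<le> 0" and st: "0 \<le> s" "s \<le> t"
    and S: "\<And>x. x \<in> {s..t} \<Longrightarrow> data_norm (F x) (D x) \<le> S"
  shows "cmod (osc_mode m F D t) \<le> cmod (osc_mode m F D s) + S * integral {s..t} (\<lambda>x. cmod (q x))"
proof -
  have B: "(\<lambda>x. S * cmod (q x)) integrable_on {s..t}"
    using norm_q_integrable'[OF st(1)] by (intro integrable_on_mult_right) auto
  have r: "cmod (cnj (q x) * F x $ 1 + q x * F x $ 2) \<le> S * cmod (q x)" if "x \<in> {s..t}" for x
    using S[OF that] by (rule source_bound)
  show ?thesis
    using mode_forward[OF osc_mode_eq(1)[OF F m(1)] st m(2) osc_mode_eq(2)[OF F m(1)] B r] by simp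
qed

lemma exp_mode_forward:
  assumes F: "cauchy_sol q z F D" and m: "m ^ 2 = z" "Re m \<le> 0" and st: "0 \<le> s" "s \<le> t"
    and S: "\<And>x. x \<in> {s..t} \<Longrightarrow> data_norm (F x) (D x) \<le> S"
  shows "cmod (exp_mode m F D t) \<le> cmod (exp_mode m F D s) + S * integral {s..t} (\<lambda>x. cmod (q x))"
proof -
  have B: "(\<lambda>x. S * cmod (q x)) integrable_on {s..t}"
    using norm_q_integrable'[OF st(1)] by (intro integrable_on_mult_right) auto
  have r: "cmod (cnj (q x) * F x $ 1 - q x * F x $ 2) \<le> S * cmod (q x)" if "x \<in> {s..t}" for x
    using S[OF that] by (rule source_bound)
  show ?thesis
    using mode_forward[OF exp_mode_eq(1)[OF F m(1)] st m(2) exp_mode_eq(2)[OF F m(1)] B r] by simp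
qed

lemma mode_tendsto_0:
  assumes "decays F D"
  shows "((\<lambda>x. cmod (osc_mode m F D x)) \<longlongrightarrow> 0) at_top" "((\<lambda>x. cmod (exp_mode m F D x)) \<longlongrightarrow> 0) at_top"
proof -
  have lim: "((\<lambda>x. (1 + cmod m) * data_norm (F x) (D x)) \<longlongrightarrow> 0) at_top"
    using assms unfolding decays_def by (rule tendsto_mult_right_zero)
  show "((\<lambda>x. cmod (osc_mode m F D x)) \<longlongrightarrow> 0) at_top" "((\<lambda>x. cmod (exp_mode m F D x)) \<longlongrightarrow> 0) at_top"
    by (rule tendsto_sandwich[OF _ _ tendsto_const lim]; auto intro!: always_eventually mode_bound)+
qed

text \<open>Letting the right end tend to infinity removes the boundary term: such a mode of a
  decaying solution is driven by the tail of \<open>q\<close> alone, with no initial value to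
  control.\<close>

lemma osc_mode_backward:
  assumes F: "cauchy_sol q z F D" and m: "m ^ 2 = - z" "Re m \<ge> 0" and x: "0 \<le> x" and dec: "decays F D"
    and S: "\<And>y. y \<ge> x \<Longrightarrow> data_norm (F y) (D y) \<le> S" and eta: "\<And>y. integral {x..y} (\<lambda>x. cmod (q x)) \<le> \<eta>"
  shows "cmod (osc_mode m F D x) \<le> S * \<eta>"
proof -
  have S0: "S \<ge> 0" using S[of x] data_norm_nonneg[of "F x" "D x"] by simp
  have "cmod (osc_mode m F D x) \<le> cmod (osc_mode m F D t) + S * \<eta>" if t: "t \<ge> x" for t
  proof -
    have B: "(\<lambda>x. S * cmod (q x)) integrable_on {x..t}"
      using norm_q_integrable'[OF x] by (intro integrable_on_mult_right) auto
    have r: "cmod (cnj (q y) * F y $ 1 + q y * F y $ 2) \<le> S * cmod (q y)" if "y \<in> {x..t}" for y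
      using S[of y] that by (intro source_bound) auto
    have "cmod (osc_mode m F D x) \<le> cmod (osc_mode m F D t) + S * integral {x..t} (\<lambda>x. cmod (q x))"
      using mode_backward[OF osc_mode_eq(1)[OF F m(1)] x t m(2) osc_mode_eq(2)[OF F m(1)] B r] by simp
    then show ?thesis using mult_left_mono[OF eta S0, of t] by simp
  qed
  then have "\<forall>\<^sub>F t in at_top. cmod (osc_mode m F D x) \<le> cmod (osc_mode m F D t) + S * \<eta>"
    unfolding eventually_at_top_linorder by blast
  moreover have "((\<lambda>t. cmod (osc_mode m F D t) + S * \<eta>) \<longlongrightarrow> 0 + S * \<eta>) at_top"
    by (intro tendsto_add mode_tendsto_0[OF dec] tendsto_const)
  ultimately show ?thesis
    by (auto dest: tendsto_lowerbound)
qed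

lemma exp_mode_backward:
  assumes F: "cauchy_sol q z F D" and m: "m ^ 2 = z" "Re m \<ge> 0" and x: "0 \<le> x" and dec: "decays F D"
    and S: "\<And>y. y \<ge> x \<Longrightarrow> data_norm (F y) (D y) \<le> S" and eta: "\<And>y. integral {x..y} (\<lambda>x. cmod (q x)) \<le> \<eta>"
  shows "cmod (exp_mode m F D x) \<le> S * \<eta>"
proof -
  have S0: "S \<ge> 0" using S[of x] data_norm_nonneg[of "F x" "D x"] by simp
  have "cmod (exp_mode m F D x) \<le> cmod (exp_mode m F D t) + S * \<eta>" if t: "t \<ge> x" for t
  proof -
    have B: "(\<lambda>x. S * cmod (q x)) integrable_on {x..t}"
      using norm_q_integrable'[OF x] by (intro integrable_on_mult_right) auto
    have r: "cmod (cnj (q y) * F y $ 1 - q y * F y $ 2) \<le> S * cmod (q y)" if "y \<in> {x..t}" for y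
      using S[of y] that by (intro source_bound) auto
    have "cmod (exp_mode m F D x) \<le> cmod (exp_mode m F D t) + S * integral {x..t} (\<lambda>x. cmod (q x))"
      using mode_backward[OF exp_mode_eq(1)[OF F m(1)] x t m(2) exp_mode_eq(2)[OF F m(1)] B r] by simp
    then show ?thesis using mult_left_mono[OF eta S0, of t] by simp
  qed
  then have "\<forall>\<^sub>F t in at_top. cmod (exp_mode m F D x) \<le> cmod (exp_mode m F D t) + S * \<eta>"
    unfolding eventually_at_top_linorder by blast
  moreover have "((\<lambda>t. cmod (exp_mode m F D t) + S * \<eta>) \<longlongrightarrow> 0 + S * \<eta>) at_top"
    by (intro tendsto_add mode_tendsto_0[OF dec] tendsto_const)
  ultimately show ?thesis
    by (auto dest: tendsto_lowerbound)
qed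

text \<open>The least upper bound property is the point: an estimate of the data beyond
  \<open>X\<close> in terms of \<open>S\<close> becomes an inequality for \<open>S\<close> itself
  and can be absorbed.\<close>

lemma decaying_sup:
  assumes F: "cauchy_sol q z F D" and dec: "decays F D" and X: "X \<ge> 0"
  obtains S where "\<And>x. x \<ge> X \<Longrightarrow> data_norm (F x) (D x) \<le> S" "S \<ge> 0"
    "\<And>S'. (\<And>x. x \<ge> X \<Longrightarrow> data_norm (F x) (D x) \<le> S') \<Longrightarrow> S \<le> S'"
proof -
  obtain Y where Y: "\<And>x. x \<ge> Y \<Longrightarrow> data_norm (F x) (D x) < 1"
    using order_tendstoD(2)[OF dec[unfolded decays_def], of 1] by (auto simp: eventually_at_top_linorder)
  have "bounded ((\<lambda>x. data_norm (F x) (D x)) ` {X..max X Y})"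
    using X by (intro compact_imp_bounded compact_continuous_image continuous_on_subset[OF data_norm_sol_cont[OF F]]) auto
  then obtain B where B: "\<And>x. x \<in> {X..max X Y} \<Longrightarrow> \<bar>data_norm (F x) (D x)\<bar> \<le> B"
    unfolding bounded_real by blast
  have bdd: "bdd_above ((\<lambda>x. data_norm (F x) (D x)) ` {X..})"
  proof (rule bdd_aboveI2)
    show "data_norm (F x) (D x) \<le> max 1 B" if "x \<in> {X..}" for x
      using that Y[of x] B[of x] by (cases "x \<ge> Y") auto
  qed
  define S where "S = (SUP x\<in>{X..}. data_norm (F x) (D x))"
  have up: "data_norm (F x) (D x) \<le> S" if "x \<ge> X" for x
    unfolding S_def using that by (intro cSUP_upper bdd) auto
  show ?thesis
  proof (rule that)
    show "S \<ge> 0" using up[of X] data_norm_nonneg[of "F X" "D X"] by simp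
    show "S \<le> S'" if "\<And>x. x \<ge> X \<Longrightarrow> data_norm (F x) (D x) \<le> S'" for S'
      unfolding S_def using that by (intro cSUP_least) auto
  qed (rule up)
qed

end

text \<open>Within distance k / 2 of k the root has modulus at least k / 2, which frees the constant
  from m.\<close>

lemma mode_sum_bound:
  assumes k: "k > 0" and m: "cmod (m - of_real k) \<le> k / 2"
  shows "data_norm (F x) (D x) \<le> (2 / k + 1) *
    (cmod (osc_mode (\<i> * m) F D x) + cmod (osc_mode (- (\<i> * m)) F D x) + cmod (exp_mode m F D x) + cmod (exp_mode (- m) F D x))"
proof -
  have "k \<le> cmod m + k / 2"
    using norm_triangle_sub[of "complex_of_real k" m] m k by (simp add: norm_minus_commute)
  then have c: "k / 2 \<le> cmod m" by simp
  then have "m \<noteq> 0" using k by auto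
  moreover have "1 / cmod m + 1 \<le> 2 / k + 1" 
  proof -
    have "cmod m > 0" using c k by linarith
    then have "k * 1 \<le> 2 * cmod m" "k > 0" using c k by auto
    then show ?thesis using \<open>cmod m > 0\<close> by (simp add: divide_simps algebra_simps)
  qed
  ultimately show ?thesis
    by (intro order_trans[OF data_norm_le_modes mult_right_mono]) simp_all
qed

context potential
begin

text \<open>In the first quadrant the exponents m and - i m have nonnegative real part and are
  estimated from infinity, while i m and - m are estimated forward from \<open>X\<close>. Since the
  sizes of the real parts never enter, the bound persists up to the real axis. Gronwall connects
  \<open>X\<close> with 0.\<close>

lemma decaying_bound:
  assumes k: "k > 0"
  shows "\<exists>C\<ge>1. \<forall>m F D. cmod (m - of_real k) \<le> k / 2 \<longrightarrow> Re m \<ge> 0 \<longrightarrow> Im m \<ge> 0 \<longrightarrow> cauchy_sol q (m\<^sup>2) F D \<longrightarrow> decays F D \<longrightarrow>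
     (\<forall>x\<ge>0. data_norm (F x) (D x) \<le> C * data_norm (F 0) (D 0))"
proof -
  define c1 where "c1 = 2 / k + 1"
  define c2 where "c2 = 1 + 2 * k"
  have c: "c1 > 0" "c2 > 0" using k by (auto simp: c1_def c2_def add_pos_pos)
  \<comment> \<open>Each of the four modes receives at most S / (8 c1) from the potential; after
    multiplication by c1 this amounts to S / 2 and is absorbed.\<close>
  obtain X where X: "X \<ge> 0" "\<And>x y. x \<ge> X \<Longrightarrow> integral {x..y} (\<lambda>x. cmod (q x)) \<le> 1 / (8 * c1)"
    using norm_q_tail[of "1 / (8 * c1)"] c by auto
  obtain C where C: "C \<ge> 1" "\<And>z F D s t. cmod z \<le> 4 * k\<^sup>2 \<Longrightarrow> cauchy_sol q z F D \<Longrightarrow> s \<in> {0..X} \<Longrightarrow> t \<in> {0..X} \<Longrightarrow> data_norm (F s) (D s) \<le> C * data_norm (F t) (D t)"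
    using cauchy_sol_gronwall[of "4 * k\<^sup>2" X] by (metis (no_types, lifting))
  show ?thesis
  proof (intro exI[of _ "max C (4 * c1 * c2 * C)"] conjI allI impI)
    show "1 \<le> max C (4 * c1 * c2 * C)" using C(1) by simp
    fix m F D x
    assume m: "cmod (m - of_real k) \<le> k / 2" "Re m \<ge> 0" "Im m \<ge> 0" and F: "cauchy_sol q (m\<^sup>2) F D" and dec: "decays F D" and x: "(x::real) \<ge> 0"
    have cm: "cmod m \<le> 2 * k"
      using norm_triangle_sub[of m "complex_of_real k"] m(1) k by simp
    then have "cmod (m\<^sup>2) \<le> 4 * k\<^sup>2"
      using power_mono[OF cm, of 2] by (simp add: norm_power power_mult_distrib)
    note gr = C(2)[OF this F]
    obtain S where S: "\<And>x. x \<ge> X \<Longrightarrow> data_norm (F x) (D x) \<le> S" "S \<ge> 0"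
      "\<And>S'. (\<And>x. x \<ge> X \<Longrightarrow> data_norm (F x) (D x) \<le> S') \<Longrightarrow> S \<le> S'"
      using decaying_sup[OF F dec X(1)] by blast
    have "S \<le> c1 * (2 * c2 * data_norm (F X) (D X) + 4 * (S * (1 / (8 * c1))))"
    proof (rule S(3))
      fix x assume xX: "x \<ge> X"
      then have x0: "x \<ge> 0" using X(1) by simp
      have b: "cmod (osc_mode (- (\<i> * m)) F D x) \<le> S * (1 / (8 * c1))" "cmod (exp_mode m F D x) \<le> S * (1 / (8 * c1))"
        by (rule osc_mode_backward[OF F _ _ x0 dec S(1) X(2)] exp_mode_backward[OF F _ _ x0 dec S(1) X(2)];
            use m xX in \<open>simp add: power_mult_distrib\<close>)+
      have I: "S * integral {X..x} (\<lambda>x. cmod (q x)) \<le> S * (1 / (8 * c1))"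
        by (intro mult_left_mono S X) auto
      have c2: "(1 + cmod n) * data_norm (F X) (D X) \<le> c2 * data_norm (F X) (D X)" if "cmod n = cmod m" for n
        using that cm by (intro mult_right_mono data_norm_nonneg) (simp add: c2_def)
      have "cmod (osc_mode (\<i> * m) F D x) \<le> cmod (osc_mode (\<i> * m) F D X) + S * integral {X..x} (\<lambda>x. cmod (q x))"
        by (rule osc_mode_forward[OF F _ _ X(1) xX S(1)]) (use m in \<open>auto simp: power_mult_distrib\<close>)
      moreover have "cmod (exp_mode (- m) F D x) \<le> cmod (exp_mode (- m) F D X) + S * integral {X..x} (\<lambda>x. cmod (q x))"
        by (rule exp_mode_forward[OF F _ _ X(1) xX S(1)]) (use m in \<open>auto simp: power_mult_distrib\<close>)
      ultimately have "cmod (osc_mode (\<i> * m) F D x) + cmod (osc_mode (- (\<i> * m)) F D x) + cmod (exp_mode m F D x) + cmod (exp_mode (- m) F D x)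
         \<le> 2 * c2 * data_norm (F X) (D X) + 4 * (S * (1 / (8 * c1)))"
        using b I c2[of "\<i> * m"] c2[of "- m"] mode_bound(1)[of "\<i> * m" F D X] mode_bound(2)[of "- m" F D X]
        by (simp add: norm_mult)
      then have "c1 * (cmod (osc_mode (\<i> * m) F D x) + cmod (osc_mode (- (\<i> * m)) F D x) + cmod (exp_mode m F D x) + cmod (exp_mode (- m) F D x))
         \<le> c1 * (2 * c2 * data_norm (F X) (D X) + 4 * (S * (1 / (8 * c1))))"
        using c by (intro mult_left_mono) auto
      then show "data_norm (F x) (D x) \<le> c1 * (2 * c2 * data_norm (F X) (D X) + 4 * (S * (1 / (8 * c1))))"
        using mode_sum_bound[OF k m(1), of F x D] unfolding c1_def[symmetric] by linarith
    qed
    also have "\<dots> = 2 * c1 * c2 * data_norm (F X) (D X) + S / 2" using c by (simp add: algebra_simps)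
    finally have SX: "S \<le> 4 * c1 * c2 * data_norm (F X) (D X)" by simp
    also have "\<dots> \<le> 4 * c1 * c2 * (C * data_norm (F 0) (D 0))"
      using gr[of X 0] X(1) c by (intro mult_left_mono) auto
    finally have SX: "S \<le> 4 * c1 * c2 * C * data_norm (F 0) (D 0)" by simp
    show "data_norm (F x) (D x) \<le> max C (4 * c1 * c2 * C) * data_norm (F 0) (D 0)"
    proof (cases "x \<ge> X")
      case True
      then have "data_norm (F x) (D x) \<le> 4 * c1 * c2 * C * data_norm (F 0) (D 0)" using S(1) SX by fastforce
      also have "\<dots> \<le> max C (4 * c1 * c2 * C) * data_norm (F 0) (D 0)"
        by (intro mult_right_mono data_norm_nonneg) auto
      finally show ?thesis .
    next
      case False
      then have "data_norm (F x) (D x) \<le> C * data_norm (F 0) (D 0)" using gr[of x 0] x X(1) by auto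
      also have "\<dots> \<le> max C (4 * c1 * c2 * C) * data_norm (F 0) (D 0)"
        by (intro mult_right_mono data_norm_nonneg) auto
      finally show ?thesis .
    qed
  qed
qed

text \<open>
  At a real spectral parameter three of the four modes of a decaying solution are determined by
  their vanishing at infinity, so the remaining one determines the solution.
\<close>

lemma decaying_unique:
  assumes k: "k > 0"
  shows "\<exists>X\<ge>0. \<forall>F D. cauchy_sol q (of_real (k\<^sup>2)) F D \<longrightarrow> decays F D \<longrightarrow> exp_mode (- of_real k) F D X = 0 \<longrightarrow>
     (\<forall>x\<ge>0. data_norm (F x) (D x) = 0)"
proof -
  define c1 where "c1 = 2 / k + 1"
  have c: "c1 > 0" using k by (auto simp: c1_def add_pos_pos)
  obtain X where X: "X \<ge> 0" "\<And>x y. x \<ge> X \<Longrightarrow> integral {x..y} (\<lambda>x. cmod (q x)) \<le> 1 / (8 * c1)"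
    using norm_q_tail[of "1 / (8 * c1)"] c by auto
  obtain C where C: "C \<ge> 1" "\<And>z F D s t. cmod z \<le> k\<^sup>2 \<Longrightarrow> cauchy_sol q z F D \<Longrightarrow> s \<in> {0..X} \<Longrightarrow> t \<in> {0..X} \<Longrightarrow> data_norm (F s) (D s) \<le> C * data_norm (F t) (D t)"
    using cauchy_sol_gronwall[of "k\<^sup>2" X] by (metis (no_types, lifting))
  show ?thesis
  proof (intro exI[of _ X] conjI X(1) allI impI)
    fix F D x
    assume F: "cauchy_sol q (of_real (k\<^sup>2)) F D" and dec: "decays F D" and 0: "exp_mode (- of_real k) F D X = 0" and x: "(x::real) \<ge> 0"
    have "cmod (of_real (k\<^sup>2)) \<le> k\<^sup>2" by (simp add: norm_power)
    note gr = C(2)[OF this F]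
    obtain S where S: "\<And>x. x \<ge> X \<Longrightarrow> data_norm (F x) (D x) \<le> S" "S \<ge> 0"
      "\<And>S'. (\<And>x. x \<ge> X \<Longrightarrow> data_norm (F x) (D x) \<le> S') \<Longrightarrow> S \<le> S'"
      using decaying_sup[OF F dec X(1)] by blast
    let ?m = "complex_of_real k"
    have "S \<le> c1 * (4 * (S * (1 / (8 * c1))))"
    proof (rule S(3))
      fix x assume xX: "x \<ge> X"
      then have x0: "x \<ge> 0" using X(1) by simp
      \<comment> \<open>At a real parameter i k has real part 0 as well, so both oscillating modes
        are estimated from infinity. Only the decaying exponential keeps an initial term, and that
        one vanishes by assumption.\<close>
      have b: "cmod (osc_mode (- (\<i> * ?m)) F D x) \<le> S * (1 / (8 * c1))" "cmod (osc_mode (\<i> * ?m) F D x) \<le> S * (1 / (8 * c1))"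
         "cmod (exp_mode ?m F D x) \<le> S * (1 / (8 * c1))"
        by (rule osc_mode_backward[OF F _ _ x0 dec S(1) X(2)] exp_mode_backward[OF F _ _ x0 dec S(1) X(2)];
            use k xX in \<open>simp add: power_mult_distrib\<close>)+
      have I: "S * integral {X..x} (\<lambda>x. cmod (q x)) \<le> S * (1 / (8 * c1))"
        by (intro mult_left_mono S X) auto
      have "cmod (exp_mode (- ?m) F D x) \<le> cmod (exp_mode (- ?m) F D X) + S * integral {X..x} (\<lambda>x. cmod (q x))"
        by (rule exp_mode_forward[OF F _ _ X(1) xX S(1)]) (use k in \<open>auto simp: power_mult_distrib\<close>)
      then have "cmod (osc_mode (\<i> * ?m) F D x) + cmod (osc_mode (- (\<i> * ?m)) F D x) + cmod (exp_mode ?m F D x) + cmod (exp_mode (- ?m) F D x)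
         \<le> 4 * (S * (1 / (8 * c1)))"
        using b I 0 by simp
      then have "c1 * (cmod (osc_mode (\<i> * ?m) F D x) + cmod (osc_mode (- (\<i> * ?m)) F D x) + cmod (exp_mode ?m F D x) + cmod (exp_mode (- ?m) F D x))
         \<le> c1 * (4 * (S * (1 / (8 * c1))))"
        using c by (intro mult_left_mono) auto
      then show "data_norm (F x) (D x) \<le> c1 * (4 * (S * (1 / (8 * c1))))"
        using mode_sum_bound[OF k, of ?m F x D] k unfolding c1_def[symmetric] by simp
    qed
    also have "\<dots> = S / 2" using c by simp
    finally have "S = 0" using S(2) by simp
    then have big: "data_norm (F x) (D x) = 0" if "x \<ge> X" for x using S(1)[OF that] data_norm_nonneg[of "F x" "D x"] by simp
    show "data_norm (F x) (D x) = 0"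
    proof (cases "x \<ge> X")
      case False
      then show ?thesis using gr[of x X] big[of X] x X(1) data_norm_nonneg[of "F x" "D x"] by auto
    qed (rule big)
  qed
qed

text \<open>The value at \<open>X\<close> of the decaying exponential mode is a linear functional
  that is injective on decaying solutions, so these form a space of dimension at most one. The
  factor is the quotient of the two functionals.\<close>

lemma decaying_multiple:
  assumes k: "k > 0" and F: "cauchy_sol q (of_real (k\<^sup>2)) F D" "decays F D"
    and G: "cauchy_sol q (of_real (k\<^sup>2)) G E" "decays G E" and nz: "x0 \<ge> 0" "data_norm (G x0) (E x0) \<noteq> 0"
  obtains c where "\<And>x. x \<ge> 0 \<Longrightarrow> F x = c *s G x" "\<And>x. x \<ge> 0 \<Longrightarrow> D x = c *s E x"
proof -
  obtain X where X: "X \<ge> 0" "\<And>F D x. cauchy_sol q (of_real (k\<^sup>2)) F D \<Longrightarrow> decays F D \<Longrightarrow> exp_mode (- of_real k) F D X = 0 \<Longrightarrow>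
     x \<ge> 0 \<Longrightarrow> data_norm (F x) (D x) = 0"
    using decaying_unique[OF k] by blast
  let ?u = "exp_mode (- of_real k)"
  have g: "?u G E X \<noteq> 0" using X(2)[OF G _ nz(1)] nz(2) by blast
  define c where "c = ?u F D X / ?u G E X"
  have "data_norm (1 *s F x + (- c) *s G x) (1 *s D x + (- c) *s E x) = 0" if "x \<ge> 0" for x
  proof (rule X(2)[OF cauchy_sol_lin[OF F(1) G(1)] decays_lin[OF F(2) G(2)] _ that])
    have "?u (\<lambda>x. 1 *s F x + (- c) *s G x) (\<lambda>x. 1 *s D x + (- c) *s E x) X = ?u F D X - c * ?u G E X"
      by (simp add: exp_mode_def algebra_simps)
    then show "?u (\<lambda>x. 1 *s F x + (- c) *s G x) (\<lambda>x. 1 *s D x + (- c) *s E x) X = 0"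
      using g by (simp add: c_def)
  qed
  then have "F x = c *s G x \<and> D x = c *s E x" if "x \<ge> 0" for x
    using that unfolding data_norm_eq_0 by (simp add: vec_eq_iff)
  then show ?thesis using that by blast
qed

end

section \<open>Outgoing solutions\<close>

lemma bounded_halfline:
  fixes f :: "real \<Rightarrow> real"
  assumes f: "continuous_on {0..} f" and Y: "\<And>x. x \<ge> Y \<Longrightarrow> f x \<le> b"
  shows "\<exists>B. \<forall>x\<ge>0. f x \<le> B"
proof -
  have "bounded (f ` {0..max 0 Y})"
    by (intro compact_imp_bounded compact_continuous_image continuous_on_subset[OF f]) auto
  then obtain B where B: "\<forall>x\<in>{0..max 0 Y}. \<bar>f x\<bar> \<le> B"
    unfolding bounded_real by blast
  have "f x \<le> max B b" if "x \<ge> 0" for x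
    using that Y[of x] B[rule_format, of x] by (cases "x \<ge> Y") auto
  then show ?thesis by blast
qed

text \<open>A radiation condition: the mode belonging to exp(-ikx) and the antisymmetric part vanish
  at infinity, whereas the amplitude of exp(ikx) is left free. Both F_{+i} and decaying solutions
  satisfy it, so one Wronskian estimate serves both Jost solutions.\<close>

definition outgoing ::
    "(real \<Rightarrow> complex) \<Rightarrow> real \<Rightarrow> (real \<Rightarrow> complex^2) \<Rightarrow> (real \<Rightarrow> complex^2) \<Rightarrow> bool" where
  "outgoing q k P DP \<longleftrightarrow>
     cauchy_sol q (of_real (k\<^sup>2)) P DP \<and> (\<exists>B. \<forall>x\<ge>0. data_norm (P x) (DP x) \<le> B) \<and>
     (osc_mode (- (\<i> * of_real k)) P DP \<longlongrightarrow> 0) at_top \<and>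
     ((\<lambda>x. P x $ 1 - P x $ 2) \<longlongrightarrow> 0) at_top \<and> ((\<lambda>x. DP x $ 1 - DP x $ 2) \<longlongrightarrow> 0) at_top"

lemma decays_nth:
  assumes "decays F D"
  shows "((\<lambda>x. F x $ i) \<longlongrightarrow> 0) at_top" "((\<lambda>x. D x $ i) \<longlongrightarrow> 0) at_top"
  by (rule Lim_null_comparison[OF _ assms[unfolded decays_def]]; auto intro!: always_eventually data_norm_bounds)+

lemma decays_outgoing:
  assumes F: "cauchy_sol q (of_real (k\<^sup>2)) F D" and dec: "decays F D"
  shows "outgoing q k F D"
  unfolding outgoing_def
proof (intro conjI)
  obtain Y where "\<And>x. x \<ge> Y \<Longrightarrow> data_norm (F x) (D x) < 1"
    using order_tendstoD(2)[OF dec[unfolded decays_def], of 1] by (auto simp: eventually_at_top_linorder)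
  then show "\<exists>B. \<forall>x\<ge>0. data_norm (F x) (D x) \<le> B"
    by (intro bounded_halfline[OF data_norm_sol_cont[OF F]]) (rule less_imp_le)
  let ?m = "- (\<i> * complex_of_real k)"
  have "((\<lambda>x. (D x $ 1 + D x $ 2) + ?m * (F x $ 1 + F x $ 2)) \<longlongrightarrow> (0 + 0) + ?m * (0 + 0)) at_top"
    by (intro tendsto_add tendsto_mult tendsto_const decays_nth[OF dec])
  then show "(osc_mode ?m F D \<longlongrightarrow> 0) at_top" by (simp add: osc_mode_def[abs_def])
  have "((\<lambda>x. F x $ 1 - F x $ 2) \<longlongrightarrow> 0 - 0) at_top" "((\<lambda>x. D x $ 1 - D x $ 2) \<longlongrightarrow> 0 - 0) at_top"
    by (intro tendsto_diff decays_nth[OF dec])+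
  then show "((\<lambda>x. F x $ 1 - F x $ 2) \<longlongrightarrow> 0) at_top" "((\<lambda>x. D x $ 1 - D x $ 2) \<longlongrightarrow> 0) at_top"
    by simp_all
qed (rule F)

text \<open>The principal root has nonnegative real part, and Im z >= 0 then places it in the closed
  first quadrant. There |m + k| >= k, and the factorisation of z - k^2 gives a Lipschitz bound for
  the root.\<close>

lemma csqrt_near:
  assumes k: "k > 0" and z: "Im z \<ge> 0"
  shows "Re (csqrt z) \<ge> 0" "Im (csqrt z) \<ge> 0" "cmod (csqrt z - of_real k) \<le> cmod (z - of_real (k\<^sup>2)) / k"
proof -
  define m where "m = csqrt z"
  have m2: "z = m * m" using power2_csqrt[of z] by (simp add: m_def power2_eq_square)
  have pr: "Re m > 0 \<or> Re m = 0 \<and> Im m \<ge> 0" unfolding m_def by (rule csqrt_principal)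
  then show re: "Re (csqrt z) \<ge> 0" by (auto simp: m_def)
  have "Re m * Im m \<ge> 0" using z m2 by (simp add: mult.commute)
  then show "Im (csqrt z) \<ge> 0" using pr by (auto simp: m_def zero_le_mult_iff)
  have "z - of_real (k\<^sup>2) = (m - of_real k) * (m + of_real k)"
    by (simp add: m2 algebra_simps power2_eq_square)
  then have "cmod (z - of_real (k\<^sup>2)) = cmod (m - of_real k) * cmod (m + of_real k)"
    by (simp add: norm_mult)
  moreover have "k \<le> cmod (m + of_real k)"
    using complex_Re_le_cmod[of "m + of_real k"] re[folded m_def] by simp
  ultimately have "cmod (m - of_real k) * k \<le> cmod (z - of_real (k\<^sup>2))"
    by (simp add: mult_left_mono)
  then show "cmod (csqrt z - of_real k) \<le> cmod (z - of_real (k\<^sup>2)) / k"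
    using k by (simp add: m_def field_simps)
qed

context potential
begin

lemma decaying_bound_near:
  assumes k: "k > 0"
  shows "\<exists>C\<ge>1. \<forall>z F D. cmod (z - of_real (k\<^sup>2)) \<le> k\<^sup>2 / 2 \<longrightarrow> Im z \<ge> 0 \<longrightarrow> cauchy_sol q z F D \<longrightarrow> decays F D \<longrightarrow>
     (\<forall>x\<ge>0. data_norm (F x) (D x) \<le> C * data_norm (F 0) (D 0))"
proof -
  obtain C where C: "C \<ge> 1" "\<And>m F D x. cmod (m - of_real k) \<le> k / 2 \<Longrightarrow> Re m \<ge> 0 \<Longrightarrow> Im m \<ge> 0 \<Longrightarrow> cauchy_sol q (m\<^sup>2) F D \<Longrightarrow> decays F D \<Longrightarrow>
     x \<ge> 0 \<Longrightarrow> data_norm (F x) (D x) \<le> C * data_norm (F 0) (D 0)"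
    using decaying_bound[OF k] by (metis (no_types, lifting))
  have "cmod (csqrt z - of_real k) \<le> k / 2" if "cmod (z - of_real (k\<^sup>2)) \<le> k\<^sup>2 / 2" "Im z \<ge> 0" for z
  proof -
    have "cmod (z - of_real (k\<^sup>2)) / k \<le> k\<^sup>2 / 2 / k" using that k by (intro divide_right_mono) auto
    also have "\<dots> = k / 2" using k by (simp add: power2_eq_square)
    finally show ?thesis using csqrt_near(3)[OF k that(2)] by linarith
  qed
  then have "data_norm (F x) (D x) \<le> C * data_norm (F 0) (D 0)"
    if "cmod (z - of_real (k\<^sup>2)) \<le> k\<^sup>2 / 2" "Im z \<ge> 0" "cauchy_sol q z F D" "decays F D" "x \<ge> 0" for z F D x
    using C(2)[OF _ csqrt_near(1,2)[OF k that(2)] _ that(4,5)] that by (simp only: power2_csqrt)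
  then show ?thesis using C(1) by blast
qed

text \<open>
  A decaying solution near the real axis is almost outgoing, uniformly in the spectral parameter, so that its
  Wronskian with an outgoing solution is small far out; the Wronskian changes little on the way
  back to 0 because the spectral parameters are close.
\<close>

lemma wronskian_outgoing_small:
  assumes k: "k > 0" and P: "outgoing q k P DP" and eta: "\<eta> > 0"
  shows "\<exists>\<rho>>0. \<forall>z F D. cmod (z - of_real (k\<^sup>2)) < \<rho> \<longrightarrow> Im z \<ge> 0 \<longrightarrow> cauchy_sol q z F D \<longrightarrow> decays F D \<longrightarrow>
     cmod (wronskian P DP F D 0) \<le> \<eta> * data_norm (F 0) (D 0)"
proof -
  obtain C where C: "C \<ge> 1" "\<And>z F D x. cmod (z - of_real (k\<^sup>2)) \<le> k\<^sup>2 / 2 \<Longrightarrow> Im z \<ge> 0 \<Longrightarrow> cauchy_sol q z F D \<Longrightarrow> decays F D \<Longrightarrow>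
     x \<ge> 0 \<Longrightarrow> data_norm (F x) (D x) \<le> C * data_norm (F 0) (D 0)"
    using decaying_bound_near[OF k] by (metis (no_types, lifting))
  have Psol: "cauchy_sol q (of_real (k\<^sup>2)) P DP" using P by (simp add: outgoing_def)
  obtain B where B: "\<And>x. x \<ge> 0 \<Longrightarrow> data_norm (P x) (DP x) \<le> B"
    using P by (auto simp: outgoing_def)
  have B0: "B \<ge> 0" using B[of 0] data_norm_nonneg[of "P 0" "DP 0"] by simp
  \<comment> \<open>At the far point the product of sums contributes B e and three further pairings
    contribute e each, all multiplied by the bound C for the decaying solution. This choice makes
    their total eta / 2.\<close>
  define e where "e = \<eta> / (2 * C * (B + 3))"
  have e: "e > 0" using eta C(1) B0 by (simp add: e_def)
  have "\<forall>\<^sub>F x in at_top. cmod (osc_mode (- (\<i> * of_real k)) P DP x) < e"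
    "\<forall>\<^sub>F x in at_top. cmod (P x $ 1 - P x $ 2) < e" "\<forall>\<^sub>F x in at_top. cmod (DP x $ 1 - DP x $ 2) < e"
    using P e unfolding outgoing_def tendsto_iff by auto
  then have "\<forall>\<^sub>F x in at_top. cmod (osc_mode (- (\<i> * of_real k)) P DP x) < e \<and>
      cmod (P x $ 1 - P x $ 2) < e \<and> cmod (DP x $ 1 - DP x $ 2) < e"
    by eventually_elim simp
  then obtain Y where Y: "\<And>x. x \<ge> Y \<Longrightarrow> cmod (osc_mode (- (\<i> * of_real k)) P DP x) < e \<and>
      cmod (P x $ 1 - P x $ 2) < e \<and> cmod (DP x $ 1 - DP x $ 2) < e"
    unfolding eventually_at_top_linorder by blast
  obtain X0 where X0: "X0 \<ge> 0" "\<And>x y. x \<ge> X0 \<Longrightarrow> integral {x..y} (\<lambda>x. cmod (q x)) \<le> e"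
    using norm_q_tail[OF e] by auto
  define X where "X = max X0 Y"
  have X: "X \<ge> 0" "X \<ge> X0" "X \<ge> Y" using X0 by (auto simp: X_def)
  \<comment> \<open>\<open>K\<close> collects the two errors caused by z differing from k^2: the
    difference of the square roots at \<open>X\<close>, at most r / k, and the drift of the
    Wronskian over [0, X].\<close>
  define K where "K = C * B * (1 / k + X)"
  have K0: "K \<ge> 0" using C(1) B0 k X by (simp add: K_def)
  define r where "r = min (k\<^sup>2 / 2) (\<eta> / (2 * (K + 1)))"
  have r: "r > 0" "r \<le> k\<^sup>2 / 2"
    using k eta K0 by (simp_all only: r_def min.cobounded1) simp
  have rK: "r * K \<le> \<eta> / 2"
  proof -
    have "r * K \<le> (\<eta> / (2 * (K + 1))) * (K + 1)"
      using K0 eta by (intro mult_mono) (auto simp: r_def)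
    also have "\<dots> = \<eta> / 2" using K0 by (simp add: field_simps)
    finally show ?thesis .
  qed
  show ?thesis
  proof (intro exI[of _ r] conjI r(1) allI impI)
    fix z F D
    assume z: "cmod (z - of_real (k\<^sup>2)) < r" "Im z \<ge> 0" and F: "cauchy_sol q z F D" and dec: "decays F D"
    define N where "N = data_norm (F 0) (D 0)"
    have N0: "N \<ge> 0" by (simp add: N_def data_norm_nonneg)
    define m where "m = csqrt z"
    note m = csqrt_near[OF k z(2), folded m_def]
    have m2: "m\<^sup>2 = z" by (simp add: m_def)
    have FB: "data_norm (F x) (D x) \<le> C * N" if "x \<ge> 0" for x
      unfolding N_def using C(2)[OF _ z(2) F dec that] z(1) r(2) by simp
    define a a' b b' where "a = F X $ 1 + F X $ 2" and "a' = D X $ 1 + D X $ 2"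
      and "b = F X $ 1 - F X $ 2" and "b' = D X $ 1 - D X $ 2"
    define c c' d d' where "c = P X $ 1 + P X $ 2" and "c' = DP X $ 1 + DP X $ 2"
      and "d = P X $ 1 - P X $ 2" and "d' = DP X $ 1 - DP X $ 2"
    have nnp: "cmod (v $ 1 + v $ 2) \<le> data_norm v w" "cmod (v $ 1 - v $ 2) \<le> data_norm v w" "cmod (w $ 1 - w $ 2) \<le> data_norm v w" for v w
      using norm_triangle_ineq[of "v $ 1" "v $ 2"] norm_triangle_ineq4[of "v $ 1" "v $ 2"] norm_triangle_ineq4[of "w $ 1" "w $ 2"]
        norm_ge_zero[of "v $ 1"] norm_ge_zero[of "v $ 2"] norm_ge_zero[of "w $ 1"] norm_ge_zero[of "w $ 2"]
      unfolding data_norm_def by linarith+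
    have bd: "cmod a \<le> C * N" "cmod b \<le> C * N" "cmod b' \<le> C * N" "cmod c \<le> B"
      unfolding a_def b_def b'_def c_def
      using nnp order_trans[OF _ FB[OF X(1)]] order_trans[OF _ B[OF X(1)]] by blast+
    have mF: "cmod (osc_mode (- (\<i> * m)) F D X) \<le> (C * N) * e"
      by (rule osc_mode_backward[OF F _ _ X(1) dec FB X0(2)])
        (use m X m2 in \<open>auto simp: power_mult_distrib\<close>)
    \<comment> \<open>In sum and difference variables the oscillating part of the Wronskian is
      rewritten through the modes - i m of \<open>F\<close> and - i k of \<open>P\<close>, both
      small far out, with a remainder proportional to m - k. The exponential part is small because
      \<open>P\<close> has a vanishing antisymmetric part.\<close>
    have W2: "2 * wronskian P DP F D X = c * osc_mode (- (\<i> * m)) F D X - osc_mode (- (\<i> * of_real k)) P DP X * a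
        + \<i> * (m - of_real k) * c * a + d * b' - d' * b"
      unfolding wronskian_def osc_mode_def a_def b_def c_def d_def b'_def d'_def by (simp add: algebra_simps)
    have "cmod (2 * wronskian P DP F D X) \<le> cmod c * cmod (osc_mode (- (\<i> * m)) F D X) + cmod (osc_mode (- (\<i> * of_real k)) P DP X) * cmod a
        + cmod (m - of_real k) * (cmod c * cmod a) + cmod d * cmod b' + cmod d' * cmod b"
      unfolding W2
      by (rule order_trans[OF norm_triangle_ineq4 add_mono] order_trans[OF norm_triangle_ineq add_mono] | simp add: norm_mult)+
    also have "\<dots> \<le> B * ((C * N) * e) + e * (C * N) + (r / k) * (B * (C * N)) + e * (C * N) + e * (C * N)"
    proof (intro add_mono mult_mono)
      have "cmod (z - of_real (k\<^sup>2)) / k \<le> r / k" using z k by (intro divide_right_mono) auto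
      then show "cmod (m - of_real k) \<le> r / k" using m(3) by linarith
    qed (use bd mF Y[OF X(3)] B0 C N0 e r k in \<open>auto simp: d_def d'_def\<close>)
    finally have WX: "cmod (wronskian P DP F D X) \<le> B * ((C * N) * e) + e * (C * N) + (r / k) * (B * (C * N)) + e * (C * N) + e * (C * N)"
      by (simp add: norm_mult) (smt (verit) norm_ge_zero)
    have "cmod (wronskian P DP F D X - wronskian P DP F D 0) \<le> (r * (B * (C * N))) * measure lborel {0..X}"
    proof (rule has_integral_bound_real[OF _ _ wronskian_has_integral[OF Psol F order_refl X(1)]])
      show "0 \<le> r * (B * (C * N))" using r B0 C N0 by simp
      show "finite ({}::real set)" by simp
      fix x assume "x \<in> {0..X} - {}"
      then have x: "x \<ge> 0" by simp
      have "cmod (P x $ 1 * F x $ 2 + P x $ 2 * F x $ 1) \<le> data_norm (P x) (DP x) * data_norm (F x) (D x)"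
      proof -
        have "cmod (P x $ 1 * F x $ 2 + P x $ 2 * F x $ 1) \<le> (cmod (P x $ 1) + cmod (P x $ 2)) * data_norm (F x) (D x)"
          using norm_triangle_ineq[of "P x $ 1 * F x $ 2" "P x $ 2 * F x $ 1"]
            mult_left_mono[OF data_norm_bounds(1)[of "F x" 2 "D x"], of "cmod (P x $ 1)"]
            mult_left_mono[OF data_norm_bounds(1)[of "F x" 1 "D x"], of "cmod (P x $ 2)"]
          by (simp add: norm_mult algebra_simps)
        also have "\<dots> \<le> data_norm (P x) (DP x) * data_norm (F x) (D x)"
          by (intro mult_right_mono data_norm_nonneg) (simp add: data_norm_def)
        finally show ?thesis .
      qed
      also have "\<dots> \<le> B * (C * N)"
        by (intro mult_mono B FB x data_norm_nonneg B0)
      finally have "cmod (P x $ 1 * F x $ 2 + P x $ 2 * F x $ 1) \<le> B * (C * N)" .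
      then show "cmod ((of_real (k\<^sup>2) - z) * (P x $ 1 * F x $ 2 + P x $ 2 * F x $ 1)) \<le> r * (B * (C * N))"
        unfolding norm_mult using z(1) r by (intro mult_mono) (auto simp: norm_minus_commute)
    qed
    then have "cmod (wronskian P DP F D 0) \<le> cmod (wronskian P DP F D X) + r * (B * (C * N)) * X"
      using norm_triangle_sub[of "wronskian P DP F D 0" "wronskian P DP F D X"] X(1) by (simp add: norm_minus_commute)
    also have "\<dots> \<le> (C * (B + 3) * e + r * K) * N"
      using WX by (simp add: K_def algebra_simps)
    also have "C * (B + 3) * e = \<eta> / 2"
    proof -
      have "2 * C * (B + 3) \<noteq> 0" using C(1) B0 by simp
      from nonzero_eq_divide_eq[THEN iffD1, OF this e_def] show ?thesis by (simp add: algebra_simps)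
    qed
    also have "(\<eta> / 2 + r * K) * N \<le> \<eta> * N" using rK N0 by (intro mult_right_mono) auto
    finally show "cmod (wronskian P DP F D 0) \<le> \<eta> * data_norm (F 0) (D 0)" by (simp add: N_def)
  qed
qed

end

lemma wronskian_bound: "cmod (wronskian F D G E x) \<le> data_norm (F x) (D x) * data_norm (G x) (E x)"
proof -
  have "cmod (wronskian F D G E x) \<le> cmod (F x $ 1) * cmod (E x $ 1) + cmod (F x $ 2) * cmod (E x $ 2)
      + cmod (D x $ 1) * cmod (G x $ 1) + cmod (D x $ 2) * cmod (G x $ 2)"
    unfolding wronskian_def norm_mult[symmetric]
    by (intro order_trans[OF norm_triangle_ineq4 add_right_mono] order_trans[OF norm_triangle_ineq4 add_right_mono] norm_triangle_ineq)
  also have "\<dots> \<le> cmod (F x $ 1) * data_norm (G x) (E x) + cmod (F x $ 2) * data_norm (G x) (E x)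
      + cmod (D x $ 1) * data_norm (G x) (E x) + cmod (D x $ 2) * data_norm (G x) (E x)"
    by (intro add_mono mult_left_mono data_norm_bounds) auto
  also have "\<dots> = data_norm (F x) (D x) * data_norm (G x) (E x)" by (simp add: data_norm_def algebra_simps)
  finally show ?thesis .
qed

text \<open>The Wronskian is constant, as the parameters agree, and it tends to 0 at infinity as a
  product of bounded and decaying data.\<close>

lemma wronskian_bounded_decays:
  assumes F: "cauchy_sol q z F D" "\<And>x. x \<ge> 0 \<Longrightarrow> data_norm (F x) (D x) \<le> B" and G: "cauchy_sol q z G E" "decays G E"
  shows "wronskian F D G E 0 = 0"
proof -
  have "(wronskian F D G E \<longlongrightarrow> 0) at_top"
  proof (rule Lim_null_comparison)
    show "((\<lambda>x. B * data_norm (G x) (E x)) \<longlongrightarrow> 0) at_top"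
      using G(2) unfolding decays_def by (rule tendsto_mult_right_zero)
    show "\<forall>\<^sub>F x in at_top. cmod (wronskian F D G E x) \<le> B * data_norm (G x) (E x)"
      using eventually_ge_at_top[of 0]
      by eventually_elim (rule order_trans[OF wronskian_bound mult_right_mono[OF F(2) data_norm_nonneg]])
  qed
  moreover have "(wronskian F D G E \<longlongrightarrow> wronskian F D G E 0) at_top"
  proof (rule tendsto_eventually)
    show "\<forall>\<^sub>F x in at_top. wronskian F D G E x = wronskian F D G E 0"
      using eventually_ge_at_top[of 0] by eventually_elim (rule wronskian_const[OF F(1) G(1)])
  qed
  ultimately show ?thesis by (rule tendsto_unique[OF trivial_limit_at_top_linorder, rotated])
qed

lemma data_norm_dag: "data_norm (dag v) (dag w) = data_norm v w"
  by (simp add: data_norm_def)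

section \<open>Asymptotics of the Jost solutions\<close>

lemma jost_plus_asymptotics:
  assumes "jost_plus_i q k F"
  shows "((\<lambda>x. F x $ i - exp (\<i> * of_real (k * x))) \<longlongrightarrow> 0) at_top"
    "((\<lambda>x. hl_deriv F x $ i - \<i> * of_real k * exp (\<i> * of_real (k * x))) \<longlongrightarrow> 0) at_top"
proof -
  have ep: "e_plus $ i = 1" for i using exhaust_2[of i] by (auto simp: e_plus_def vector_2)
  have l: "((\<lambda>x. norm (F x - exp (\<i> * of_real (k * x)) *s e_plus)) \<longlongrightarrow> 0) at_top"
    "((\<lambda>x. norm (hl_deriv F x - (\<i> * of_real k * exp (\<i> * of_real (k * x))) *s e_plus)) \<longlongrightarrow> 0) at_top"
    using assms unfolding jost_plus_i_def by (auto dest!: smalloD_tendsto)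
  show "((\<lambda>x. F x $ i - exp (\<i> * of_real (k * x))) \<longlongrightarrow> 0) at_top"
  proof (rule Lim_null_comparison[OF always_eventually l(1)], rule allI)
    show "cmod (F x $ i - exp (\<i> * of_real (k * x))) \<le> norm (F x - exp (\<i> * of_real (k * x)) *s e_plus)" for x
      using Finite_Cartesian_Product.norm_nth_le[of "F x - exp (\<i> * of_real (k * x)) *s e_plus" i] by (simp add: ep)
  qed
  show "((\<lambda>x. hl_deriv F x $ i - \<i> * of_real k * exp (\<i> * of_real (k * x))) \<longlongrightarrow> 0) at_top"
  proof (rule Lim_null_comparison[OF always_eventually l(2)], rule allI)
    show "cmod (hl_deriv F x $ i - \<i> * of_real k * exp (\<i> * of_real (k * x)))
      \<le> norm (hl_deriv F x - (\<i> * of_real k * exp (\<i> * of_real (k * x))) *s e_plus)" for x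
      using Finite_Cartesian_Product.norm_nth_le[of "hl_deriv F x - (\<i> * of_real k * exp (\<i> * of_real (k * x))) *s e_plus" i] by (simp add: ep)
  qed
qed

lemma jost_plus_outgoing:
  assumes k: "k > 0" and F: "jost_plus_i q k F"
  shows "outgoing q k F (hl_deriv F)"
proof -
  note as = jost_plus_asymptotics[OF F]
  let ?e = "\<lambda>x. exp (\<i> * complex_of_real (k * x))" and ?D = "hl_deriv F"
  have cauchy_sol: "cauchy_sol q (of_real (k\<^sup>2)) F ?D" using F by (auto simp: jost_plus_i_def intro: herm_solution_sol)
  have "\<forall>\<^sub>F x in at_top. cmod (F x $ 1 - ?e x) < 1 \<and> cmod (F x $ 2 - ?e x) < 1 \<and>
      cmod (?D x $ 1 - \<i> * of_real k * ?e x) < 1 \<and> cmod (?D x $ 2 - \<i> * of_real k * ?e x) < 1"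
    using as(1)[of 1] as(1)[of 2] as(2)[of 1] as(2)[of 2] unfolding tendsto_iff
    by (auto intro!: eventually_conj)
  then obtain Y where Y: "\<And>x. x \<ge> Y \<Longrightarrow> cmod (F x $ 1 - ?e x) < 1 \<and> cmod (F x $ 2 - ?e x) < 1 \<and>
      cmod (?D x $ 1 - \<i> * of_real k * ?e x) < 1 \<and> cmod (?D x $ 2 - \<i> * of_real k * ?e x) < 1"
    unfolding eventually_at_top_linorder by blast
  have b1: "cmod (?e x) = 1" "cmod (\<i> * of_real k * ?e x) = k" for x
    using k by (simp_all add: norm_mult)
  have "data_norm (F x) (?D x) \<le> 6 + 2 * k" if "x \<ge> Y" for x
  proof -
    have h: "cmod a \<le> cmod b + 1" if "cmod (a - b) < 1" for a b :: complex
      using norm_triangle_sub[of a b] that by linarith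
    from Y[OF that] have "cmod (F x $ 1) \<le> 1 + 1" "cmod (F x $ 2) \<le> 1 + 1" "cmod (?D x $ 1) \<le> k + 1" "cmod (?D x $ 2) \<le> k + 1"
      using h[where b = "?e x"] h[where b = "\<i> * of_real k * ?e x"] unfolding b1 by blast+
    then show ?thesis unfolding data_norm_def by linarith
  qed
  then have bd: "\<exists>B. \<forall>x\<ge>0. data_norm (F x) (?D x) \<le> B" by (rule bounded_halfline[OF data_norm_sol_cont[OF cauchy_sol]])
  let ?m = "- (\<i> * complex_of_real k)"
  have "((\<lambda>x. ((?D x $ 1 - \<i> * of_real k * ?e x) + (?D x $ 2 - \<i> * of_real k * ?e x))
       + ?m * ((F x $ 1 - ?e x) + (F x $ 2 - ?e x))) \<longlongrightarrow> (0 + 0) + ?m * (0 + 0)) at_top"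
    by (intro tendsto_add tendsto_mult tendsto_const as)
  then have 1: "(osc_mode ?m F ?D \<longlongrightarrow> 0) at_top" by (simp add: osc_mode_def[abs_def] algebra_simps)
  have "((\<lambda>x. (F x $ 1 - ?e x) - (F x $ 2 - ?e x)) \<longlongrightarrow> 0 - 0) at_top"
    "((\<lambda>x. (?D x $ 1 - \<i> * of_real k * ?e x) - (?D x $ 2 - \<i> * of_real k * ?e x)) \<longlongrightarrow> 0 - 0) at_top"
    by (intro tendsto_diff as)+
  then have 2: "((\<lambda>x. F x $ 1 - F x $ 2) \<longlongrightarrow> 0) at_top" "((\<lambda>x. ?D x $ 1 - ?D x $ 2) \<longlongrightarrow> 0) at_top"
    by simp_all
  show ?thesis unfolding outgoing_def using cauchy_sol bd 1 2 by blast
qed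

text \<open>Neither factor needs to converge: the comparison functions oscillate and only their
  product is constant.\<close>

lemma tendsto_mult_asymptotic:
  fixes x y a b :: "real \<Rightarrow> complex"
  assumes "((\<lambda>t. x t - a t) \<longlongrightarrow> 0) F" "((\<lambda>t. y t - b t) \<longlongrightarrow> 0) F"
    and a: "\<And>t. cmod (a t) \<le> A" and b: "\<And>t. cmod (b t) \<le> B" and l: "\<And>t. a t * b t = l"
  shows "((\<lambda>t. x t * y t) \<longlongrightarrow> l) F"
proof -
  have "((\<lambda>t. (x t - a t) * (y t - b t) + (a t * (y t - b t) + b t * (x t - a t))) \<longlongrightarrow> 0 * 0 + (0 + 0)) F"
  proof (intro tendsto_add tendsto_mult assms)
    show "((\<lambda>t. a t * (y t - b t)) \<longlongrightarrow> 0) F"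
    proof (rule Lim_null_comparison[OF always_eventually])
      show "\<forall>t. norm (a t * (y t - b t)) \<le> A * norm (y t - b t)"
        using a by (auto simp: norm_mult intro: mult_right_mono)
      show "((\<lambda>t. A * norm (y t - b t)) \<longlongrightarrow> 0) F" using tendsto_norm_zero[OF assms(2)] by (rule tendsto_mult_right_zero)
    qed
    show "((\<lambda>t. b t * (x t - a t)) \<longlongrightarrow> 0) F"
    proof (rule Lim_null_comparison[OF always_eventually])
      show "\<forall>t. norm (b t * (x t - a t)) \<le> B * norm (x t - a t)"
        using b by (auto simp: norm_mult intro: mult_right_mono)
      show "((\<lambda>t. B * norm (x t - a t)) \<longlongrightarrow> 0) F" using tendsto_norm_zero[OF assms(1)] by (rule tendsto_mult_right_zero)
    qed
  qed
  moreover have "(x t - a t) * (y t - b t) + (a t * (y t - b t) + b t * (x t - a t)) = x t * y t - l" for t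
    using l[of t] by (simp add: algebra_simps)
  ultimately show ?thesis by (simp add: LIM_zero_iff)
qed

text \<open>The flux of the outgoing wave, constant in x and read off at infinity. Each of its four
  terms, taken with its sign, tends to i k. Adding a decaying solution to \<open>F\<close> does not
  change it.\<close>

lemma wronskian_dag_jost_plus:
  assumes k: "k > 0" and F: "jost_plus_i q k F"
  shows "wronskian (\<lambda>x. dag (F x)) (\<lambda>x. dag (hl_deriv F x)) F (hl_deriv F) 0 = 4 * \<i> * of_real k"
proof -
  note as = jost_plus_asymptotics[OF F]
  let ?e = "\<lambda>x. exp (\<i> * complex_of_real (k * x))" and ?D = "hl_deriv F"
  have cauchy_sol: "cauchy_sol q (of_real (k\<^sup>2)) F ?D" using F by (auto simp: jost_plus_i_def intro: herm_solution_sol)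
  have b1: "cmod (?e x) \<le> 1" "cmod (\<i> * of_real k * ?e x) \<le> k" "cmod (cnj (?e x)) \<le> 1" "cmod (cnj (\<i> * of_real k * ?e x)) \<le> k" for x
    using k by (simp_all add: norm_mult)
  have ee: "cnj (?e x) * ?e x = 1" for x
    by (simp add: complex_norm_square[symmetric] mult.commute flip: exp_cnj)
  have cas: "((\<lambda>x. cnj (F x $ i) - cnj (?e x)) \<longlongrightarrow> 0) at_top"
    "((\<lambda>x. cnj (?D x $ i) - cnj (\<i> * of_real k * ?e x)) \<longlongrightarrow> 0) at_top" for i
    using tendsto_cnj[OF as(1)[of i]] tendsto_cnj[OF as(2)[of i]] by simp_all
  have 1: "((\<lambda>x. cnj (F x $ i) * ?D x $ j) \<longlongrightarrow> \<i> * of_real k) at_top" for i j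
    by (rule tendsto_mult_asymptotic[OF cas(1) as(2) b1(3) b1(2)]) (use ee in \<open>simp add: algebra_simps\<close>)
  have 2: "((\<lambda>x. cnj (?D x $ i) * F x $ j) \<longlongrightarrow> - (\<i> * of_real k)) at_top" for i j
    by (rule tendsto_mult_asymptotic[OF cas(2) as(1) b1(4) b1(1)]) (use ee in \<open>simp add: algebra_simps\<close>)
  let ?W = "wronskian (\<lambda>x. dag (F x)) (\<lambda>x. dag (?D x)) F ?D"
  have "((\<lambda>x. cnj (F x $ 2) * ?D x $ 1 + cnj (F x $ 1) * ?D x $ 2 - cnj (?D x $ 2) * F x $ 1 - cnj (?D x $ 1) * F x $ 2)
     \<longlongrightarrow> \<i> * of_real k + \<i> * of_real k - - (\<i> * of_real k) - - (\<i> * of_real k)) at_top"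
    by (intro tendsto_add tendsto_diff 1 2)
  then have "(?W \<longlongrightarrow> 4 * \<i> * of_real k) at_top"
    by (simp add: wronskian_def[abs_def] mult.assoc)
  moreover have "(?W \<longlongrightarrow> ?W 0) at_top"
  proof (rule tendsto_eventually)
    have sd: "cauchy_sol q (of_real (k\<^sup>2)) (\<lambda>x. dag (F x)) (\<lambda>x. dag (?D x))"
      using cauchy_sol_dag[OF cauchy_sol] unfolding complex_cnj_complex_of_real .
    show "\<forall>\<^sub>F x in at_top. ?W x = ?W 0"
      using eventually_ge_at_top[of 0] by eventually_elim (rule wronskian_const[OF sd cauchy_sol])
  qed
  ultimately show ?thesis by (rule tendsto_unique[OF trivial_limit_at_top_linorder, rotated])
qed

lemma o_exp_tendsto:
  fixes f :: "real \<Rightarrow> complex^2"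
  assumes "(\<lambda>x. norm (f x - (c * exp (- (k * x))) *\<^sub>R v)) \<in> o[at_top](\<lambda>x. exp (- (k * x)))"
  shows "((\<lambda>x. exp (k * x) *\<^sub>R (f x $ i)) \<longlongrightarrow> c *\<^sub>R (v $ i)) at_top"
proof -
  have l: "((\<lambda>x. norm (f x - (c * exp (- (k * x))) *\<^sub>R v) / exp (- (k * x))) \<longlongrightarrow> 0) at_top"
    using assms by (rule smalloD_tendsto)
  have "((\<lambda>x. exp (k * x) *\<^sub>R (f x $ i) - c *\<^sub>R (v $ i)) \<longlongrightarrow> 0) at_top"
  proof (rule Lim_null_comparison[OF always_eventually l], rule allI)
    fix x
    have "exp (k * x) *\<^sub>R (f x $ i) - c *\<^sub>R (v $ i) = exp (k * x) *\<^sub>R ((f x - (c * exp (- (k * x))) *\<^sub>R v) $ i)"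
      by (simp add: algebra_simps exp_minus)
    also have "norm \<dots> \<le> exp (k * x) * norm (f x - (c * exp (- (k * x))) *\<^sub>R v)"
      unfolding norm_scaleR abs_exp_cancel
      by (intro mult_left_mono Finite_Cartesian_Product.norm_nth_le) simp
    finally show "norm (exp (k * x) *\<^sub>R (f x $ i) - c *\<^sub>R (v $ i)) \<le> norm (f x - (c * exp (- (k * x))) *\<^sub>R v) / exp (- (k * x))"
      by (simp add: exp_minus field_simps)
  qed
  then show ?thesis by (simp add: LIM_zero_iff)
qed

lemma exp_scaled_tendsto_0:
  assumes k: "k > 0" and f: "((\<lambda>x. exp (k * x) *\<^sub>R (f x :: complex)) \<longlongrightarrow> l) at_top"
  shows "(f \<longlongrightarrow> 0) at_top"
proof -
  have "((\<lambda>x. exp (- (k * x))) \<longlongrightarrow> 0) at_top"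
    using k by (intro filterlim_compose[OF exp_at_bot]) (auto intro!: filterlim_uminus_at_bot[THEN iffD2] filterlim_tendsto_pos_mult_at_top[OF tendsto_const] filterlim_ident)
  from tendsto_scaleR[OF this f] show ?thesis by (simp add: exp_minus)
qed

lemma jost_minus_asymptotics:
  assumes k: "k > 0" and F: "jost_minus1 q k F"
  shows "((\<lambda>x. exp (k * x) *\<^sub>R (F x $ 1)) \<longlongrightarrow> 1) at_top" "decays F (hl_deriv F)"
    "cauchy_sol q (of_real (k\<^sup>2)) F (hl_deriv F)"
proof -
  have e1: "e_minus $ 1 = 1" by (simp add: e_minus_def vector_2)
  have F1: "((\<lambda>x. exp (k * x) *\<^sub>R (F x $ i)) \<longlongrightarrow> 1 *\<^sub>R (e_minus $ i)) at_top" for i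
    by (rule o_exp_tendsto) (use F in \<open>simp add: jost_minus1_def\<close>)
  have D1: "((\<lambda>x. exp (k * x) *\<^sub>R (hl_deriv F x $ i)) \<longlongrightarrow> (- k) *\<^sub>R (e_minus $ i)) at_top" for i
    by (rule o_exp_tendsto) (use F in \<open>simp add: jost_minus1_def\<close>)
  show "((\<lambda>x. exp (k * x) *\<^sub>R (F x $ 1)) \<longlongrightarrow> 1) at_top" using F1[of 1] by (simp add: e1)
  have "((\<lambda>x. data_norm (F x) (hl_deriv F x)) \<longlongrightarrow> 0 + 0 + 0 + 0) at_top"
    unfolding data_norm_def
    by (intro tendsto_add tendsto_norm_zero exp_scaled_tendsto_0[OF k F1] exp_scaled_tendsto_0[OF k D1])
  then show "decays F (hl_deriv F)" by (simp add: decays_def)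
  show "cauchy_sol q (of_real (k\<^sup>2)) F (hl_deriv F)" using F by (auto simp: jost_minus1_def intro: herm_solution_sol)
qed

lemma exp_decay_square_integrable:
  fixes f :: "real \<Rightarrow> complex"
  assumes k: "k > 0" and f: "continuous_on {0..} f" and B: "\<And>x. x \<ge> 0 \<Longrightarrow> cmod (f x) \<le> B * exp (- (k * x))"
  shows "(\<lambda>x. (cmod (f x))\<^sup>2) absolutely_integrable_on {0..}" "f absolutely_integrable_on {0..}"
proof -
  have m: "f \<in> borel_measurable (lebesgue_on {0..})"
    by (rule continuous_imp_measurable_on_sets_lebesgue[OF f]) auto
  have g: "(\<lambda>x. B * exp (- k * x)) integrable_on {0..}"
    using integrable_on_exp_minus_to_infinity[OF k, of 0] by (rule integrable_on_mult_right)
  show "f absolutely_integrable_on {0..}"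
    by (rule measurable_bounded_by_integrable_imp_absolutely_integrable[OF m _ g]) (use B in auto)
  have "(\<lambda>x. B\<^sup>2 * exp (- (2 * k) * x)) integrable_on {0..}"
    using integrable_on_exp_minus_to_infinity[of "2 * k" 0] k by (intro integrable_on_mult_right) auto
  then show "(\<lambda>x. (cmod (f x))\<^sup>2) absolutely_integrable_on {0..}"
  proof (rule measurable_bounded_by_integrable_imp_absolutely_integrable[rotated 2])
    fix x :: real assume "x \<in> {0..}"
    then have "(cmod (f x))\<^sup>2 \<le> (B * exp (- (k * x)))\<^sup>2" using B[of x] by (intro power_mono) auto
    also have "\<dots> = B\<^sup>2 * exp (- (2 * k) * x)" by (simp add: power_mult_distrib flip: exp_double)
    finally show "norm ((cmod (f x))\<^sup>2) \<le> B\<^sup>2 * exp (- (2 * k) * x)" by simp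
  qed (use m in auto)
qed

lemma absolutely_integrable_on_open_halfline:
  fixes f :: "real \<Rightarrow> 'a::euclidean_space"
  shows "f absolutely_integrable_on {0<..} \<longleftrightarrow> f absolutely_integrable_on {0..}"
  by (rule absolutely_integrable_spike_set_eq) (auto intro: negligible_subset[of "{0}"])

text \<open>Vectors of this form are those with \<open>dag v = - v\<close>. On them the system
  reduces to the antilinear scalar equation, and the scalar asymptotics become those of
  F_{-1}.\<close>

definition jost_pair :: "(real \<Rightarrow> complex) \<Rightarrow> real \<Rightarrow> complex^2" where
  "jost_pair e x = vector [cnj (e x), - e x]"

lemma jost_pair_nth [simp]: "jost_pair e x $ 1 = cnj (e x)" "jost_pair e x $ 2 = - e x"
  by (simp_all add: jost_pair_def vector_2)

lemma scalar_jost_sol: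
  assumes "scalar_jost q k e"
  shows "cauchy_sol q (of_real (k\<^sup>2)) (jost_pair e) (jost_pair (hl_deriv e))"
  unfolding cauchy_sol_def
proof (intro conjI allI impI)
  have ac: "loc_abs_cont1 e" using assms by (simp add: scalar_jost_def)
  show "((\<lambda>x. jost_pair e x $ i) has_vector_derivative jost_pair (hl_deriv e) x $ i) (at x within {0..})"
    if "x \<ge> 0" for x i
    using exhaust_2[of i] loc_abs_cont1D(1)[OF ac that]
    by (auto intro!: has_vector_derivative_cnj derivative_eq_intros)
  show "loc_abs_cont (\<lambda>x. jost_pair (hl_deriv e) x $ i)" for i
    using exhaust_2[of i] loc_abs_cont_diff[OF loc_abs_cont_const[of 0] loc_abs_cont1D(2)[OF ac]] loc_abs_cont_cnj[OF loc_abs_cont1D(2)[OF ac]]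
    by auto
  have "AE x in lebesgue. x > 0 \<longrightarrow> (\<exists>e2. (hl_deriv e has_vector_derivative e2) (at x) \<and>
              - e2 + q x * e x = - of_real (k\<^sup>2) * cnj (e x))"
    using assms by (simp add: scalar_jost_def)
  then show "AE x in lebesgue. x > 0 \<longrightarrow>
        ((\<lambda>x. jost_pair (hl_deriv e) x $ 1) has_vector_derivative cnj (q x) * jost_pair e x $ 1 - of_real (k\<^sup>2) * jost_pair e x $ 2) (at x) \<and>
        ((\<lambda>x. jost_pair (hl_deriv e) x $ 2) has_vector_derivative q x * jost_pair e x $ 2 - of_real (k\<^sup>2) * jost_pair e x $ 1) (at x)"
  proof eventually_elim
    case (elim x)
    show ?case
    proof
      assume "x > 0"
      then obtain e2 where e2: "(hl_deriv e has_vector_derivative e2) (at x)" "- e2 + q x * e x = - of_real (k\<^sup>2) * cnj (e x)"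
        using elim by blast
      have e2': "e2 = q x * e x + of_real (k\<^sup>2) * cnj (e x)" using e2(2) by (simp add: algebra_simps)
      show "((\<lambda>x. jost_pair (hl_deriv e) x $ 1) has_vector_derivative cnj (q x) * jost_pair e x $ 1 - of_real (k\<^sup>2) * jost_pair e x $ 2) (at x) \<and>
        ((\<lambda>x. jost_pair (hl_deriv e) x $ 2) has_vector_derivative q x * jost_pair e x $ 2 - of_real (k\<^sup>2) * jost_pair e x $ 1) (at x)"
        using has_vector_derivative_cnj[OF e2(1)] has_vector_derivative_minus[OF e2(1)] by (simp add: e2')
    qed
  qed
qed

lemma scalar_jost_asymptotics:
  assumes k: "k > 0" and e: "scalar_jost q k e"
  shows "((\<lambda>x. exp (k * x) *\<^sub>R e x) \<longlongrightarrow> 1) at_top" "continuous_on {0..} e"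
    "\<exists>B. \<forall>x\<ge>0. cmod (e x) \<le> B * exp (- (k * x))"
proof -
  have l: "((\<lambda>x. norm (e x - of_real (exp (- (k * x)))) / exp (- (k * x))) \<longlongrightarrow> 0) at_top"
    using e unfolding scalar_jost_def by (auto dest: smalloD_tendsto)
  have "((\<lambda>x. exp (k * x) *\<^sub>R e x - 1) \<longlongrightarrow> 0) at_top"
  proof (rule Lim_null_comparison[OF always_eventually l], rule allI)
    fix x
    have "exp (k * x) *\<^sub>R e x - 1 = exp (k * x) *\<^sub>R (e x - of_real (exp (- (k * x))))"
      by (simp add: algebra_simps exp_minus scaleR_conv_of_real)
    then show "norm (exp (k * x) *\<^sub>R e x - 1) \<le> norm (e x - of_real (exp (- (k * x)))) / exp (- (k * x))"
      by (simp add: exp_minus field_simps)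
  qed
  then show lim: "((\<lambda>x. exp (k * x) *\<^sub>R e x) \<longlongrightarrow> 1) at_top" by (simp add: LIM_zero_iff)
  show c: "continuous_on {0..} e"
    using e by (auto simp: scalar_jost_def loc_abs_cont1_def intro: loc_abs_cont_continuous)
  obtain Y where Y: "\<And>x. x \<ge> Y \<Longrightarrow> norm (exp (k * x) *\<^sub>R e x) < 2"
    using order_tendstoD(2)[OF tendsto_norm[OF lim], of 2] by (auto simp: eventually_at_top_linorder)
  have "\<exists>B. \<forall>x\<ge>0. norm (exp (k * x) *\<^sub>R e x) \<le> B"
    by (rule bounded_halfline[where Y = Y and b = 2]) (use Y in \<open>auto intro!: continuous_intros c less_imp_le\<close>)
  then show "\<exists>B. \<forall>x\<ge>0. cmod (e x) \<le> B * exp (- (k * x))"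
    by (auto simp: exp_minus field_simps)
qed

context potential
begin

text \<open>The scalar Jost solution is normalised by its value only. Decay of the derivative comes
  from square integrability together with the equation.\<close>

lemma scalar_jost_decays:
  assumes k: "k > 0" and e: "scalar_jost q k e"
  shows "decays (jost_pair e) (jost_pair (hl_deriv e))"
proof (rule square_integrable_decays[OF scalar_jost_sol[OF e]])
  obtain B where B: "\<And>x. x \<ge> 0 \<Longrightarrow> cmod (e x) \<le> B * exp (- (k * x))"
    using scalar_jost_asymptotics(3)[OF k e] by blast
  have "(\<lambda>x. (cmod (e x))\<^sup>2) integrable_on {0..}"
    using exp_decay_square_integrable(1)[OF k scalar_jost_asymptotics(2)[OF k e] B] absolutely_integrable_on_def by blast
  then have "(\<lambda>x. 2 * (cmod (e x))\<^sup>2) integrable_on {0..}" by (rule integrable_on_mult_right)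
  moreover have "(norm (jost_pair e x))\<^sup>2 = 2 * (cmod (e x))\<^sup>2" for x
    by (simp add: norm_vec_def L2_set_def sum_2)
  ultimately show "(\<lambda>x. (norm (jost_pair e x))\<^sup>2) integrable_on {0..}" by simp
qed

text \<open>Both sides are decaying solutions at k^2, hence proportional; comparing the leading
  coefficients of the first components gives the factor 1.\<close>

lemma jost_minus_eq_scalar:
  assumes k: "k > 0" and F: "jost_minus1 q k F" and e: "scalar_jost q k e" and x: "x \<ge> 0"
  shows "F x = jost_pair e x" "hl_deriv F x = jost_pair (hl_deriv e) x"
proof -
  note lim = scalar_jost_asymptotics(1)[OF k e]
  obtain Y where Y: "\<And>x. x \<ge> Y \<Longrightarrow> norm (exp (k * x) *\<^sub>R e x) > 0"
    using order_tendstoD(1)[OF tendsto_norm[OF lim], of 0] by (auto simp: eventually_at_top_linorder)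
  have "e (max 0 Y) \<noteq> 0" using Y[of "max 0 Y"] by auto
  then have nz: "data_norm (jost_pair e (max 0 Y)) (jost_pair (hl_deriv e) (max 0 Y)) \<noteq> 0"
    by (simp add: data_norm_eq_0 vec_eq_iff forall_2)
  have m: "0 \<le> max 0 Y" by simp
  obtain c where c: "\<And>x. x \<ge> 0 \<Longrightarrow> F x = c *s jost_pair e x" "\<And>x. x \<ge> 0 \<Longrightarrow> hl_deriv F x = c *s jost_pair (hl_deriv e) x"
    using decaying_multiple[OF k jost_minus_asymptotics(3,2)[OF k F] scalar_jost_sol[OF e] scalar_jost_decays[OF k e] m nz] by blast
  have "((\<lambda>x. c * cnj (exp (k * x) *\<^sub>R e x)) \<longlongrightarrow> c * cnj 1) at_top"
    by (intro tendsto_mult tendsto_const tendsto_cnj lim)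
  moreover have "\<forall>\<^sub>F x in at_top. exp (k * x) *\<^sub>R (F x $ 1) = c * cnj (exp (k * x) *\<^sub>R e x)"
    using eventually_ge_at_top[of 0] by eventually_elim (simp add: c scaleR_conv_of_real exp_of_real)
  ultimately have "((\<lambda>x. exp (k * x) *\<^sub>R (F x $ 1)) \<longlongrightarrow> c * cnj 1) at_top"
    by (subst tendsto_cong)
  then have "((\<lambda>x. exp (k * x) *\<^sub>R (F x $ 1)) \<longlongrightarrow> c) at_top" by simp
  then have "c = 1" using jost_minus_asymptotics(1)[OF k F] by (rule tendsto_unique[OF trivial_limit_at_top_linorder])
  then show "F x = jost_pair e x" "hl_deriv F x = jost_pair (hl_deriv e) x"
    using c[OF x] by (simp_all add: vec_eq_iff)
qed

end

section \<open>Boundary data\<close>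

text \<open>The boundary functionals as functions of two numbers, so that they apply to Cauchy data
  whatever the derivative is called.\<close>

definition bd_val :: "complex option \<Rightarrow> complex \<Rightarrow> complex \<Rightarrow> complex" where
  "bd_val \<alpha> v w = (case \<alpha> of
       None \<Rightarrow> w
     | Some a \<Rightarrow> (cnj a * w - v) / of_real (sqrt (1 + (cmod a)\<^sup>2)))"

definition bd_val_perp :: "complex option \<Rightarrow> complex \<Rightarrow> complex \<Rightarrow> complex" where
  "bd_val_perp \<alpha> v w = (case \<alpha> of
       None \<Rightarrow> v
     | Some a \<Rightarrow> (w + a * v) / of_real (sqrt (1 + (cmod a)\<^sup>2)))"

lemma bd_ell_eq: "bd_ell \<alpha> f = bd_val \<alpha> (f 0) (hl_deriv f 0)"
  "bd_ell_perp \<alpha> f = bd_val_perp \<alpha> (f 0) (hl_deriv f 0)"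
  by (auto simp: bd_ell_def bd_ell_perp_def bd_val_def bd_val_perp_def split: option.split)

lemma bd_val_lin:
  "bd_val \<alpha> (a * v + b * v') (a * w + b * w') = a * bd_val \<alpha> v w + b * bd_val \<alpha> v' w'"
  "bd_val_perp \<alpha> (a * v + b * v') (a * w + b * w') = a * bd_val_perp \<alpha> v w + b * bd_val_perp \<alpha> v' w'"
  by (auto simp: bd_val_def bd_val_perp_def algebra_simps add_divide_distrib diff_divide_distrib split: option.split)

lemma bd_val_cnj:
  "bd_val (map_option cnj \<alpha>) (cnj v) (cnj w) = cnj (bd_val \<alpha> v w)"
  "bd_val_perp (map_option cnj \<alpha>) (cnj v) (cnj w) = cnj (bd_val_perp \<alpha> v w)"
  by (auto simp: bd_val_def bd_val_perp_def split: option.split)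

lemma sqrt_one_plus_norm_sq:
  fixes a :: complex
  defines "s \<equiv> complex_of_real (sqrt (1 + (cmod a)\<^sup>2))"
  shows "s * s = 1 + a * cnj a" "s \<noteq> 0" "cmod s \<ge> 1" "cmod s \<ge> cmod a"
proof -
  have r: "sqrt (1 + (cmod a)\<^sup>2) * sqrt (1 + (cmod a)\<^sup>2) = 1 + (cmod a)\<^sup>2" by simp
  show "s * s = 1 + a * cnj a"
    unfolding s_def of_real_mult[symmetric] r by (simp only: of_real_add of_real_1 complex_norm_square)
  have "sqrt (1 + (cmod a)\<^sup>2) \<ge> sqrt 1" by (intro real_sqrt_le_mono) simp
  then have "sqrt (1 + (cmod a)\<^sup>2) \<ge> 1" by simp
  then show "cmod s \<ge> 1" by (simp add: s_def)
  then show "s \<noteq> 0" by auto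
  have "sqrt (1 + (cmod a)\<^sup>2) \<ge> sqrt ((cmod a)\<^sup>2)" by (intro real_sqrt_le_mono) simp
  then show "cmod s \<ge> cmod a" by (simp add: s_def)
qed

text \<open>The change from (value, derivative) to the pair of boundary functionals has determinant
  1, thanks to the normalising square root, and therefore preserves the bilinear Wronskian.\<close>

lemma bd_val_wronskian:
  "v * w' - w * v' = bd_val_perp \<alpha> v w * bd_val \<alpha> v' w' - bd_val \<alpha> v w * bd_val_perp \<alpha> v' w'"
proof (cases \<alpha>)
  case (Some a)
  define s where "s = complex_of_real (sqrt (1 + (cmod a)\<^sup>2))"
  note s = sqrt_one_plus_norm_sq[of a, folded s_def]
  have "bd_val_perp \<alpha> v w * bd_val \<alpha> v' w' - bd_val \<alpha> v w * bd_val_perp \<alpha> v' w'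
     = ((w + a * v) * (cnj a * w' - v') - (cnj a * w - v) * (w' + a * v')) / (s * s)"
  proof -
    have "bd_val_perp \<alpha> v w * bd_val \<alpha> v' w' - bd_val \<alpha> v w * bd_val_perp \<alpha> v' w'
       = ((w + a * v) / s) * ((cnj a * w' - v') / s) - ((cnj a * w - v) / s) * ((w' + a * v') / s)"
      using Some by (simp only: bd_val_def bd_val_perp_def s_def option.case)
    then show ?thesis by (simp only: times_divide_times_eq) (simp only: diff_divide_distrib)
  qed
  also have "(w + a * v) * (cnj a * w' - v') - (cnj a * w - v) * (w' + a * v') = (v * w' - w * v') * (s * s)"
    unfolding s(1) by (simp add: algebra_simps)
  finally show ?thesis using s(2) by simp
qed (simp add: bd_val_def bd_val_perp_def)

text \<open>The change of boundary coordinates is unitary. The entries of its inverse have modulus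
  at most 1, and adding the two rows gives the factor 2.\<close>

lemma bd_val_bound: "cmod v + cmod w \<le> 2 * (cmod (bd_val \<alpha> v w) + cmod (bd_val_perp \<alpha> v w))"
proof (cases \<alpha>)
  case (Some a)
  define s where "s = complex_of_real (sqrt (1 + (cmod a)\<^sup>2))"
  note s = sqrt_one_plus_norm_sq[of a, folded s_def]
  define l p where "l = bd_val \<alpha> v w" and "p = bd_val_perp \<alpha> v w"
  have lp: "s * l = cnj a * w - v" "s * p = w + a * v"
    using Some s(2) by (simp_all add: l_def p_def bd_val_def bd_val_perp_def s_def[symmetric])
  have "s * (cnj a * p - l) = cnj a * (s * p) - s * l" by (simp add: algebra_simps)
  also have "\<dots> = (s * s) * v" unfolding lp s(1) by (simp add: algebra_simps)
  finally have "s * (s * v) = s * (cnj a * p - l)" by (simp only: mult.assoc)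
  then have v: "s * v = cnj a * p - l" using s(2) by (metis mult_left_cancel)
  have "s * (p + a * l) = s * p + a * (s * l)" by (simp add: algebra_simps)
  also have "\<dots> = (s * s) * w" unfolding lp s(1) by (simp add: algebra_simps)
  finally have "s * (s * w) = s * (p + a * l)" by (simp only: mult.assoc)
  then have w: "s * w = p + a * l" using s(2) by (metis mult_left_cancel)
  have ls: "x * cmod y \<le> cmod s * cmod y" if "x = cmod a \<or> x = 1" for x y using that s by (auto intro: mult_right_mono)
  have "cmod s * cmod v \<le> cmod a * cmod p + 1 * cmod l"
    unfolding norm_mult[symmetric] v using norm_triangle_ineq4[of "cnj a * p" l] by (simp add: norm_mult)
  also have "\<dots> \<le> cmod s * cmod p + cmod s * cmod l" by (intro add_mono ls) auto
  finally have "cmod s * cmod v \<le> cmod s * (cmod l + cmod p)" by (simp add: algebra_simps)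
  then have 1: "cmod v \<le> cmod l + cmod p" using s(2) by (simp add: mult_le_cancel_left)
  have "cmod s * cmod w \<le> 1 * cmod p + cmod a * cmod l"
    unfolding norm_mult[symmetric] w using norm_triangle_ineq[of p "a * l"] by (simp add: norm_mult)
  also have "\<dots> \<le> cmod s * cmod p + cmod s * cmod l" by (intro add_mono ls) auto
  finally have "cmod s * cmod w \<le> cmod s * (cmod l + cmod p)" by (simp add: algebra_simps)
  then have 2: "cmod w \<le> cmod l + cmod p" using s(2) by (simp add: mult_le_cancel_left)
  show ?thesis using 1 2 by (simp add: l_def p_def)
qed (simp add: bd_val_def bd_val_perp_def)

definition bd_data :: "complex option \<Rightarrow> complex^2 \<Rightarrow> complex^2 \<Rightarrow> complex^2" where
  "bd_data \<alpha> v w = vector [bd_val (map_option cnj \<alpha>) (v $ 1) (w $ 1), bd_val \<alpha> (v $ 2) (w $ 2)]"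

definition bd_data_perp :: "complex option \<Rightarrow> complex^2 \<Rightarrow> complex^2 \<Rightarrow> complex^2" where
  "bd_data_perp \<alpha> v w = vector [bd_val_perp (map_option cnj \<alpha>) (v $ 1) (w $ 1), bd_val_perp \<alpha> (v $ 2) (w $ 2)]"

lemma bd_data_nth: "bd_data \<alpha> v w $ 1 = bd_val (map_option cnj \<alpha>) (v $ 1) (w $ 1)" "bd_data \<alpha> v w $ 2 = bd_val \<alpha> (v $ 2) (w $ 2)"
  by (simp_all add: bd_data_def vector_2)

lemma bd_data_perp_nth: "bd_data_perp \<alpha> v w $ 1 = bd_val_perp (map_option cnj \<alpha>) (v $ 1) (w $ 1)" "bd_data_perp \<alpha> v w $ 2 = bd_val_perp \<alpha> (v $ 2) (w $ 2)"
  by (simp_all add: bd_data_perp_def vector_2)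

lemma bd_data_lin: "bd_data \<alpha> (a *s v + b *s v') (a *s w + b *s w') = a *s bd_data \<alpha> v w + b *s bd_data \<alpha> v' w'"
  by (simp add: vec_eq_iff forall_2 bd_data_nth bd_val_lin)

lemma bd_data_perp_lin: "bd_data_perp \<alpha> (a *s v + b *s v') (a *s w + b *s w') = a *s bd_data_perp \<alpha> v w + b *s bd_data_perp \<alpha> v' w'"
  by (simp add: vec_eq_iff forall_2 bd_data_perp_nth bd_val_lin)

text \<open>The conjugated parameter in the first component is what makes this work:
  \<open>dag\<close> exchanges the components and conjugates them.\<close>

lemma bd_data_dag: "bd_data \<alpha> (dag v) (dag w) = dag (bd_data \<alpha> v w)"
  using bd_val_cnj(1)[of "map_option cnj \<alpha>" "v $ 1" "w $ 1"] bd_val_cnj(1)[of \<alpha> "v $ 2" "w $ 2"]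
  by (simp add: vec_eq_iff forall_2 bd_data_nth option.map_comp comp_def option.map_ident)

lemma bd_data_perp_dag: "bd_data_perp \<alpha> (dag v) (dag w) = dag (bd_data_perp \<alpha> v w)"
  using bd_val_cnj(2)[of "map_option cnj \<alpha>" "v $ 1" "w $ 1"] bd_val_cnj(2)[of \<alpha> "v $ 2" "w $ 2"]
  by (simp add: vec_eq_iff forall_2 bd_data_perp_nth option.map_comp comp_def option.map_ident)

text \<open>Since \<alpha> occurs on the right only, the same Wronskian can be evaluated in any
  boundary coordinates. It vanishes if both arguments satisfy the boundary condition.\<close>

lemma wronskian_boundary:
  "wronskian F D G E 0 = bd_data_perp \<alpha> (F 0) (D 0) $ 1 * bd_data \<alpha> (G 0) (E 0) $ 1 + bd_data_perp \<alpha> (F 0) (D 0) $ 2 * bd_data \<alpha> (G 0) (E 0) $ 2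
     - bd_data \<alpha> (F 0) (D 0) $ 1 * bd_data_perp \<alpha> (G 0) (E 0) $ 1 - bd_data \<alpha> (F 0) (D 0) $ 2 * bd_data_perp \<alpha> (G 0) (E 0) $ 2"
proof -
  have "wronskian F D G E 0 = (F 0 $ 1 * E 0 $ 1 - D 0 $ 1 * G 0 $ 1) + (F 0 $ 2 * E 0 $ 2 - D 0 $ 2 * G 0 $ 2)"
    by (simp add: wronskian_def)
  then show ?thesis
    unfolding bd_val_wronskian[of "F 0 $ 1" "E 0 $ 1" "D 0 $ 1" "G 0 $ 1" "map_option cnj \<alpha>"]
      bd_val_wronskian[of "F 0 $ 2" "E 0 $ 2" "D 0 $ 2" "G 0 $ 2" \<alpha>]
    by (simp add: bd_data_nth bd_data_perp_nth)
qed

lemma data_norm_boundary: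
  "data_norm v w \<le> 2 * (cmod (bd_data \<alpha> v w $ 1) + cmod (bd_data \<alpha> v w $ 2) + cmod (bd_data_perp \<alpha> v w $ 1) + cmod (bd_data_perp \<alpha> v w $ 2))"
  using bd_val_bound[of "v $ 1" "w $ 1" "map_option cnj \<alpha>"] bd_val_bound[of "v $ 2" "w $ 2" \<alpha>]
  by (simp add: data_norm_def bd_data_nth bd_data_perp_nth)

lemma bd_L_sol:
  assumes "cauchy_sol q z F D"
  shows "bd_L \<alpha> F = bd_data \<alpha> (F 0) (D 0)" "bd_L_perp \<alpha> F = bd_data_perp \<alpha> (F 0) (D 0)"
proof -
  have "hl_deriv (\<lambda>x. F x $ i) 0 = D 0 $ i" for i
    by (rule hl_deriv_eqI[OF order_refl cauchy_sol_der[OF assms order_refl]])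
  then show "bd_L \<alpha> F = bd_data \<alpha> (F 0) (D 0)" "bd_L_perp \<alpha> F = bd_data_perp \<alpha> (F 0) (D 0)"
    by (simp_all add: bd_L_def bd_L_perp_def bd_data_def bd_data_perp_def bd_ell_eq)
qed

lemma jost_pair_boundary:
  "bd_data \<alpha> (jost_pair e 0) (jost_pair (hl_deriv e) 0) = vector [cnj (bd_ell \<alpha> e), - bd_ell \<alpha> e]"
  "bd_data_perp \<alpha> (jost_pair e 0) (jost_pair (hl_deriv e) 0) = vector [cnj (bd_ell_perp \<alpha> e), - bd_ell_perp \<alpha> e]"
  using bd_val_lin[of \<alpha> "-1" "e 0" 0 0 "hl_deriv e 0" 0]
  by (simp_all add: vec_eq_iff forall_2 bd_data_nth bd_data_perp_nth bd_val_cnj bd_ell_eq vector_2)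

section \<open>Eigenvalues and the determinant of the Jost boundary data\<close>

lemma L2_halfline_integrable:
  fixes f :: "real \<Rightarrow> 'a::real_normed_vector"
  assumes "L2_halfline f"
  shows "(\<lambda>x. (norm (f x))\<^sup>2) integrable_on {0..}"
  using assms absolutely_integrable_on_open_halfline[of "\<lambda>x. (norm (f x))\<^sup>2"]
  by (auto simp: L2_halfline_def dest: set_lebesgue_integral_eq_integral(1))

lemma L2_halfline_exp_decay:
  assumes k: "k > 0" and f: "continuous_on {0..} f" and B: "\<And>x. x \<ge> 0 \<Longrightarrow> cmod (f x) \<le> B * exp (- (k * x))"
  shows "L2_halfline f"
  unfolding L2_halfline_def
proof
  have "f absolutely_integrable_on {0<..}"
    using exp_decay_square_integrable(2)[OF assms] absolutely_integrable_on_open_halfline[of f] by blast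
  then show "set_borel_measurable lebesgue {0<..} f"
    unfolding set_integrable_def set_borel_measurable_def by (rule borel_measurable_integrable)
  show "set_integrable lebesgue {0<..} (\<lambda>x. (cmod (f x))\<^sup>2)"
    using exp_decay_square_integrable(1)[OF assms] absolutely_integrable_on_open_halfline[of "\<lambda>x. (cmod (f x))\<^sup>2"] by blast
qed

lemma wronskian_antisym: "wronskian G E F D x = - wronskian F D G E x"
  by (simp add: wronskian_def algebra_simps)

lemma parallel_complex2:
  fixes p m :: "complex^2"
  assumes "p $ 1 * m $ 2 = m $ 1 * p $ 2" "m \<noteq> 0"
  shows "\<exists>c. p = c *s m"
proof (cases "m $ 1 = 0")
  case True
  then have "m $ 2 \<noteq> 0" using assms(2) by (simp add: vec_eq_iff forall_2)
  then show ?thesis using assms(1) True by (intro exI[of _ "p $ 2 / m $ 2"]) (simp add: vec_eq_iff forall_2)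
next
  case False
  then show ?thesis using assms(1) by (intro exI[of _ "p $ 1 / m $ 1"]) (simp add: vec_eq_iff forall_2 field_simps)
qed

lemma det_cols2: "det (cols2 p m) = p $ 1 * m $ 2 - m $ 1 * p $ 2"
  by (simp add: det_2 cols2_def)

context potential
begin

lemma cauchy_sol_zero_at_0:
  assumes F: "cauchy_sol q z F D" and "data_norm (F 0) (D 0) = 0" and "x \<ge> 0"
  shows "data_norm (F x) (D x) = 0"
proof -
  obtain C where C: "\<And>z' F D s t. cmod z' \<le> cmod z \<Longrightarrow> cauchy_sol q z' F D \<Longrightarrow> s \<in> {0..x} \<Longrightarrow> t \<in> {0..x} \<Longrightarrow> data_norm (F s) (D s) \<le> C * data_norm (F t) (D t)"
    using cauchy_sol_gronwall[of "cmod z" x] by (metis (no_types, lifting))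
  have "data_norm (F x) (D x) \<le> C * data_norm (F 0) (D 0)" by (rule C[OF order_refl F]) (use assms in auto)
  then show ?thesis using assms(2) data_norm_nonneg[of "F x" "D x"] by simp
qed

text \<open>The operator acts on the two components separately, so the derivative is assembled from
  scalar ones. The data at 0 are nonzero because a solution with zero data vanishes
  identically.\<close>

lemma eigenvalue_sol:
  assumes "hermitisation_eigenvalue q \<alpha> z"
  obtains F D where "cauchy_sol q z F D" "decays F D" "bd_data_perp \<alpha> (F 0) (D 0) = 0" "data_norm (F 0) (D 0) \<noteq> 0"
proof -
  obtain F where F: "hermitisation q \<alpha> F (\<lambda>x. z *s F x)" and nz: "\<not> (AE x in lebesgue. x > 0 \<longrightarrow> F x = 0)"
    using assms by (auto simp: hermitisation_eigenvalue_def)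
  have op: "schroedinger_op q \<alpha> (\<lambda>x. F x $ 2) (\<lambda>x. z * F x $ 1)"
    "schroedinger_op (\<lambda>x. cnj (q x)) (map_option cnj \<alpha>) (\<lambda>x. F x $ 1) (\<lambda>x. z * F x $ 2)"
    using F by (simp_all add: hermitisation_def)
  have ac: "loc_abs_cont1 (\<lambda>x. F x $ i)" for i
    using op exhaust_2[of i] by (auto simp: schroedinger_op_def)
  define D :: "real \<Rightarrow> complex^2" where "D x = (\<chi> i. hl_deriv (\<lambda>x. F x $ i) x)" for x
  have cauchy_sol: "cauchy_sol q z F D"
    unfolding cauchy_sol_def
  proof (intro conjI allI impI)
    show "((\<lambda>x. F x $ i) has_vector_derivative D x $ i) (at x within {0..})" if "x \<ge> 0" for x i
      using loc_abs_cont1D(1)[OF ac that] by (simp add: D_def)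
    show "loc_abs_cont (\<lambda>x. D x $ i)" for i
      using loc_abs_cont1D(2)[OF ac] by (simp add: D_def)
    have "AE x in lebesgue. x > 0 \<longrightarrow> (\<exists>f2. (hl_deriv (\<lambda>x. F x $ 2) has_vector_derivative f2) (at x) \<and> - f2 + q x * F x $ 2 = z * F x $ 1)"
      "AE x in lebesgue. x > 0 \<longrightarrow> (\<exists>f2. (hl_deriv (\<lambda>x. F x $ 1) has_vector_derivative f2) (at x) \<and> - f2 + cnj (q x) * F x $ 1 = z * F x $ 2)"
      using op by (simp_all add: schroedinger_op_def)
    then show "AE x in lebesgue. x > 0 \<longrightarrow>
        ((\<lambda>x. D x $ 1) has_vector_derivative cnj (q x) * F x $ 1 - z * F x $ 2) (at x) \<and>
        ((\<lambda>x. D x $ 2) has_vector_derivative q x * F x $ 2 - z * F x $ 1) (at x)"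
    proof eventually_elim
      case (elim x)
      have *: "f2 = b - c" if "- f2 + b = c" for f2 b c :: complex using that by (simp add: algebra_simps)
      show ?case
      proof
        assume "x > 0"
        then obtain f1 f2 where "(hl_deriv (\<lambda>x. F x $ 2) has_vector_derivative f2) (at x)" "- f2 + q x * F x $ 2 = z * F x $ 1"
          "(hl_deriv (\<lambda>x. F x $ 1) has_vector_derivative f1) (at x)" "- f1 + cnj (q x) * F x $ 1 = z * F x $ 2"
          using elim by blast
        then show "((\<lambda>x. D x $ 1) has_vector_derivative cnj (q x) * F x $ 1 - z * F x $ 2) (at x) \<and>
          ((\<lambda>x. D x $ 2) has_vector_derivative q x * F x $ 2 - z * F x $ 1) (at x)"
          using *[of f1 "cnj (q x) * F x $ 1" "z * F x $ 2"] *[of f2 "q x * F x $ 2" "z * F x $ 1"] by (simp add: D_def)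
      qed
    qed
  qed
  have "(\<lambda>x. (norm (F x $ i))\<^sup>2) integrable_on {0..}" for i
    using op exhaust_2[of i] by (auto simp: schroedinger_op_def intro: L2_halfline_integrable)
  then have "(\<lambda>x. (norm (F x $ 1))\<^sup>2 + (norm (F x $ 2))\<^sup>2) integrable_on {0..}" by (intro integrable_add)
  then have "(\<lambda>x. (norm (F x))\<^sup>2) integrable_on {0..}"
    by (simp add: norm_vec_def L2_set_def sum_2)
  then have dec: "decays F D" by (rule square_integrable_decays[OF cauchy_sol])
  have "bd_data_perp \<alpha> (F 0) (D 0) = 0"
    using op by (simp add: schroedinger_op_def bd_ell_eq vec_eq_iff forall_2 bd_data_perp_nth D_def)
  moreover have "data_norm (F 0) (D 0) \<noteq> 0"
  proof
    assume "data_norm (F 0) (D 0) = 0"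
    then have "F x = 0" if "x > 0" for x using cauchy_sol_zero_at_0[OF cauchy_sol _ less_imp_le[OF that]] by (simp add: data_norm_eq_0)
    then show False using nz by simp
  qed
  ultimately show ?thesis using that cauchy_sol dec by blast
qed

lemma jost_minus_nonzero:
  assumes k: "k > 0" and Fm: "jost_minus1 q k Fm"
  shows "data_norm (Fm 0) (hl_deriv Fm 0) \<noteq> 0"
proof
  note F = jost_minus_asymptotics[OF k Fm]
  assume "data_norm (Fm 0) (hl_deriv Fm 0) = 0"
  then have "\<And>x. x \<ge> 0 \<Longrightarrow> Fm x = 0" using cauchy_sol_zero_at_0[OF F(3)] by (simp add: data_norm_eq_0)
  then have "\<forall>\<^sub>F x in at_top. exp (k * x) *\<^sub>R (Fm x $ 1) = 0"
    by (auto simp: eventually_at_top_linorder intro!: exI[of _ 0])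
  then have "((\<lambda>x. exp (k * x) *\<^sub>R (Fm x $ 1)) \<longlongrightarrow> 0) at_top" by (rule tendsto_eventually)
  then have "(0::complex) = 1" using F(1) by (rule tendsto_unique[OF trivial_limit_at_top_linorder])
  then show False by simp
qed

text \<open>F_{-1} itself serves as the eigenfunction: its exponential bound comes from the scalar
  Jost solution, and it is nonzero for all large x.\<close>

lemma jost_minus_eigenvalue:
  assumes k: "k > 0" and Fm: "jost_minus1 q k Fm" and e: "scalar_jost q k e"
    and bc: "bd_data_perp \<alpha> (Fm 0) (hl_deriv Fm 0) = 0"
  shows "hermitisation_eigenvalue q \<alpha> (of_real (k\<^sup>2))"
proof -
  note F = jost_minus_asymptotics[OF k Fm]
  have hs: "loc_abs_cont1 Fm" using Fm by (simp add: jost_minus1_def herm_solution_def)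
  obtain B where B: "\<And>x. x \<ge> 0 \<Longrightarrow> cmod (e x) \<le> B * exp (- (k * x))"
    using scalar_jost_asymptotics(3)[OF k e] by blast
  have FB: "cmod (Fm x $ i) \<le> B * exp (- (k * x))" if "x \<ge> 0" for x i
    using jost_minus_eq_scalar(1)[OF k Fm e that] B[OF that] exhaust_2[of i] by auto
  have L2: "L2_halfline (\<lambda>x. c * Fm x $ i)" for c i
  proof (rule L2_halfline_exp_decay[OF k, where B = "cmod c * B"])
    show "continuous_on {0..} (\<lambda>x. c * Fm x $ i)" by (intro continuous_intros cauchy_sol_cont[OF F(3)])
    show "cmod (c * Fm x $ i) \<le> cmod c * B * exp (- (k * x))" if "x \<ge> 0" for x
      using mult_left_mono[OF FB[OF that], of "cmod c" i] by (simp add: norm_mult)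
  qed
  \<comment> \<open>The derivative of a component and the component of the derivative agree only on
    the half-line, so derivatives are transferred on the open set where x > 0.\<close>
  have der: "(hl_deriv (\<lambda>x. Fm x $ i) has_vector_derivative d) (at x)"
    if "((\<lambda>x. hl_deriv Fm x $ i) has_vector_derivative d) (at x)" "x > 0" for i d x
  proof (rule has_vector_derivative_transform_within_open[OF that(1), of "{0<..}"])
    show "hl_deriv Fm y $ i = hl_deriv (\<lambda>x. Fm x $ i) y" if "y \<in> {0<..}" for y
      using loc_abs_cont1_nth(2)[OF hs, of y i] that by simp
  qed (use that in auto)
  have bc': "bd_ell_perp \<alpha> (\<lambda>x. Fm x $ 2) = 0" "bd_ell_perp (map_option cnj \<alpha>) (\<lambda>x. Fm x $ 1) = 0"
    using bc loc_abs_cont1_nth(2)[OF hs, of 0] by (simp_all add: bd_ell_eq vec_eq_iff forall_2 bd_data_perp_nth)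
  have "hermitisation q \<alpha> Fm (\<lambda>x. of_real (k\<^sup>2) *s Fm x)"
    unfolding hermitisation_def schroedinger_op_def
  proof (intro conjI)
    show "AE x in lebesgue. 0 < x \<longrightarrow> (\<exists>f2. (hl_deriv (\<lambda>x. Fm x $ 2) has_vector_derivative f2) (at x) \<and>
        - f2 + q x * Fm x $ 2 = (complex_of_real (k\<^sup>2) *s Fm x) $ 1)"
      using cauchy_sol_AE[OF F(3)]
    proof eventually_elim
      case (elim x)
      then show ?case using der[of 2 "q x * Fm x $ 2 - of_real (k\<^sup>2) * Fm x $ 1" x] by auto
    qed
    show "AE x in lebesgue. 0 < x \<longrightarrow> (\<exists>f2. (hl_deriv (\<lambda>x. Fm x $ 1) has_vector_derivative f2) (at x) \<and>
        - f2 + cnj (q x) * Fm x $ 1 = (complex_of_real (k\<^sup>2) *s Fm x) $ 2)"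
      using cauchy_sol_AE[OF F(3)]
    proof eventually_elim
      case (elim x)
      then show ?case using der[of 1 "cnj (q x) * Fm x $ 1 - of_real (k\<^sup>2) * Fm x $ 2" x] by auto
    qed
  qed (use L2[of 1] L2[of "of_real (k\<^sup>2)"] loc_abs_cont1_nth(1)[OF hs] bc' in auto)
  moreover have "\<not> (AE x in lebesgue. x > 0 \<longrightarrow> Fm x = 0)"
  proof
    assume "AE x in lebesgue. x > 0 \<longrightarrow> Fm x = 0"
    then obtain E where E: "negligible E" "\<And>x. x \<notin> E \<Longrightarrow> x > 0 \<longrightarrow> Fm x = 0"
      using AE_lebesgue_negligible by blast
    obtain Y where Y: "\<And>x. x \<ge> Y \<Longrightarrow> norm (exp (k * x) *\<^sub>R (Fm x $ 1)) > 0"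
      using order_tendstoD(1)[OF tendsto_norm[OF F(1)], of 0] by (auto simp: eventually_at_top_linorder)
    have "{max 1 Y..max 1 Y + 1} \<subseteq> E"
      using E(2) Y by fastforce
    then have "negligible {max 1 Y..max 1 Y + 1}" using E(1) negligible_subset by blast
    then show False using negligible_interval(1)[of "max 1 Y" "max 1 Y + 1"] by simp
  qed
  ultimately show ?thesis by (auto simp: hermitisation_eigenvalue_def)
qed

text \<open>Decaying solutions at k^2 are unique up to a factor, so F_{-1} is a multiple of the
  eigenfunction and inherits its boundary condition.\<close>

lemma eigenvalue_jost_minus:
  assumes k: "k > 0" and Fm: "jost_minus1 q k Fm" and ev: "hermitisation_eigenvalue q \<alpha> (of_real (k\<^sup>2))"
  shows "bd_data_perp \<alpha> (Fm 0) (hl_deriv Fm 0) = 0"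
proof -
  note F = jost_minus_asymptotics[OF k Fm]
  obtain G E where G: "cauchy_sol q (of_real (k\<^sup>2)) G E" "decays G E" "bd_data_perp \<alpha> (G 0) (E 0) = 0" "data_norm (G 0) (E 0) \<noteq> 0"
    using eigenvalue_sol[OF ev] by blast
  obtain c where c: "\<And>x. x \<ge> 0 \<Longrightarrow> Fm x = c *s G x" "\<And>x. x \<ge> 0 \<Longrightarrow> hl_deriv Fm x = c *s E x"
    using decaying_multiple[OF k F(3,2) G(1,2) order_refl G(4)] by blast
  then show ?thesis using bd_data_perp_lin[of \<alpha> c "G 0" 0 0 "E 0" 0] G(3) by simp
qed

text \<open>If the determinant vanished, some combination F_{+i} - c F_{-1} would satisfy the
  boundary condition, and its flux at 0 would be 0. All terms containing F_{-1} vanish, so the flux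
  is that of F_{+i}, namely 4 i k.\<close>

lemma jost_det_nonzero:
  assumes k: "k > 0" and Fp: "jost_plus_i q k Fp" and Fm: "jost_minus1 q k Fm"
    and m: "bd_data_perp \<alpha> (Fm 0) (hl_deriv Fm 0) \<noteq> 0"
  shows "det (cols2 (bd_data_perp \<alpha> (Fp 0) (hl_deriv Fp 0)) (bd_data_perp \<alpha> (Fm 0) (hl_deriv Fm 0))) \<noteq> 0"
proof
  let ?Dp = "hl_deriv Fp" and ?Dm = "hl_deriv Fm"
  note F = jost_minus_asymptotics[OF k Fm]
  have P: "outgoing q k Fp ?Dp" by (rule jost_plus_outgoing[OF k Fp])
  have Ps: "cauchy_sol q (of_real (k\<^sup>2)) Fp ?Dp" using P by (simp add: outgoing_def)
  obtain B where B: "\<And>x. x \<ge> 0 \<Longrightarrow> data_norm (Fp x) (?Dp x) \<le> B" using P by (auto simp: outgoing_def)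
  obtain B' where B': "\<And>x. x \<ge> 0 \<Longrightarrow> data_norm (Fm x) (?Dm x) \<le> B'"
    using decays_outgoing[OF F(3,2)] by (auto simp: outgoing_def)
  assume "det (cols2 (bd_data_perp \<alpha> (Fp 0) (?Dp 0)) (bd_data_perp \<alpha> (Fm 0) (?Dm 0))) = 0"
  then obtain c where c: "bd_data_perp \<alpha> (Fp 0) (?Dp 0) = c *s bd_data_perp \<alpha> (Fm 0) (?Dm 0)"
    using parallel_complex2[OF _ m] by (auto simp: det_cols2)
  define G where "G x = 1 *s Fp x + (- c) *s Fm x" for x
  define E where "E x = 1 *s ?Dp x + (- c) *s ?Dm x" for x
  have "bd_data_perp \<alpha> (G 0) (E 0) = 0"
    unfolding G_def E_def bd_data_perp_lin c by simp
  then have "wronskian (\<lambda>x. dag (G x)) (\<lambda>x. dag (E x)) G E 0 = 0"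
    unfolding wronskian_boundary[where \<alpha> = \<alpha>] bd_data_perp_dag by simp
  moreover have "wronskian (\<lambda>x. dag (G x)) (\<lambda>x. dag (E x)) G E 0 =
      wronskian (\<lambda>x. dag (Fp x)) (\<lambda>x. dag (?Dp x)) Fp ?Dp 0 - c * wronskian (\<lambda>x. dag (Fp x)) (\<lambda>x. dag (?Dp x)) Fm ?Dm 0
      - cnj c * wronskian (\<lambda>x. dag (Fm x)) (\<lambda>x. dag (?Dm x)) Fp ?Dp 0
      + cnj c * c * wronskian (\<lambda>x. dag (Fm x)) (\<lambda>x. dag (?Dm x)) Fm ?Dm 0"
    by (simp add: wronskian_def G_def E_def algebra_simps)
  moreover have sd: "cauchy_sol q (of_real (k\<^sup>2)) (\<lambda>x. dag (F x)) (\<lambda>x. dag (D x))" if "cauchy_sol q (of_real (k\<^sup>2)) F D" for F D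
    using cauchy_sol_dag[OF that] unfolding complex_cnj_complex_of_real .
  moreover have "wronskian (\<lambda>x. dag (Fp x)) (\<lambda>x. dag (?Dp x)) Fm ?Dm 0 = 0"
    by (rule wronskian_bounded_decays[where B = B, OF sd[OF Ps] _ F(3,2)]) (simp only: data_norm_dag B)
  moreover have "wronskian (\<lambda>x. dag (Fm x)) (\<lambda>x. dag (?Dm x)) Fm ?Dm 0 = 0"
    by (rule wronskian_bounded_decays[where B = B', OF sd[OF F(3)] _ F(3,2)]) (simp only: data_norm_dag B')
  moreover have "wronskian Fp ?Dp (\<lambda>x. dag (Fm x)) (\<lambda>x. dag (?Dm x)) 0 = 0"
    by (rule wronskian_bounded_decays[OF Ps B sd[OF F(3)]]) (use F(2) in \<open>simp_all add: decays_def data_norm_dag\<close>)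
  ultimately have "4 * \<i> * complex_of_real k = 0"
    using wronskian_dag_jost_plus[OF k Fp] wronskian_antisym[of "\<lambda>x. dag (Fm x)" "\<lambda>x. dag (?Dm x)" Fp ?Dp 0] by simp
  then show False using k by simp
qed

text \<open>Two admissible choices differ by a decaying solution, hence by a multiple of F_{-1}; in
  the determinant this is a column operation.\<close>

lemma jost_det_independent:
  assumes k: "k > 0" and Fp: "jost_plus_i q k Fp" and Fp': "jost_plus_i q k Fp'" and Fm: "jost_minus1 q k Fm"
  shows "det (cols2 (bd_data_perp \<alpha> (Fp' 0) (hl_deriv Fp' 0)) (bd_data_perp \<alpha> (Fm 0) (hl_deriv Fm 0))) =
    det (cols2 (bd_data_perp \<alpha> (Fp 0) (hl_deriv Fp 0)) (bd_data_perp \<alpha> (Fm 0) (hl_deriv Fm 0)))"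
proof -
  note F = jost_minus_asymptotics[OF k Fm]
  have Ps: "cauchy_sol q (of_real (k\<^sup>2)) Fp (hl_deriv Fp)" "cauchy_sol q (of_real (k\<^sup>2)) Fp' (hl_deriv Fp')"
    using jost_plus_outgoing[OF k Fp] jost_plus_outgoing[OF k Fp'] by (auto simp: outgoing_def)
  define G where "G x = 1 *s Fp' x + (- 1) *s Fp x" for x
  define E where "E x = 1 *s hl_deriv Fp' x + (- 1) *s hl_deriv Fp x" for x
  have G: "cauchy_sol q (of_real (k\<^sup>2)) G E"
    unfolding G_def[abs_def] E_def[abs_def] by (rule cauchy_sol_lin[OF Ps(2,1)])
  have gl: "((\<lambda>x. G x $ i) \<longlongrightarrow> 0) at_top" "((\<lambda>x. E x $ i) \<longlongrightarrow> 0) at_top" for i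
    using tendsto_diff[OF jost_plus_asymptotics(1)[OF Fp', of i] jost_plus_asymptotics(1)[OF Fp, of i]]
      tendsto_diff[OF jost_plus_asymptotics(2)[OF Fp', of i] jost_plus_asymptotics(2)[OF Fp, of i]]
    by (simp_all add: G_def E_def)
  have "((\<lambda>x. data_norm (G x) (E x)) \<longlongrightarrow> 0 + 0 + 0 + 0) at_top"
    unfolding data_norm_def by (intro tendsto_add tendsto_norm_zero gl)
  then have dec: "decays G E" by (simp add: decays_def)
  obtain c where c: "\<And>x. x \<ge> 0 \<Longrightarrow> G x = c *s Fm x" "\<And>x. x \<ge> 0 \<Longrightarrow> E x = c *s hl_deriv Fm x"
    using decaying_multiple[OF k G dec F(3,2) order_refl jost_minus_nonzero[OF k Fm]] by blast
  have "bd_data_perp \<alpha> (Fp' 0) (hl_deriv Fp' 0) = bd_data_perp \<alpha> (1 *s Fp 0 + c *s Fm 0) (1 *s hl_deriv Fp 0 + c *s hl_deriv Fm 0)"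
    using c[of 0] by (simp add: G_def E_def algebra_simps)
  then show ?thesis unfolding bd_data_perp_lin by (simp add: det_cols2 algebra_simps)
qed

end

section \<open>Boundary values of the Weyl matrix away from eigenvalues\<close>

context potential
begin

text \<open>The normalisations of Phi and Theta are such that Theta - Phi M has boundary data M and
  epsilon. The Weyl matrix is thereby read off from the data at 0 of decaying solutions, the only
  form in which it is used.\<close>

lemma weyl_column:
  assumes W: "weyl_matrix q \<alpha> z M"
  obtains Y D where "cauchy_sol q z Y D" "decays Y D" "bd_data \<alpha> (Y 0) (D 0) = column j M" "bd_data_perp \<alpha> (Y 0) (D 0) = column j eps_mat"
proof -
  obtain \<Phi> \<Theta> where hs: "\<And>j. herm_solution q z (\<lambda>x. column j (\<Phi> x))" "\<And>j. herm_solution q z (\<lambda>x. column j (\<Theta> x))"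
    and bc: "mat_bd_L \<alpha> \<Phi> = - mat 1" "mat_bd_L_perp \<alpha> \<Phi> = 0" "mat_bd_L \<alpha> \<Theta> = 0" "mat_bd_L_perp \<alpha> \<Theta> = eps_mat"
    and L2: "\<And>j. L2_halfline (\<lambda>x. column j (\<Theta> x - \<Phi> x ** M))"
    using W unfolding weyl_matrix_def by blast
  define P T where "P l = (\<lambda>x. column l (\<Phi> x))" and "T l = (\<lambda>x. column l (\<Theta> x))" for l
  have P: "cauchy_sol q z (P l) (hl_deriv (P l))" and T: "cauchy_sol q z (T l) (hl_deriv (T l))" for l
    using herm_solution_sol hs unfolding P_def T_def by blast+
  define Y where "Y x = 1 *s T j x + (-1) *s (M $ 1 $ j *s P 1 x + M $ 2 $ j *s P 2 x)" for x
  define D where "D x = 1 *s hl_deriv (T j) x + (-1) *s (M $ 1 $ j *s hl_deriv (P 1) x + M $ 2 $ j *s hl_deriv (P 2) x)" for x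
  have Ysol: "cauchy_sol q z Y D"
    unfolding Y_def[abs_def] D_def[abs_def] by (intro cauchy_sol_lin P T)
  have Yeq: "column j (\<Theta> x - \<Phi> x ** M) = Y x" for x
    by (simp add: vec_eq_iff Y_def P_def T_def column_def matrix_matrix_mult_def sum_2 algebra_simps)
  have "decays Y D"
    using L2_halfline_integrable[OF L2[of j]] unfolding Yeq by (rule square_integrable_decays[OF Ysol])
  moreover
  have nth: "mat_bd_L \<alpha> F $ i $ l = bd_L \<alpha> (\<lambda>x. column l (F x)) $ i"
    "mat_bd_L_perp \<alpha> F $ i $ l = bd_L_perp \<alpha> (\<lambda>x. column l (F x)) $ i" for F i l
    by (simp_all add: mat_bd_L_def mat_bd_L_perp_def)
  have LVP: "bd_data \<alpha> (P l 0) (hl_deriv (P l) 0) $ i = (- mat 1 :: complex^2^2) $ i $ l"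
    "bd_data_perp \<alpha> (P l 0) (hl_deriv (P l) 0) $ i = 0"
    "bd_data \<alpha> (T l 0) (hl_deriv (T l) 0) $ i = 0"
    "bd_data_perp \<alpha> (T l 0) (hl_deriv (T l) 0) $ i = eps_mat $ i $ l" for l i
    unfolding bd_L_sol[OF P, symmetric] bd_L_sol[OF T, symmetric]
    using nth[of \<Phi> i l] nth[of \<Theta> i l] by (simp_all add: P_def T_def bc)
  have "bd_data \<alpha> (Y 0) (D 0) = column j M"
    unfolding Y_def D_def bd_data_lin by (simp add: vec_eq_iff forall_2 LVP column_def mat_def)
  moreover have "bd_data_perp \<alpha> (Y 0) (D 0) = column j eps_mat"
    unfolding Y_def D_def bd_data_perp_lin by (simp add: vec_eq_iff forall_2 LVP column_def)
  ultimately show ?thesis using that Ysol by blast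
qed

text \<open>
  By Cramer's rule the Wronskians with two outgoing solutions determine one half of the
  boundary data of a solution from the other half.
\<close>

lemma boundary_data_near:
  fixes P DP Q DQ :: "real \<Rightarrow> complex^2" and \<alpha> :: "complex option"
  assumes k: "k > 0" and P: "outgoing q k P DP" and Q: "outgoing q k Q DQ"
  defines "p \<equiv> bd_data_perp \<alpha> (P 0) (DP 0)" and "m \<equiv> bd_data_perp \<alpha> (Q 0) (DQ 0)"
    and "r \<equiv> bd_data \<alpha> (P 0) (DP 0)" and "s \<equiv> bd_data \<alpha> (Q 0) (DQ 0)"
  defines "\<delta> \<equiv> p $ 1 * m $ 2 - m $ 1 * p $ 2"
  assumes det: "\<delta> \<noteq> 0" and eta: "\<eta> > 0"
  shows "\<exists>\<rho>>0. \<forall>z F D. cmod (z - of_real (k\<^sup>2)) < \<rho> \<longrightarrow> Im z \<ge> 0 \<longrightarrow> cauchy_sol q z F D \<longrightarrow> decays F D \<longrightarrow>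
    (\<forall>x y. x = bd_data \<alpha> (F 0) (D 0) \<longrightarrow> y = bd_data_perp \<alpha> (F 0) (D 0) \<longrightarrow>
     cmod (x $ 1 - (m $ 2 * (r $ 1 * y $ 1 + r $ 2 * y $ 2) - p $ 2 * (s $ 1 * y $ 1 + s $ 2 * y $ 2)) / \<delta>)
        \<le> \<eta> * (cmod (x $ 1) + cmod (x $ 2) + cmod (y $ 1) + cmod (y $ 2)) \<and>
     cmod (x $ 2 - (p $ 1 * (s $ 1 * y $ 1 + s $ 2 * y $ 2) - m $ 1 * (r $ 1 * y $ 1 + r $ 2 * y $ 2)) / \<delta>)
        \<le> \<eta> * (cmod (x $ 1) + cmod (x $ 2) + cmod (y $ 1) + cmod (y $ 2)))"
proof -
  define c where "c = 1 + (cmod (p $ 1) + cmod (p $ 2) + cmod (m $ 1) + cmod (m $ 2))"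
  have c: "c > 0" unfolding c_def by (intro add_pos_nonneg add_nonneg_nonneg) auto
  \<comment> \<open>\<open>c\<close> dominates the coefficients in Cramer's rule, with 1 added for
    positivity, and the factor 2 is lost when Cauchy data are bounded by boundary data.\<close>
  define e where "e = \<eta> * cmod \<delta> / (2 * c)"
  have e: "e > 0" using eta det c by (simp add: e_def)
  obtain r1 where r1: "r1 > 0" "\<And>z F D. cmod (z - of_real (k\<^sup>2)) < r1 \<Longrightarrow> Im z \<ge> 0 \<Longrightarrow> cauchy_sol q z F D \<Longrightarrow> decays F D \<Longrightarrow>
     cmod (wronskian P DP F D 0) \<le> e * data_norm (F 0) (D 0)"
    using wronskian_outgoing_small[OF k P e] by blast
  obtain r2 where r2: "r2 > 0" "\<And>z F D. cmod (z - of_real (k\<^sup>2)) < r2 \<Longrightarrow> Im z \<ge> 0 \<Longrightarrow> cauchy_sol q z F D \<Longrightarrow> decays F D \<Longrightarrow>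
     cmod (wronskian Q DQ F D 0) \<le> e * data_norm (F 0) (D 0)"
    using wronskian_outgoing_small[OF k Q e] by blast
  show ?thesis
  proof (intro exI[of _ "min r1 r2"] conjI allI impI)
    fix z F D x y
    assume z: "cmod (z - of_real (k\<^sup>2)) < min r1 r2" "Im z \<ge> 0" and F: "cauchy_sol q z F D" "decays F D"
      and x: "x = bd_data \<alpha> (F 0) (D 0)" and y: "y = bd_data_perp \<alpha> (F 0) (D 0)"
    define N where "N = cmod (x $ 1) + cmod (x $ 2) + cmod (y $ 1) + cmod (y $ 2)"
    define w1 w2 where "w1 = wronskian P DP F D 0" and "w2 = wronskian Q DQ F D 0"
    have N0: "N \<ge> 0" by (simp add: N_def)
    have "e * data_norm (F 0) (D 0) \<le> e * (2 * N)"
      using data_norm_boundary[of "F 0" "D 0" \<alpha>] e by (intro mult_left_mono) (auto simp: N_def x y)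
    then have w: "cmod w1 \<le> 2 * e * N" "cmod w2 \<le> 2 * e * N"
      using r1(2)[OF _ z(2) F] r2(2)[OF _ z(2) F] z(1) by (auto simp: w1_def w2_def)
    have W1: "w1 = p $ 1 * x $ 1 + p $ 2 * x $ 2 - (r $ 1 * y $ 1 + r $ 2 * y $ 2)"
      and W2: "w2 = m $ 1 * x $ 1 + m $ 2 * x $ 2 - (s $ 1 * y $ 1 + s $ 2 * y $ 2)"
      unfolding w1_def w2_def wronskian_boundary[where \<alpha> = \<alpha>] p_def m_def r_def s_def x y by simp_all
    have *: "cmod (a * w1 - b * w2) \<le> \<eta> * N * cmod \<delta>"
      if "cmod a + cmod b \<le> c" for a b
    proof -
      have "cmod (a * w1 - b * w2) \<le> cmod a * cmod w1 + cmod b * cmod w2"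
        using norm_triangle_ineq4[of "a * w1" "b * w2"] by (simp add: norm_mult)
      also have "\<dots> \<le> cmod a * (2 * e * N) + cmod b * (2 * e * N)"
        by (intro add_mono mult_left_mono w) auto
      also have "\<dots> = (cmod a + cmod b) * (2 * e * N)" by (simp add: algebra_simps)
      also have "\<dots> \<le> c * (2 * e * N)" using that e N0 by (intro mult_right_mono) auto
      also have "\<dots> = \<eta> * N * cmod \<delta>" using c by (simp add: e_def)
      finally show ?thesis .
    qed
    have div: "cmod (X - A / \<delta>) \<le> \<eta> * N" if "cmod (X * \<delta> - A) \<le> \<eta> * N * cmod \<delta>" for X A
    proof -
      have "X - A / \<delta> = (X * \<delta> - A) / \<delta>" using det by (simp add: diff_divide_distrib)
      then show ?thesis using that det by (simp add: norm_divide divide_le_eq)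
    qed
    have "x $ 1 * \<delta> - (m $ 2 * (r $ 1 * y $ 1 + r $ 2 * y $ 2) - p $ 2 * (s $ 1 * y $ 1 + s $ 2 * y $ 2)) = m $ 2 * w1 - p $ 2 * w2"
      unfolding W1 W2 \<delta>_def by (simp add: algebra_simps)
    then show "cmod (x $ 1 - (m $ 2 * (r $ 1 * y $ 1 + r $ 2 * y $ 2) - p $ 2 * (s $ 1 * y $ 1 + s $ 2 * y $ 2)) / \<delta>)
        \<le> \<eta> * (cmod (x $ 1) + cmod (x $ 2) + cmod (y $ 1) + cmod (y $ 2))"
      unfolding N_def[symmetric] using *[of "m $ 2" "p $ 2"] by (intro div) (simp add: c_def)
    have "x $ 2 * \<delta> - (p $ 1 * (s $ 1 * y $ 1 + s $ 2 * y $ 2) - m $ 1 * (r $ 1 * y $ 1 + r $ 2 * y $ 2)) = - (m $ 1 * w1 - p $ 1 * w2)"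
      unfolding W1 W2 \<delta>_def by (simp add: algebra_simps)
    then show "cmod (x $ 2 - (p $ 1 * (s $ 1 * y $ 1 + s $ 2 * y $ 2) - m $ 1 * (r $ 1 * y $ 1 + r $ 2 * y $ 2)) / \<delta>)
        \<le> \<eta> * (cmod (x $ 1) + cmod (x $ 2) + cmod (y $ 1) + cmod (y $ 2))"
      unfolding N_def[symmetric] using *[of "m $ 1" "p $ 1"] by (intro div) (simp add: c_def norm_minus_commute)
  qed (use r1 r2 in auto)
qed

text \<open>For an eigenfunction at real t near k^2 one half of the boundary data vanishes, so each
  entry of the other half is at most a quarter of the sum of both, which forces zero. The
  neighbourhood obtained is where the continuous density can be used.\<close>

lemma no_eigenvalue_near:
  fixes P DP Q DQ :: "real \<Rightarrow> complex^2" and \<alpha> :: "complex option"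
  assumes k: "k > 0" and P: "outgoing q k P DP" and Q: "outgoing q k Q DQ"
    and det: "det (cols2 (bd_data_perp \<alpha> (P 0) (DP 0)) (bd_data_perp \<alpha> (Q 0) (DQ 0))) \<noteq> 0"
  shows "\<exists>\<rho>>0. \<forall>t. \<bar>t - k\<^sup>2\<bar> < \<rho> \<longrightarrow> \<not> hermitisation_eigenvalue q \<alpha> (of_real t)"
proof -
  have e: "(1/4::real) > 0" by simp
  from boundary_data_near[OF k P Q det[unfolded det_cols2] e]
  obtain \<rho> where \<rho>: "\<rho> > 0" and near: "\<And>z F D. cmod (z - of_real (k\<^sup>2)) < \<rho> \<Longrightarrow> Im z \<ge> 0 \<Longrightarrow> cauchy_sol q z F D \<Longrightarrow> decays F D \<Longrightarrow>
     bd_data_perp \<alpha> (F 0) (D 0) = 0 \<Longrightarrow>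
     cmod (bd_data \<alpha> (F 0) (D 0) $ 1) \<le> 1/4 * (cmod (bd_data \<alpha> (F 0) (D 0) $ 1) + cmod (bd_data \<alpha> (F 0) (D 0) $ 2)) \<and>
     cmod (bd_data \<alpha> (F 0) (D 0) $ 2) \<le> 1/4 * (cmod (bd_data \<alpha> (F 0) (D 0) $ 1) + cmod (bd_data \<alpha> (F 0) (D 0) $ 2))"
    by fastforce
  have "\<not> hermitisation_eigenvalue q \<alpha> (of_real t)" if t: "\<bar>t - k\<^sup>2\<bar> < \<rho>" for t
  proof
    assume "hermitisation_eigenvalue q \<alpha> (of_real t)"
    then obtain F D where F: "cauchy_sol q (of_real t) F D" "decays F D" "bd_data_perp \<alpha> (F 0) (D 0) = 0" "data_norm (F 0) (D 0) \<noteq> 0"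
      by (rule eigenvalue_sol)
    have "cmod (of_real t - of_real (k\<^sup>2)) < \<rho>" using t by (simp only: of_real_diff[symmetric] norm_of_real)
    note z0 = near[OF this _ F(1-3), unfolded Im_complex_of_real, OF order_refl]
    have "cmod (bd_data \<alpha> (F 0) (D 0) $ 1) \<le> 0" "cmod (bd_data \<alpha> (F 0) (D 0) $ 2) \<le> 0"
    proof -
      have *: "a \<le> 0 \<and> b \<le> 0" if "a \<le> 1/4 * (a + b) \<and> b \<le> 1/4 * (a + b)" for a b :: real
      proof -
        have "a \<le> 1/4 * (a + b)" "b \<le> 1/4 * (a + b)" using that by blast+
        then have "a \<le> 0" "b \<le> 0" by simp_all
        then show ?thesis by blast
      qed
      show "cmod (bd_data \<alpha> (F 0) (D 0) $ 1) \<le> 0" "cmod (bd_data \<alpha> (F 0) (D 0) $ 2) \<le> 0"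
        using *[OF z0] by simp_all
    qed
    then have "data_norm (F 0) (D 0) \<le> 0" using data_norm_boundary[of "F 0" "D 0" \<alpha>] F(3) by simp
    then show False using F(4) data_norm_nonneg[of "F 0" "D 0"] by simp
  qed
  then show ?thesis using \<rho> by blast
qed

text \<open>Here one half of the boundary data is a column of epsilon, which is fixed, and the other
  is a column of M, whose size is not known in advance. Cramer's rule therefore gives an error
  relative to the size of M, which has to be absorbed before it becomes absolute.\<close>

lemma weyl_matrix_limit:
  fixes P DP Q DQ :: "real \<Rightarrow> complex^2" and \<alpha> :: "complex option"
  assumes k: "k > 0" and P: "outgoing q k P DP" and Q: "outgoing q k Q DQ"
  defines "p \<equiv> bd_data_perp \<alpha> (P 0) (DP 0)" and "m \<equiv> bd_data_perp \<alpha> (Q 0) (DQ 0)"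
    and "r \<equiv> bd_data \<alpha> (P 0) (DP 0)" and "s \<equiv> bd_data \<alpha> (Q 0) (DQ 0)"
  defines "\<delta> \<equiv> p $ 1 * m $ 2 - m $ 1 * p $ 2"
  assumes det: "\<delta> \<noteq> 0" and M: "\<And>z. z \<notin> \<real> \<Longrightarrow> weyl_matrix q \<alpha> z (M z)"
  shows "((\<lambda>d. M (Complex (k\<^sup>2) d) $ 1 $ 1) \<longlongrightarrow> (m $ 2 * r $ 2 - p $ 2 * s $ 2) / \<delta>) (at_right 0)"
    "((\<lambda>d. M (Complex (k\<^sup>2) d) $ 2 $ 1) \<longlongrightarrow> (p $ 1 * s $ 2 - m $ 1 * r $ 2) / \<delta>) (at_right 0)"
    "((\<lambda>d. M (Complex (k\<^sup>2) d) $ 1 $ 2) \<longlongrightarrow> (m $ 2 * r $ 1 - p $ 2 * s $ 1) / \<delta>) (at_right 0)"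
    "((\<lambda>d. M (Complex (k\<^sup>2) d) $ 2 $ 2) \<longlongrightarrow> (p $ 1 * s $ 1 - m $ 1 * r $ 1) / \<delta>) (at_right 0)"
proof -
  have main: "((\<lambda>d. M (Complex (k\<^sup>2) d) $ 1 $ j) \<longlongrightarrow>
        (m $ 2 * (r $ 1 * eps_mat $ 1 $ j + r $ 2 * eps_mat $ 2 $ j) - p $ 2 * (s $ 1 * eps_mat $ 1 $ j + s $ 2 * eps_mat $ 2 $ j)) / \<delta>) (at_right 0) \<and>
      ((\<lambda>d. M (Complex (k\<^sup>2) d) $ 2 $ j) \<longlongrightarrow>
        (p $ 1 * (s $ 1 * eps_mat $ 1 $ j + s $ 2 * eps_mat $ 2 $ j) - m $ 1 * (r $ 1 * eps_mat $ 1 $ j + r $ 2 * eps_mat $ 2 $ j)) / \<delta>) (at_right 0)"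
    (is "(_ \<longlongrightarrow> ?a) _ \<and> (_ \<longlongrightarrow> ?b) _") for j
  proof -
    define T0 where "T0 = cmod ?a + cmod ?b"
    have T0: "T0 \<ge> 0" by (simp add: T0_def)
    have y1: "cmod (eps_mat $ 1 $ j) + cmod (eps_mat $ 2 $ j) = 1"
      using exhaust_2[of j] by (auto simp: eps_mat_def vector_2)
    have est: "\<forall>\<^sub>F d in at_right 0. cmod (M (Complex (k\<^sup>2) d) $ 1 $ j - ?a) < e \<and> cmod (M (Complex (k\<^sup>2) d) $ 2 $ j - ?b) < e"
      if e: "e > 0" for e
    proof -
      \<comment> \<open>The first entry yields T + 1 <= 2 (T0 + 1) by absorption, and the second
        then makes the error at most e / 2.\<close>
      define \<eta> where "\<eta> = min (1/4) (e / (4 * (T0 + 1)))"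
      have eta: "\<eta> > 0" using e T0 by (simp add: \<eta>_def)
      have eta_le: "\<eta> \<le> 1/4" "\<eta> \<le> e / (4 * (T0 + 1))"
        unfolding \<eta>_def by (rule min.cobounded1 min.cobounded2)+
      from boundary_data_near[OF k P Q det[unfolded \<delta>_def p_def m_def] eta]
      obtain \<rho> where \<rho>: "\<rho> > 0" and near: "\<And>z F D x y. cmod (z - of_real (k\<^sup>2)) < \<rho> \<Longrightarrow> Im z \<ge> 0 \<Longrightarrow> cauchy_sol q z F D \<Longrightarrow> decays F D \<Longrightarrow>
         x = bd_data \<alpha> (F 0) (D 0) \<Longrightarrow> y = bd_data_perp \<alpha> (F 0) (D 0) \<Longrightarrow>
         cmod (x $ 1 - (m $ 2 * (r $ 1 * y $ 1 + r $ 2 * y $ 2) - p $ 2 * (s $ 1 * y $ 1 + s $ 2 * y $ 2)) / \<delta>)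
            \<le> \<eta> * (cmod (x $ 1) + cmod (x $ 2) + cmod (y $ 1) + cmod (y $ 2)) \<and>
         cmod (x $ 2 - (p $ 1 * (s $ 1 * y $ 1 + s $ 2 * y $ 2) - m $ 1 * (r $ 1 * y $ 1 + r $ 2 * y $ 2)) / \<delta>)
            \<le> \<eta> * (cmod (x $ 1) + cmod (x $ 2) + cmod (y $ 1) + cmod (y $ 2))"
        unfolding p_def[symmetric] m_def[symmetric] r_def[symmetric] s_def[symmetric] \<delta>_def[symmetric] by blast
      have "\<forall>\<^sub>F d in at_right (0::real). d < \<rho>" "\<forall>\<^sub>F d in at_right (0::real). d > 0"
        using \<rho> by (auto simp: eventually_at_right_less eventually_at_right_field)
      then show ?thesis
      proof eventually_elim
        case (elim d)
        let ?z = "Complex (k\<^sup>2) d"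
        have z: "?z \<notin> \<real>" "Im ?z \<ge> 0" using elim by (auto simp: complex_is_Real_iff)
        have "?z - of_real (k\<^sup>2) = \<i> * of_real d" by (simp add: complex_eq_iff)
        then have zr: "cmod (?z - of_real (k\<^sup>2)) < \<rho>" using elim by (simp add: norm_mult)
        obtain F D where F: "cauchy_sol q ?z F D" "decays F D" and x: "bd_data \<alpha> (F 0) (D 0) = column j (M ?z)" and y: "bd_data_perp \<alpha> (F 0) (D 0) = column j eps_mat"
          using weyl_column[OF M[OF z(1)]] by blast
        define x1 x2 where "x1 = M ?z $ 1 $ j" and "x2 = M ?z $ 2 $ j"
        define T where "T = cmod x1 + cmod x2"
        have n: "cmod (x1 - ?a) \<le> \<eta> * (T + 1) \<and> cmod (x2 - ?b) \<le> \<eta> * (T + 1)"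
          using near[OF zr z(2) F x[symmetric] y[symmetric]] y1 by (simp add: column_def x1_def x2_def T_def add.assoc)
        have "T \<le> T0 + 2 * (\<eta> * (T + 1))"
          using n norm_triangle_sub[of x1 ?a] norm_triangle_sub[of x2 ?b] unfolding T_def T0_def by linarith
        also have "\<eta> * (T + 1) \<le> 1/4 * (T + 1)" using eta_le by (intro mult_right_mono) (auto simp: T_def)
        finally have "T + 1 \<le> 2 * (T0 + 1)" by (simp add: field_simps)
        then have "\<eta> * (T + 1) \<le> e / (4 * (T0 + 1)) * (2 * (T0 + 1))"
          using eta_le T0 e by (intro mult_mono) (auto simp: T_def)
        also have "\<dots> = e / 2" using T0 by (simp add: field_simps)
        finally show ?case using n e by (simp add: x1_def x2_def)
      qed
    qed
    show ?thesis
      unfolding tendsto_iff dist_norm using est unfolding eventually_conj_iff by blast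
  qed
  show "((\<lambda>d. M (Complex (k\<^sup>2) d) $ 1 $ 1) \<longlongrightarrow> (m $ 2 * r $ 2 - p $ 2 * s $ 2) / \<delta>) (at_right 0)"
    "((\<lambda>d. M (Complex (k\<^sup>2) d) $ 2 $ 1) \<longlongrightarrow> (p $ 1 * s $ 2 - m $ 1 * r $ 2) / \<delta>) (at_right 0)"
    "((\<lambda>d. M (Complex (k\<^sup>2) d) $ 1 $ 2) \<longlongrightarrow> (m $ 2 * r $ 1 - p $ 2 * s $ 1) / \<delta>) (at_right 0)"
    "((\<lambda>d. M (Complex (k\<^sup>2) d) $ 2 $ 2) \<longlongrightarrow> (p $ 1 * s $ 1 - m $ 1 * r $ 1) / \<delta>) (at_right 0)"
    using main[of 1] main[of 2] by (simp_all add: eps_mat_def vector_2)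
qed

end

section \<open>Herglotz integrals\<close>

definition herglotz_kernel :: "complex \<Rightarrow> real \<Rightarrow> complex" where
  "herglotz_kernel z t = 1 / (of_real t - z) - of_real (t / (1 + t\<^sup>2))"

lemma norm_of_real_minus_ge: "cmod (of_real t - z) \<ge> \<bar>Im z\<bar>"
  using abs_Im_le_cmod[of "of_real t - z"] by simp

text \<open>Multiplied by 1 + t^2 the kernel becomes z + (1 + z^2) / (t - z), which is bounded
  because |t - z| >= |Im z|.\<close>

lemma herglotz_kernel_bound:
  assumes "Im z \<noteq> 0"
  shows "cmod (herglotz_kernel z t) \<le> (cmod z + cmod (1 + z\<^sup>2) / \<bar>Im z\<bar>) * (1 / (1 + t\<^sup>2))"
proof -
  have nz: "of_real t - z \<noteq> 0" using assms norm_of_real_minus_ge[of z t] by auto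
  have pos: "1 + t\<^sup>2 > 0" by (simp add: add_pos_nonneg)
  have nt: "complex_of_real (1 + t\<^sup>2) \<noteq> 0" using pos by (simp only: of_real_eq_0_iff)
  have "herglotz_kernel z t * of_real (1 + t\<^sup>2) = of_real (1 + t\<^sup>2) / (of_real t - z) - of_real t"
    using nt by (simp add: herglotz_kernel_def left_diff_distrib del: of_real_add)
  also have "\<dots> = z + (1 + z\<^sup>2) / (of_real t - z)"
    using nz by (simp add: divide_simps) (simp add: algebra_simps power2_eq_square)
  finally have "cmod (herglotz_kernel z t) * (1 + t\<^sup>2) = cmod (z + (1 + z\<^sup>2) / (of_real t - z))"
    using pos by (metis norm_mult norm_of_real abs_of_pos)
  also have "\<dots> \<le> cmod z + cmod (1 + z\<^sup>2) / cmod (of_real t - z)"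
    by (rule order_trans[OF norm_triangle_ineq]) (simp add: norm_divide)
  also have "\<dots> \<le> cmod z + cmod (1 + z\<^sup>2) / \<bar>Im z\<bar>"
    using assms nz norm_of_real_minus_ge[of z t] by (intro add_left_mono divide_left_mono) auto
  finally show ?thesis using pos by (simp add: field_simps)
qed

locale herglotz_measure =
  fixes \<nu> :: "real measure"
  assumes sets_nu [measurable_cong, simp]: "sets \<nu> = sets borel"
    and int_nu: "integrable \<nu> (\<lambda>t. 1 / (1 + t\<^sup>2))"
begin

lemma integrable_dominated:
  fixes f :: "real \<Rightarrow> 'a::{banach,second_countable_topology}"
  assumes "f \<in> borel_measurable borel" "AE t in \<nu>. norm (f t) \<le> C * (1 / (1 + t\<^sup>2))"
  shows "integrable \<nu> f"
proof (rule Bochner_Integration.integrable_bound)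
  show "integrable \<nu> (\<lambda>t. C * (1 / (1 + t\<^sup>2)))" using int_nu by (rule integrable_mult_right)
  show "f \<in> borel_measurable \<nu>" using assms(1) by simp
  show "AE t in \<nu>. norm (f t) \<le> norm (C * (1 / (1 + t\<^sup>2)))"
    using assms(2) by eventually_elim (metis real_norm_def abs_ge_self order_trans)
qed

lemma integrable_kernel:
  assumes "Im z \<noteq> 0" and s: "s \<in> borel_measurable borel" "AE t in \<nu>. cmod (s t) \<le> 1"
  shows "integrable \<nu> (\<lambda>t. herglotz_kernel z t * s t)"
proof (rule integrable_dominated)
  show "(\<lambda>t. herglotz_kernel z t * s t) \<in> borel_measurable borel"
    unfolding herglotz_kernel_def using s(1) by measurable
  show "AE t in \<nu>. cmod (herglotz_kernel z t * s t) \<le> (cmod z + cmod (1 + z\<^sup>2) / \<bar>Im z\<bar>) * (1 / (1 + t\<^sup>2))"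
    using s(2)
  proof eventually_elim
    case (elim t)
    then have "cmod (herglotz_kernel z t * s t) \<le> cmod (herglotz_kernel z t) * 1"
      unfolding norm_mult by (intro mult_left_mono) auto
    then show ?case using herglotz_kernel_bound[OF assms(1), of t] by simp
  qed
qed

lemma bounded_integrable:
  fixes f :: "real \<Rightarrow> 'a::{banach,second_countable_topology}"
  assumes f: "f \<in> borel_measurable borel" "AE t in \<nu>. norm (f t) \<le> C" and A: "A \<in> sets borel" "A \<subseteq> {a..b}"
  shows "set_integrable \<nu> A f"
  unfolding set_integrable_def
proof (rule integrable_dominated)
  define R where "R = max \<bar>a\<bar> \<bar>b\<bar>"
  show "(\<lambda>x. indicat_real A x *\<^sub>R f x) \<in> borel_measurable borel"
    using f(1) A(1) by measurable
  show "AE t in \<nu>. norm (indicat_real A t *\<^sub>R f t) \<le> (\<bar>C\<bar> * (1 + R\<^sup>2)) * (1 / (1 + t\<^sup>2))"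
    using f(2)
  proof eventually_elim
    case (elim t)
    have pos: "1 + t\<^sup>2 > 0" by (simp add: add_pos_nonneg)
    show ?case
    proof (cases "t \<in> A")
      case True
      then have "a \<le> t" "t \<le> b" using A(2) by auto
      then have "\<bar>t\<bar> \<le> R" unfolding R_def by (smt (verit) max.cobounded1 max.cobounded2)
      then have "t\<^sup>2 \<le> R\<^sup>2" by (metis abs_le_square_iff abs_of_nonneg abs_ge_zero order_trans)
      then have "1 \<le> (1 + R\<^sup>2) * (1 / (1 + t\<^sup>2))" using pos by simp
      from mult_left_mono[OF this abs_ge_zero[of C]] show ?thesis using True elim by (simp add: mult.assoc)
    qed (use pos in simp)
  qed
qed

text \<open>An infinite point mass would be reported as 0 by \<open>measure\<close>, so it has to be
  excluded before masses are computed.\<close>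

lemma finite_at_point: "emeasure \<nu> {x0} \<noteq> \<infinity>"
proof -
  have "set_integrable \<nu> {x0} (\<lambda>_. 1 :: complex)"
    by (rule bounded_integrable[where a = x0 and b = x0 and C = 1]) auto
  then have "integrable \<nu> (indicat_real {x0})"
    unfolding set_integrable_def using integrable_norm by fastforce
  then show ?thesis by (simp add: integrable_indicator_iff less_top)
qed

text \<open>For z = x0 + i d the kernel times - i d tends to 1 at t = x0 and to 0 elsewhere. The
  factor d cancels the 1 / Im z of the kernel bound and leaves a dominating function independent of
  d. A sequence is used because of dominated convergence.\<close>

lemma herglotz_mass_limit:
  assumes s: "s \<in> borel_measurable borel" "AE t in \<nu>. cmod (s t) \<le> 1"
  shows "(\<lambda>n. - \<i> * of_real (1 / real (Suc n)) * (LINT t|\<nu>. herglotz_kernel (Complex x0 (1 / real (Suc n))) t * s t))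
    \<longlonglongrightarrow> s x0 * of_real (measure \<nu> {x0})"
proof -
  define d :: "nat \<Rightarrow> real" where "d n = 1 / real (Suc n)" for n
  have d: "d n > 0" "d n \<le> 1" for n by (simp_all add: d_def)
  have dlim: "d \<longlonglongrightarrow> 0" unfolding d_def by (rule LIMSEQ_Suc[OF lim_1_over_n])
  define z where "z n = Complex x0 (d n)" for n
  define g where "g n t = - \<i> * of_real (d n) * (herglotz_kernel (z n) t * s t)" for n t
  define f where "f t = indicat_real {x0} t *\<^sub>R s x0" for t
  \<comment> \<open>The summands bound |z| and |1 + z^2| for d <= 1.\<close>
  define C where "C = (\<bar>x0\<bar> + 1) + (1 + (\<bar>x0\<bar> + 1)\<^sup>2)"
  have zb: "cmod (z n) \<le> \<bar>x0\<bar> + 1" for n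
    using cmod_le[of "z n"] d[of n] by (simp add: z_def)
  have "(\<lambda>n. LINT t|\<nu>. g n t) \<longlonglongrightarrow> (LINT t|\<nu>. f t)"
  proof (rule integral_dominated_convergence)
    show "f \<in> borel_measurable \<nu>" unfolding f_def by measurable
    show "g n \<in> borel_measurable \<nu>" for n
      unfolding g_def herglotz_kernel_def using s(1) by measurable
    show "integrable \<nu> (\<lambda>t. C * (1 / (1 + t\<^sup>2)))" using int_nu by (rule integrable_mult_right)
    show "AE t in \<nu>. norm (g n t) \<le> C * (1 / (1 + t\<^sup>2))" for n
      using s(2)
    proof eventually_elim
      case (elim t)
      have "norm (g n t) = d n * (cmod (herglotz_kernel (z n) t) * cmod (s t))"
        using d[of n] by (simp add: g_def norm_mult)
      also have "\<dots> \<le> d n * ((cmod (z n) + cmod (1 + (z n)\<^sup>2) / \<bar>Im (z n)\<bar>) * (1 / (1 + t\<^sup>2)) * 1)"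
        using elim d[of n] herglotz_kernel_bound[of "z n" t]
        by (intro mult_left_mono mult_mono) (auto simp: z_def intro!: mult_nonneg_nonneg add_nonneg_nonneg)
      also have "\<dots> = (d n * cmod (z n) + cmod (1 + (z n)\<^sup>2)) * (1 / (1 + t\<^sup>2))"
      proof -
        have "d n * (cmod (z n) + cmod (1 + (z n)\<^sup>2) / \<bar>Im (z n)\<bar>) = d n * cmod (z n) + cmod (1 + (z n)\<^sup>2)"
          using d[of n] by (simp add: z_def distrib_left)
        then show ?thesis by (simp only: mult.assoc[symmetric] mult_1_right)
      qed
      also have "\<dots> \<le> C * (1 / (1 + t\<^sup>2))"
      proof (rule mult_right_mono)
        have "d n * cmod (z n) \<le> 1 * (\<bar>x0\<bar> + 1)" using d[of n] zb[of n] by (intro mult_mono) auto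
        moreover have "cmod (1 + (z n)\<^sup>2) \<le> 1 + (\<bar>x0\<bar> + 1)\<^sup>2"
          using norm_triangle_ineq[of 1 "(z n)\<^sup>2"] power_mono[OF zb[of n] norm_ge_zero, of 2]
          unfolding norm_power norm_one by linarith
        ultimately show "d n * cmod (z n) + cmod (1 + (z n)\<^sup>2) \<le> C" by (simp add: C_def)
      qed simp
      finally show ?case .
    qed
    show "AE t in \<nu>. (\<lambda>n. g n t) \<longlonglongrightarrow> f t"
    proof (rule AE_I2)
      fix t
      have z: "z n = of_real x0 + \<i> * of_real (d n)" for n by (simp add: z_def complex_eq_iff)
      show "(\<lambda>n. g n t) \<longlonglongrightarrow> f t"
      proof (cases "t = x0")
        case True
        have "g n t = (1 + \<i> * of_real (d n) * of_real (x0 / (1 + x0\<^sup>2))) * s x0" for n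
          unfolding g_def herglotz_kernel_def z True using d[of n]
          by (simp add: divide_simps) (simp add: algebra_simps)
        moreover have "(\<lambda>n. (1 + \<i> * of_real (d n) * of_real (x0 / (1 + x0\<^sup>2))) * s x0) \<longlonglongrightarrow>
            (1 + \<i> * of_real 0 * of_real (x0 / (1 + x0\<^sup>2))) * s x0"
          by (intro tendsto_intros dlim)
        ultimately show ?thesis by (simp add: f_def True)
      next
        case False
        have "(\<lambda>n. - \<i> * of_real (d n) * ((1 / (of_real t - (of_real x0 + \<i> * of_real (d n))) - of_real (t / (1 + t\<^sup>2))) * s t))
           \<longlonglongrightarrow> - \<i> * of_real 0 * ((1 / (of_real t - (of_real x0 + \<i> * of_real 0)) - of_real (t / (1 + t\<^sup>2))) * s t)"
          by (intro tendsto_intros dlim) (use False in simp)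
        then show ?thesis using False by (simp add: f_def g_def herglotz_kernel_def z)
      qed
    qed
  qed
  moreover have "(LINT t|\<nu>. f t) = s x0 * of_real (measure \<nu> {x0})"
  proof -
    have "(LINT t|\<nu>. f t) = (LINT t:{x0}|\<nu>. s x0)" by (simp add: f_def set_lebesgue_integral_def)
    also have "\<dots> = measure \<nu> {x0} *\<^sub>R s x0"
      using finite_at_point[of x0] by (subst set_integral_const) auto
    finally show ?thesis by (simp add: scaleR_conv_of_real mult.commute)
  qed
  ultimately show ?thesis by (simp add: g_def z_def d_def)
qed

text \<open>Agreement of two complex set functions on Borel subsets of \<open>I\<close> is agreement
  of integrals of indicators. Induction over nonnegative measurable functions extends it to bounded
  weights, in particular to the Poisson kernel.\<close>

lemma set_integral_transfer:
  fixes s g :: "real \<Rightarrow> complex" and f :: "real \<Rightarrow> real"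
  assumes I: "I \<in> sets borel" and s: "set_integrable \<nu> I s" and g: "set_integrable lborel I g"
    and eq: "\<And>B. B \<in> sets borel \<Longrightarrow> B \<subseteq> I \<Longrightarrow> (LINT t:B|\<nu>. s t) = (LINT t:B|lborel. g t)"
    and f: "f \<in> borel_measurable borel" "\<And>x. 0 \<le> f x" "\<And>x. f x \<le> C"
  shows "(LINT t:I|\<nu>. f t *\<^sub>R s t) = (LINT t:I|lborel. f t *\<^sub>R g t)"
proof -
  have int: "set_integrable M I (\<lambda>t. f t *\<^sub>R h t)"
    if M: "sets M = sets borel" and h: "set_integrable M I h" and f: "f \<in> borel_measurable borel" "\<And>x. 0 \<le> f x" "\<And>x. f x \<le> C"
    for M and h :: "real \<Rightarrow> complex" and f C
    unfolding set_integrable_def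
  proof (rule Bochner_Integration.integrable_bound)
    show "integrable M (\<lambda>x. C *\<^sub>R (indicat_real I x *\<^sub>R h x))"
      using h unfolding set_integrable_def by (rule integrable_scaleR_right)
    have "(\<lambda>x. f x *\<^sub>R (indicat_real I x *\<^sub>R h x)) \<in> borel_measurable M"
    proof (rule borel_measurable_scaleR)
      show "f \<in> borel_measurable M" using f(1) M by (simp cong: measurable_cong_sets)
      show "(\<lambda>x. indicat_real I x *\<^sub>R h x) \<in> borel_measurable M"
        using h unfolding set_integrable_def by (rule borel_measurable_integrable)
    qed
    then show "(\<lambda>x. indicat_real I x *\<^sub>R f x *\<^sub>R h x) \<in> borel_measurable M"
      by (simp add: mult.commute)
    have "norm (indicat_real I x *\<^sub>R f x *\<^sub>R h x) \<le> norm (C *\<^sub>R (indicat_real I x *\<^sub>R h x))" for x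
      using f(2)[of x] f(3)[of x] by (auto simp: indicator_def intro!: mult_right_mono)
    then show "AE x in M. norm (indicat_real I x *\<^sub>R f x *\<^sub>R h x) \<le> norm (C *\<^sub>R (indicat_real I x *\<^sub>R h x))"
      by simp
  qed
  \<comment> \<open>Boundedness is part of the induction statement: summands and approximants are
    nonnegative and lie below the limit function, so they inherit a bound.\<close>
  have "(\<exists>C. \<forall>x. f x \<le> C) \<longrightarrow> (LINT t:I|\<nu>. f t *\<^sub>R s t) = (LINT t:I|lborel. f t *\<^sub>R g t)"
    using f(1,2)
  proof (induction rule: borel_measurable_induct_real)
    case (set A)
    have "(LINT t:I|M. indicat_real A t *\<^sub>R h t) = (LINT t:(A \<inter> I)|M. h t)" for M and h :: "real \<Rightarrow> complex"
      unfolding set_lebesgue_integral_def by (intro Bochner_Integration.integral_cong) (auto simp: indicator_def)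
    then show ?case using eq[of "A \<inter> I"] set I by simp
  next
    case (mult u c)
    show ?case
    proof (cases "c = 0")
      case False
      show ?thesis
      proof
        assume "\<exists>C. \<forall>x. c * u x \<le> C"
        then obtain C where "\<forall>x. c * u x \<le> C" by blast
        then have "\<forall>x. u x \<le> C / c" using False mult.hyps(1) by (simp add: field_simps)
        then have "(LINT t:I|\<nu>. u t *\<^sub>R s t) = (LINT t:I|lborel. u t *\<^sub>R g t)" using mult.IH by blast
        then show "(LINT t:I|\<nu>. (c * u t) *\<^sub>R s t) = (LINT t:I|lborel. (c * u t) *\<^sub>R g t)"
          by (simp only: scaleR_scaleR[symmetric] set_integral_scaleR_right)
      qed
    qed (simp add: set_lebesgue_integral_def)
  next
    case (add u v)
    show ?case
    proof
      assume "\<exists>C. \<forall>x. v x + u x \<le> C"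
      then obtain C where C: "\<And>x. v x + u x \<le> C" by blast
      have uv: "u x \<le> C" "v x \<le> C" for x using C[of x] add.hyps(2,4)[of x] by linarith+
      then have e: "(LINT t:I|\<nu>. u t *\<^sub>R s t) = (LINT t:I|lborel. u t *\<^sub>R g t)" "(LINT t:I|\<nu>. v t *\<^sub>R s t) = (LINT t:I|lborel. v t *\<^sub>R g t)"
        using add.IH by blast+
      have "(LINT t:I|M. (v t + u t) *\<^sub>R h t) = (LINT t:I|M. v t *\<^sub>R h t) + (LINT t:I|M. u t *\<^sub>R h t)"
        if "sets M = sets borel" "set_integrable M I h" for M and h :: "real \<Rightarrow> complex"
        unfolding scaleR_add_left
        by (rule set_integral_add[OF int[OF that add.hyps(3,4) uv(2)] int[OF that add.hyps(1,2) uv(1)]])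
      then show "(LINT t:I|\<nu>. (v t + u t) *\<^sub>R s t) = (LINT t:I|lborel. (v t + u t) *\<^sub>R g t)"
        using e s g by simp
    qed
  next
    case (seq U)
    show ?case
    proof
      assume "\<exists>C. \<forall>x. f x \<le> C"
      then obtain C where C: "\<And>x. f x \<le> C" by blast
      have Uf: "U i x \<le> f x" for i x
        using seq.hyps(3,4) by (intro incseq_le[of "\<lambda>i. U i x"]) (auto simp: incseq_def le_fun_def)
      then have UC: "U i x \<le> C" for i x using C order_trans by blast
      have lim: "(\<lambda>i. LINT t:I|M. U i t *\<^sub>R h t) \<longlonglongrightarrow> (LINT t:I|M. f t *\<^sub>R h t)"
        if M: "sets M = sets borel" "set_integrable M I h" for M and h :: "real \<Rightarrow> complex"
        unfolding set_lebesgue_integral_def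
      proof (rule integral_dominated_convergence)
        show "integrable M (\<lambda>x. norm (C *\<^sub>R (indicat_real I x *\<^sub>R h x)))"
          using M(2) unfolding set_integrable_def by (intro integrable_norm integrable_scaleR_right)
        show "(\<lambda>x. indicat_real I x *\<^sub>R f x *\<^sub>R h x) \<in> borel_measurable M"
          using int[OF M f(1,2) C] unfolding set_integrable_def by (rule borel_measurable_integrable)
        show "(\<lambda>x. indicat_real I x *\<^sub>R U i x *\<^sub>R h x) \<in> borel_measurable M" for i
          using int[OF M seq.hyps(1,2) UC] unfolding set_integrable_def by (rule borel_measurable_integrable)
        show "AE x in M. (\<lambda>i. indicat_real I x *\<^sub>R U i x *\<^sub>R h x) \<longlonglongrightarrow> indicat_real I x *\<^sub>R f x *\<^sub>R h x"
          using seq.hyps(4) by (intro AE_I2 tendsto_intros) auto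
        show "AE x in M. norm (indicat_real I x *\<^sub>R U i x *\<^sub>R h x) \<le> norm (C *\<^sub>R (indicat_real I x *\<^sub>R h x))" for i
          using seq.hyps(2) UC[of i] order_trans[OF seq.hyps(2) UC]
          by (intro AE_I2) (auto simp: indicator_def intro!: mult_right_mono)
      qed
      have "(LINT t:I|\<nu>. U i t *\<^sub>R s t) = (LINT t:I|lborel. U i t *\<^sub>R g t)" for i
        using seq.IH UC by blast
      then show "(LINT t:I|\<nu>. f t *\<^sub>R s t) = (LINT t:I|lborel. f t *\<^sub>R g t)"
        using lim[OF sets_nu s] lim[OF sets_lborel g] LIMSEQ_unique by simp
    qed
  qed
  then show ?thesis using f(3) by blast
qed

end

section \<open>The Poisson kernel\<close>

definition poisson_kernel :: "real \<Rightarrow> real \<Rightarrow> real \<Rightarrow> real" where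
  "poisson_kernel x d t = d / ((t - x)\<^sup>2 + d\<^sup>2)"

lemma poisson_kernel_bounds:
  assumes "d > 0"
  shows "0 \<le> poisson_kernel x d t" "poisson_kernel x d t \<le> 1 / d"
proof -
  have "d\<^sup>2 > 0" "(t - x)\<^sup>2 + d\<^sup>2 \<ge> d\<^sup>2" using assms by simp_all
  then have "d / ((t - x)\<^sup>2 + d\<^sup>2) \<le> d / d\<^sup>2" using assms by (intro divide_left_mono mult_pos_pos add_nonneg_pos) auto
  then show "poisson_kernel x d t \<le> 1 / d" using assms by (simp add: poisson_kernel_def power2_eq_square)
  show "0 \<le> poisson_kernel x d t" using assms by (simp add: poisson_kernel_def)
qed

lemma poisson_kernel_measurable [measurable]: "poisson_kernel x d \<in> borel_measurable borel"
  unfolding poisson_kernel_def[abs_def] by measurable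

text \<open>The regularising term of the Herglotz kernel is real and drops out of the
  difference.\<close>

lemma poisson_kernel_eq:
  assumes d: "d > 0"
  shows "2 * \<i> * of_real (poisson_kernel x d t) = herglotz_kernel (Complex x d) t - cnj (herglotz_kernel (Complex x d) t)"
proof -
  define w where "w = of_real t - Complex x d"
  have w: "w = of_real (t - x) - \<i> * of_real d" by (simp add: w_def complex_eq_iff)
  have nz: "w \<noteq> 0" using d by (simp add: w complex_eq_iff)
  have "herglotz_kernel (Complex x d) t - cnj (herglotz_kernel (Complex x d) t) = 1 / w - 1 / cnj w"
    by (simp add: herglotz_kernel_def w_def)
  also have "\<dots> = (cnj w - w) / (w * cnj w)" using nz by (simp add: divide_simps)
  also have "cnj w - w = 2 * \<i> * of_real d" by (simp add: w)
  also have "w * cnj w = of_real ((t - x)\<^sup>2 + d\<^sup>2)"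
    by (simp add: w power2_eq_square algebra_simps)
  finally show ?thesis by (simp add: poisson_kernel_def)
qed

lemma poisson_kernel_tail:
  assumes d: "d > 0" and r: "r > 0" and t: "\<bar>t - x\<bar> \<ge> r"
  shows "poisson_kernel x d t \<le> d * (2 + (1 + 2 * x\<^sup>2) / r\<^sup>2) * (1 / (1 + t\<^sup>2))"
proof -
  define C where "C = 2 + (1 + 2 * x\<^sup>2) / r\<^sup>2"
  have tx: "(t - x)\<^sup>2 \<ge> r\<^sup>2" using power_mono[OF t, of 2] r by simp
  then have tx0: "(t - x)\<^sup>2 > 0" using r by (smt (verit) zero_less_power)
  have pos: "1 + t\<^sup>2 > 0" by (simp add: add_pos_nonneg)
  \<comment> \<open>Expanded, this is t^2 <= 2 (t - x)^2 + 2 x^2, which trades the weight 1 + t^2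
    for (t - x)^2 away from x.\<close>
  have "0 \<le> (t - 2 * x)\<^sup>2" by simp
  then have t2: "t\<^sup>2 \<le> 2 * (t - x)\<^sup>2 + 2 * x\<^sup>2" by (simp add: power2_eq_square algebra_simps)
  have "1 + 2 * x\<^sup>2 \<le> (1 + 2 * x\<^sup>2) / r\<^sup>2 * (t - x)\<^sup>2"
  proof -
    have "(1 + 2 * x\<^sup>2) / r\<^sup>2 * r\<^sup>2 \<le> (1 + 2 * x\<^sup>2) / r\<^sup>2 * (t - x)\<^sup>2"
      using tx by (intro mult_left_mono) auto
    then show ?thesis using r by simp
  qed
  with t2 have "1 + t\<^sup>2 \<le> C * (t - x)\<^sup>2" by (simp add: C_def distrib_right)
  then have le: "1 / (t - x)\<^sup>2 \<le> C * (1 / (1 + t\<^sup>2))" using tx0 pos by (simp add: field_simps)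
  have "poisson_kernel x d t \<le> d / (t - x)\<^sup>2"
    unfolding poisson_kernel_def using d tx0 by (intro divide_left_mono mult_pos_pos add_nonneg_pos) auto
  also have "\<dots> = d * (1 / (t - x)\<^sup>2)" by simp
  also have "\<dots> \<le> d * (C * (1 / (1 + t\<^sup>2)))" using d by (intro mult_left_mono le) simp
  finally show ?thesis by (simp add: C_def)
qed

text \<open>arctan ((t - x) / d) is a primitive. The kernel is not divided by pi, so its mass near x
  tends to pi as d decreases to 0.\<close>

lemma poisson_kernel_mass:
  assumes d: "d > 0" and r: "r > 0"
  shows "set_integrable lborel {x-r..x+r} (poisson_kernel x d)"
    "(LINT t:{x-r..x+r}|lborel. poisson_kernel x d t) = 2 * arctan (r / d)"
proof -
  have der: "((\<lambda>t. arctan ((t - x) / d)) has_real_derivative poisson_kernel x d t) (at t)" for t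
  proof -
    have "((\<lambda>t. arctan ((t - x) / d)) has_real_derivative (1 / d) * inverse (1 + ((t - x) / d)\<^sup>2)) (at t)"
      using d by (auto intro!: derivative_eq_intros)
    moreover have "(1 / d) * inverse (1 + ((t - x) / d)\<^sup>2) = poisson_kernel x d t"
    proof -
      have "1 + ((t - x) / d)\<^sup>2 = ((t - x)\<^sup>2 + d\<^sup>2) / d\<^sup>2" using d by (simp add: power_divide add_divide_distrib)
      then show ?thesis using d by (simp add: poisson_kernel_def power2_eq_square)
    qed
    ultimately show ?thesis by simp
  qed
  have le: "x - r \<le> x + r" using r by simp
  note F = integral_FTC_Icc_nonneg[OF poisson_kernel_measurable der poisson_kernel_bounds(1)[OF d] le]
    integrable_FTC_Icc_nonneg[OF poisson_kernel_measurable der poisson_kernel_bounds(1)[OF d] le]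
  show "set_integrable lborel {x-r..x+r} (poisson_kernel x d)"
    using F(2) by (simp add: set_integrable_def mult.commute)
  have "arctan (- r / d) = - arctan (r / d)" by (simp add: arctan_minus)
  then show "(LINT t:{x-r..x+r}|lborel. poisson_kernel x d t) = 2 * arctan (r / d)"
    using F(1) by (simp add: set_lebesgue_integral_def mult.commute)
qed

section \<open>Boundary values of Poisson integrals\<close>

context herglotz_measure
begin

lemma integrable_poisson:
  assumes d: "d > 0" and s: "s \<in> borel_measurable borel" "AE t in \<nu>. cmod (s t) \<le> 1"
  shows "integrable \<nu> (\<lambda>t. poisson_kernel x d t *\<^sub>R s t)"
proof (rule integrable_dominated)
  let ?C = "(cmod (Complex x d) + cmod (1 + (Complex x d)\<^sup>2) / \<bar>Im (Complex x d)\<bar>)"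
  show "(\<lambda>t. poisson_kernel x d t *\<^sub>R s t) \<in> borel_measurable borel" using s(1) by measurable
  have "poisson_kernel x d t \<le> ?C * (1 / (1 + t\<^sup>2))" for t
  proof -
    have "2 * poisson_kernel x d t = cmod (2 * \<i> * of_real (poisson_kernel x d t))"
      using poisson_kernel_bounds(1)[OF d, of x t] by (simp add: norm_mult)
    also have "\<dots> \<le> 2 * cmod (herglotz_kernel (Complex x d) t)"
      unfolding poisson_kernel_eq[OF d] by (rule order_trans[OF norm_triangle_ineq4]) simp
    finally show ?thesis using herglotz_kernel_bound[of "Complex x d" t] d by simp
  qed
  then have bd: "cmod (poisson_kernel x d t *\<^sub>R s t) \<le> ?C * (1 / (1 + t\<^sup>2))" if "cmod (s t) \<le> 1" for t
    using mult_left_mono[OF that poisson_kernel_bounds(1)[OF d, of x t]] poisson_kernel_bounds(1)[OF d, of x t]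
    by (simp add: order_trans)
  show "AE t in \<nu>. cmod (poisson_kernel x d t *\<^sub>R s t) \<le> ?C * (1 / (1 + t\<^sup>2))"
    using s(2) by eventually_elim (rule bd)
qed

text \<open>The density \<open>g\<close> is known near x only. Outside a small interval the integral
  is of order d by the tail bound; inside, \<open>s\<close> with respect to \<open>\<nu>\<close> is
  exchanged for \<open>g\<close> with respect to Lebesgue measure, and continuity of
  \<open>g\<close> compares the result with g(x) times the mass of the kernel.\<close>

lemma poisson_limit:
  fixes s g :: "real \<Rightarrow> complex"
  assumes s: "s \<in> borel_measurable borel" "AE t in \<nu>. cmod (s t) \<le> 1" and r0: "r0 > 0"
    and g: "continuous_on {x-r0..x+r0} g"
    and eq: "\<And>B. B \<in> sets borel \<Longrightarrow> B \<subseteq> {x-r0..x+r0} \<Longrightarrow> (LINT t:B|\<nu>. s t) = (LINT t:B|lborel. g t)"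
  shows "((\<lambda>d. LINT t|\<nu>. poisson_kernel x d t *\<^sub>R s t) \<longlongrightarrow> of_real pi * g x) (at_right 0)"
proof (rule tendstoI)
  fix e :: real assume e: "e > 0"
  \<comment> \<open>The mass of the kernel is below pi, hence below 4, so the variation of
    \<open>g\<close> costs at most e / 2; the tail and the defect of the mass take less than e / 4
    each.\<close>
  define \<eta> where "\<eta> = e / 8"
  have eta: "\<eta> > 0" using e by (simp add: \<eta>_def)
  have "x \<in> {x-r0..x+r0}" using r0 by simp
  then obtain r1 where r1: "r1 > 0" "\<And>t. t \<in> {x-r0..x+r0} \<Longrightarrow> dist t x < r1 \<Longrightarrow> dist (g t) (g x) < \<eta>"
    using g eta unfolding continuous_on_iff by blast
  define r where "r = min r0 (r1 / 2)"
  have r: "r > 0" "r \<le> r0" "r < r1" using r0 r1(1) by (auto simp: r_def)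
  define I where "I = {x-r..x+r}"
  have I: "I \<in> sets borel" "I \<subseteq> {x-r0..x+r0}" using r by (auto simp: I_def)
  have gI: "cmod (g t - g x) \<le> \<eta>" if "t \<in> I" for t
  proof -
    have "t \<in> {x-r0..x+r0}" "dist t x < r1" using that r by (auto simp: I_def dist_real_def abs_le_iff)
    then show ?thesis using r1(2)[of t] by (simp add: dist_norm)
  qed
  have gint: "set_integrable lborel I g"
    unfolding I_def by (rule borel_integrable_atLeastAtMost') (use g I in \<open>auto simp: I_def intro: continuous_on_subset\<close>)
  have sint: "set_integrable \<nu> I s"
    by (rule bounded_integrable[OF s I(1), where a = "x - r" and b = "x + r"]) (simp add: I_def)
  define C where "C = 2 + (1 + 2 * x\<^sup>2) / r\<^sup>2"
  define J where "J = (LINT t|\<nu>. 1 / (1 + t\<^sup>2))"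
  have rd: "filterlim (\<lambda>d. r / d) at_top (at_right 0)"
    unfolding divide_inverse
    by (rule filterlim_tendsto_pos_mult_at_top[OF tendsto_const r(1) filterlim_inverse_at_top_right])
  have "((\<lambda>d. arctan (r / d)) \<longlongrightarrow> pi / 2) (at_right 0)"
    by (rule filterlim_compose[OF tendsto_arctan_at_top rd])
  then have "((\<lambda>d. cmod (g x) * \<bar>2 * arctan (r / d) - pi\<bar>) \<longlongrightarrow> cmod (g x) * \<bar>2 * (pi / 2) - pi\<bar>) (at_right 0)"
    by (intro tendsto_intros)
  then have ev1: "\<forall>\<^sub>F d in at_right 0. cmod (g x) * \<bar>2 * arctan (r / d) - pi\<bar> < e / 4"
    using e by (intro order_tendstoD(2)) auto
  have "((\<lambda>d. d * C * J) \<longlongrightarrow> 0 * C * J) (at_right 0)" by (intro tendsto_intros)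
  then have ev2: "\<forall>\<^sub>F d in at_right 0. d * C * J < e / 4" using e by (intro order_tendstoD(2)) auto
  have ev3: "\<forall>\<^sub>F d in at_right 0. d > (0::real)" by (simp add: eventually_at_right_less)
  show "\<forall>\<^sub>F d in at_right 0. dist (LINT t|\<nu>. poisson_kernel x d t *\<^sub>R s t) (of_real pi * g x) < e"
    using ev1 ev2 ev3
  proof eventually_elim
    case (elim d)
    then have d: "d > 0" by simp
    let ?P = "poisson_kernel x d"
    note P = poisson_kernel_bounds[OF d, of x]
    have int: "integrable \<nu> (\<lambda>t. ?P t *\<^sub>R s t)" by (rule integrable_poisson[OF d s])
    have intI: "integrable \<nu> (\<lambda>t. indicat_real B t *\<^sub>R (?P t *\<^sub>R s t))" if "B \<in> sets borel" for B
      by (rule integrable_mult_indicator[OF _ int]) (use that in simp)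
    have "(LINT t|\<nu>. ?P t *\<^sub>R s t) = (LINT t|\<nu>. indicat_real I t *\<^sub>R (?P t *\<^sub>R s t) + indicat_real (- I) t *\<^sub>R (?P t *\<^sub>R s t))"
      by (intro Bochner_Integration.integral_cong) (auto simp: indicator_def)
    also have "\<dots> = (LINT t|\<nu>. indicat_real I t *\<^sub>R (?P t *\<^sub>R s t)) + (LINT t|\<nu>. indicat_real (- I) t *\<^sub>R (?P t *\<^sub>R s t))"
      using intI[OF I(1)] intI[of "- I"] I(1) by (intro Bochner_Integration.integral_add) auto
    finally have split: "(LINT t|\<nu>. ?P t *\<^sub>R s t) = (LINT t:I|\<nu>. ?P t *\<^sub>R s t) + (LINT t:-I|\<nu>. ?P t *\<^sub>R s t)"
      by (simp add: set_lebesgue_integral_def)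
    have out: "cmod (LINT t:-I|\<nu>. ?P t *\<^sub>R s t) \<le> d * C * J"
    proof -
      have "cmod (LINT t:-I|\<nu>. ?P t *\<^sub>R s t) \<le> (LINT t|\<nu>. norm (indicat_real (- I) t *\<^sub>R (?P t *\<^sub>R s t)))"
        unfolding set_lebesgue_integral_def by (rule integral_norm_bound)
      also have "\<dots> \<le> (LINT t|\<nu>. (d * C) * (1 / (1 + t\<^sup>2)))"
      proof (rule integral_mono_AE)
        show "integrable \<nu> (\<lambda>t. norm (indicat_real (- I) t *\<^sub>R (?P t *\<^sub>R s t)))"
          by (rule integrable_norm[OF intI]) (use I(1) in auto)
        show "integrable \<nu> (\<lambda>t. (d * C) * (1 / (1 + t\<^sup>2)))" using int_nu by (rule integrable_mult_right)
        show "AE t in \<nu>. norm (indicat_real (- I) t *\<^sub>R (?P t *\<^sub>R s t)) \<le> (d * C) * (1 / (1 + t\<^sup>2))"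
          using s(2)
        proof eventually_elim
          case (elim t)
          show ?case
          proof (cases "t \<in> I")
            case True
            have "0 \<le> C" using r by (simp add: C_def)
            then show ?thesis using True d by simp
          next
            case False
            then have "\<bar>t - x\<bar> \<ge> r" by (auto simp: I_def)
            then have "?P t \<le> d * C * (1 / (1 + t\<^sup>2))" unfolding C_def by (rule poisson_kernel_tail[OF d r(1)])
            moreover have "?P t * cmod (s t) \<le> ?P t * 1" using elim P(1) by (intro mult_left_mono) auto
            ultimately show ?thesis using False P(1)[of t] by simp
          qed
        qed
      qed
      also have "\<dots> = d * C * J" unfolding J_def by (rule integral_mult_right_zero)
      finally show ?thesis .
    qed
    have inn: "(LINT t:I|\<nu>. ?P t *\<^sub>R s t) = (LINT t:I|lborel. ?P t *\<^sub>R g t)"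
      by (rule set_integral_transfer[OF I(1) sint gint _ _ P]) (use eq I in auto)
    have Pint: "set_integrable lborel I ?P" "(LINT t:I|lborel. ?P t) = 2 * arctan (r / d)"
      unfolding I_def by (rule poisson_kernel_mass[OF d r(1)])+
    have Pgx: "set_integrable lborel I (\<lambda>t. ?P t *\<^sub>R g x)"
      using Pint(1) by (rule set_integrable_scaleR_left)
    have Pg: "set_integrable lborel I (\<lambda>t. ?P t *\<^sub>R (g t - g x))"
      unfolding set_integrable_def
    proof (rule Bochner_Integration.integrable_bound)
      show "integrable lborel (\<lambda>t. indicat_real I t *\<^sub>R (?P t * \<eta>))"
        using Pint(1) unfolding set_integrable_def by (simp add: mult.assoc[symmetric])
      have "(\<lambda>t. indicat_real I t *\<^sub>R g t) \<in> borel_measurable lborel"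
        using gint unfolding set_integrable_def by (rule borel_measurable_integrable)
      then have "(\<lambda>t. ?P t *\<^sub>R (indicat_real I t *\<^sub>R g t - indicat_real I t *\<^sub>R g x)) \<in> borel_measurable lborel"
        using I(1) by measurable
      then show "(\<lambda>t. indicat_real I t *\<^sub>R ?P t *\<^sub>R (g t - g x)) \<in> borel_measurable lborel"
        by (simp add: algebra_simps)
      show "AE t in lborel. norm (indicat_real I t *\<^sub>R ?P t *\<^sub>R (g t - g x)) \<le> norm (indicat_real I t *\<^sub>R (?P t * \<eta>))"
        using gI P(1) eta by (intro AE_I2) (auto simp: indicator_def abs_mult intro: mult_left_mono)
    qed
    have "(LINT t:I|lborel. ?P t *\<^sub>R g t) = (LINT t:I|lborel. ?P t *\<^sub>R (g t - g x) + ?P t *\<^sub>R g x)"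
      by (simp add: scaleR_diff_right)
    also have "\<dots> = (LINT t:I|lborel. ?P t *\<^sub>R (g t - g x)) + (LINT t:I|lborel. ?P t *\<^sub>R g x)"
      by (rule set_integral_add(2)[OF Pg Pgx])
    also have "(LINT t:I|lborel. ?P t *\<^sub>R g x) = (2 * arctan (r / d)) *\<^sub>R g x"
      unfolding Pint(2)[symmetric] set_lebesgue_integral_def scaleR_scaleR[symmetric]
      using integral_scaleR_left[of "g x" lborel "\<lambda>t. indicat_real I t *\<^sub>R ?P t"] Pint(1)
      by (simp add: set_integrable_def)
    finally have 1: "(LINT t:I|lborel. ?P t *\<^sub>R g t) = (LINT t:I|lborel. ?P t *\<^sub>R (g t - g x)) + (2 * arctan (r / d)) *\<^sub>R g x" .
    have 2: "cmod (LINT t:I|lborel. ?P t *\<^sub>R (g t - g x)) \<le> e / 2"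
    proof -
      have "cmod (LINT t:I|lborel. ?P t *\<^sub>R (g t - g x)) \<le> (LINT t:I|lborel. norm (?P t *\<^sub>R (g t - g x)))"
        by (rule set_integral_norm_bound[OF Pg])
      also have "\<dots> \<le> (LINT t:I|lborel. ?P t * \<eta>)"
      proof (rule set_integral_mono)
        show "set_integrable lborel I (\<lambda>t. norm (?P t *\<^sub>R (g t - g x)))" by (rule set_integrable_norm[OF Pg])
        show "set_integrable lborel I (\<lambda>t. ?P t * \<eta>)" using Pint(1) by simp
        show "norm (?P t *\<^sub>R (g t - g x)) \<le> ?P t * \<eta>" if "t \<in> I" for t
          using gI[OF that] P(1)[of t] by (simp add: mult_left_mono)
      qed
      also have "\<dots> = 2 * arctan (r / d) * \<eta>" using Pint(2) by simp
      also have "\<dots> \<le> 4 * \<eta>"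
      proof (rule mult_right_mono)
        show "2 * arctan (r / d) \<le> 4" using arctan_ubound[of "r / d"] pi_less_4 by simp
      qed (use eta in simp)
      finally show ?thesis by (simp add: \<eta>_def)
    qed
    have 3: "cmod ((2 * arctan (r / d)) *\<^sub>R g x - of_real pi * g x) < e / 4"
    proof -
      have "(2 * arctan (r / d)) *\<^sub>R g x - of_real pi * g x = (2 * arctan (r / d) - pi) *\<^sub>R g x"
        by (simp add: scaleR_conv_of_real algebra_simps)
      then show ?thesis using elim(1) by (simp add: mult.commute)
    qed
    have "(LINT t|\<nu>. ?P t *\<^sub>R s t) - of_real pi * g x = (LINT t:-I|\<nu>. ?P t *\<^sub>R s t)
        + (LINT t:I|lborel. ?P t *\<^sub>R (g t - g x)) + ((2 * arctan (r / d)) *\<^sub>R g x - of_real pi * g x)"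
      unfolding split inn 1 by simp
    also have "cmod \<dots> \<le> cmod (LINT t:-I|\<nu>. ?P t *\<^sub>R s t) + cmod (LINT t:I|lborel. ?P t *\<^sub>R (g t - g x))
       + cmod ((2 * arctan (r / d)) *\<^sub>R g x - of_real pi * g x)"
      by (rule order_trans[OF norm_triangle_ineq add_right_mono[OF norm_triangle_ineq]])
    also have "\<dots> < e" using out 2 3 elim(2) by linarith
    finally show ?case by (simp add: dist_norm)
  qed
qed

end

section \<open>The limit at an eigenvalue\<close>

lemma cauchy_sol_scale:
  assumes "cauchy_sol q z F D" shows "cauchy_sol q z (\<lambda>x. a *s F x) (\<lambda>x. a *s D x)"
  using cauchy_sol_lin[OF assms assms, of a 0] by simp

lemma decays_scale:
  assumes "decays F D" shows "decays (\<lambda>x. a *s F x) (\<lambda>x. a *s D x)"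
  using decays_lin[OF assms assms, of a 0] by simp

context potential
begin

text \<open>With vanishing boundary data the flux of F_{+i} at 0 would be zero.\<close>

lemma jost_plus_boundary_nonzero:
  assumes k: "k > 0" and Fp: "jost_plus_i q k Fp"
  shows "bd_data_perp \<alpha> (Fp 0) (hl_deriv Fp 0) \<noteq> 0"
proof
  assume "bd_data_perp \<alpha> (Fp 0) (hl_deriv Fp 0) = 0"
  then have "wronskian (\<lambda>x. dag (Fp x)) (\<lambda>x. dag (hl_deriv Fp x)) Fp (hl_deriv Fp) 0 = 0"
    unfolding wronskian_boundary[where \<alpha> = \<alpha>] bd_data_perp_dag by simp
  then show False using wronskian_dag_jost_plus[OF k Fp] k by simp
qed

text \<open>
  At an eigenvalue the Weyl solution, multiplied by the distance to the real axis, converges to a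
  multiple of the eigenfunction.  The direction of the limit comes from the Wronskian with
  the outgoing solution, and the factor from integrating the Wronskian with the eigenfunction.
\<close>

lemma weyl_matrix_eigenvalue_limit:
  fixes \<sigma>1 \<sigma>2 :: complex
  assumes k: "k > 0" and Fp: "jost_plus_i q k Fp" and Fm: "jost_minus1 q k Fm" and e: "scalar_jost q k e"
    and bc: "bd_data_perp \<alpha> (Fm 0) (hl_deriv Fm 0) = 0"
    and M: "\<And>z. z \<notin> \<real> \<Longrightarrow> weyl_matrix q \<alpha> z (M z)"
    and lim1: "(\<lambda>n. of_real (1 / real (Suc n)) * M (Complex (k\<^sup>2) (1 / real (Suc n))) $ 1 $ 1) \<longlonglongrightarrow> \<i> * \<sigma>1"
    and lim2: "(\<lambda>n. of_real (1 / real (Suc n)) * M (Complex (k\<^sup>2) (1 / real (Suc n))) $ 2 $ 1) \<longlonglongrightarrow> \<i> * \<sigma>2"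
  defines "l \<equiv> bd_ell \<alpha> e" and "E \<equiv> (LINT x:{0<..}|lebesgue. (cmod (e x))\<^sup>2)"
  shows "l \<noteq> 0" "2 * of_real E * \<sigma>1 = l * cnj l" "cnj l * \<sigma>2 = - l * \<sigma>1"
proof -
  let ?Dp = "hl_deriv Fp" and ?Dm = "hl_deriv Fm"
  note F = jost_minus_asymptotics[OF k Fm]
  have P: "outgoing q k Fp ?Dp" by (rule jost_plus_outgoing[OF k Fp])
  have Ps: "cauchy_sol q (of_real (k\<^sup>2)) Fp ?Dp" using P by (simp add: outgoing_def)
  obtain Bp where Bp: "\<And>x. x \<ge> 0 \<Longrightarrow> data_norm (Fp x) (?Dp x) \<le> Bp" using P by (auto simp: outgoing_def)
  obtain Bm where Bm: "\<And>x. x \<ge> 0 \<Longrightarrow> data_norm (Fm x) (?Dm x) \<le> Bm"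
    using decays_outgoing[OF F(3,2)] by (auto simp: outgoing_def)
  have Fme: "Fm x = jost_pair e x" if "x \<ge> 0" for x by (rule jost_minus_eq_scalar(1)[OF k Fm e that])
  have Lm: "bd_data \<alpha> (Fm 0) (?Dm 0) $ 1 = cnj l" "bd_data \<alpha> (Fm 0) (?Dm 0) $ 2 = - l"
    unfolding jost_minus_eq_scalar[OF k Fm e order_refl] jost_pair_boundary by (simp_all add: l_def vector_2)
  show l0: "l \<noteq> 0"
  proof
    assume "l = 0"
    then have "data_norm (Fm 0) (?Dm 0) \<le> 0"
      using data_norm_boundary[of "Fm 0" "?Dm 0" \<alpha>] bc Lm by simp
    then show False using jost_minus_nonzero[OF k Fm] data_norm_nonneg[of "Fm 0" "?Dm 0"] by simp
  qed
  define d :: "nat \<Rightarrow> real" where "d n = 1 / real (Suc n)" for n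
  have d: "d n > 0" "d n \<le> 1" for n by (simp_all add: d_def)
  have dlim: "d \<longlonglongrightarrow> 0" unfolding d_def by (rule LIMSEQ_Suc[OF lim_1_over_n])
  define z where "z n = Complex (k\<^sup>2) (d n)" for n
  have z: "z n \<notin> \<real>" "Im (z n) \<ge> 0" for n using d[of n] by (auto simp: z_def complex_is_Real_iff)
  have zd: "z n - of_real (k\<^sup>2) = \<i> * of_real (d n)" for n by (simp add: z_def complex_eq_iff)
  have zn: "cmod (z n - of_real (k\<^sup>2)) = d n" for n unfolding zd using d[of n] by (simp add: norm_mult)
  have "\<exists>Y D. cauchy_sol q (z n) Y D \<and> decays Y D \<and> bd_data \<alpha> (Y 0) (D 0) = column 1 (M (z n)) \<and> bd_data_perp \<alpha> (Y 0) (D 0) = column 1 eps_mat" for n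
    using weyl_column[OF M[OF z(1)[of n]], of 1] by metis
  then obtain Y DY where Y: "\<And>n. cauchy_sol q (z n) (Y n) (DY n)" "\<And>n. decays (Y n) (DY n)"
    "\<And>n. bd_data \<alpha> (Y n 0) (DY n 0) = column 1 (M (z n))" "\<And>n. bd_data_perp \<alpha> (Y n 0) (DY n 0) = column 1 eps_mat"
    by metis
  \<comment> \<open>Multiplication by the distance d to the real axis compensates the simple pole:
    the boundary data of \<open>G n\<close> tend to (i \<sigma>1, i \<sigma>2) in one half and to 0
    in the other.\<close>
  define G where "G n x = of_real (d n) *s Y n x" for n x
  define D where "D n x = of_real (d n) *s DY n x" for n x
  have G: "cauchy_sol q (z n) (G n) (D n)" "decays (G n) (D n)" for n
    using cauchy_sol_scale[OF Y(1)[of n], of "of_real (d n)"] decays_scale[OF Y(2)[of n], of "of_real (d n)"]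
    by (simp_all add: G_def[abs_def] D_def[abs_def])
  have LVG: "bd_data \<alpha> (G n 0) (D n 0) $ i = of_real (d n) * M (z n) $ i $ 1" for n i
    using bd_data_lin[of \<alpha> "of_real (d n)" "Y n 0" 0 0 "DY n 0" 0] by (simp add: G_def D_def Y(3) column_def)
  have LPG: "bd_data_perp \<alpha> (G n 0) (D n 0) $ 1 = 0" "bd_data_perp \<alpha> (G n 0) (D n 0) $ 2 = of_real (d n)" for n
    using bd_data_perp_lin[of \<alpha> "of_real (d n)" "Y n 0" 0 0 "DY n 0" 0] by (simp_all add: G_def D_def Y(4) column_def eps_mat_def vector_2)
  have L1: "(\<lambda>n. bd_data \<alpha> (G n 0) (D n 0) $ 1) \<longlonglongrightarrow> \<i> * \<sigma>1" and L2: "(\<lambda>n. bd_data \<alpha> (G n 0) (D n 0) $ 2) \<longlonglongrightarrow> \<i> * \<sigma>2"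
    unfolding LVG z_def d_def by (rule lim1 lim2)+
  have dlim': "(\<lambda>n. complex_of_real (d n)) \<longlonglongrightarrow> 0" using tendsto_of_real[OF dlim] by simp
  define b where "b n = 2 * (cmod (bd_data \<alpha> (G n 0) (D n 0) $ 1) + cmod (bd_data \<alpha> (G n 0) (D n 0) $ 2) + 0 + d n)" for n
  have "b \<longlonglongrightarrow> 2 * (cmod (\<i> * \<sigma>1) + cmod (\<i> * \<sigma>2) + 0 + 0)"
    unfolding b_def by (intro tendsto_intros L1 L2 dlim)
  then have "Bseq b" by (rule convergent_imp_Bseq[OF convergentI])
  then obtain B0 where B0: "B0 > 0" "\<And>n. norm (b n) \<le> B0" by (auto elim: BseqE)
  have N: "data_norm (G n 0) (D n 0) \<le> B0" for n
    using data_norm_boundary[of "G n 0" "D n 0" \<alpha>] B0(2)[of n] d[of n] unfolding LPG b_def by simp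
  have W1: "(\<lambda>n. wronskian Fp ?Dp (G n) (D n) 0) \<longlonglongrightarrow> 0"
  proof (rule tendstoI)
    fix \<epsilon> :: real assume \<epsilon>: "\<epsilon> > 0"
    define \<eta> where "\<eta> = \<epsilon> / (2 * B0)"
    have \<eta>: "\<eta> > 0" using \<epsilon> B0(1) by (simp add: \<eta>_def)
    obtain \<rho> where \<rho>: "\<rho> > 0" "\<And>z F D. cmod (z - of_real (k\<^sup>2)) < \<rho> \<Longrightarrow> Im z \<ge> 0 \<Longrightarrow> cauchy_sol q z F D \<Longrightarrow> decays F D \<Longrightarrow>
       cmod (wronskian Fp ?Dp F D 0) \<le> \<eta> * data_norm (F 0) (D 0)"
      using wronskian_outgoing_small[OF k P \<eta>] by blast
    have "\<forall>\<^sub>F n in sequentially. d n < \<rho>" using dlim \<rho>(1) by (rule order_tendstoD)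
    then show "\<forall>\<^sub>F n in sequentially. dist (wronskian Fp ?Dp (G n) (D n) 0) 0 < \<epsilon>"
    proof eventually_elim
      case (elim n)
      then have "cmod (wronskian Fp ?Dp (G n) (D n) 0) \<le> \<eta> * data_norm (G n 0) (D n 0)"
        by (intro \<rho>(2)[OF _ z(2)[of n] G]) (simp only: zn)
      also have "\<dots> \<le> \<eta> * B0" using N \<eta> by (intro mult_left_mono) auto
      also have "\<dots> < \<epsilon>" using \<epsilon> B0(1) by (simp add: \<eta>_def)
      finally show ?case by simp
    qed
  qed
  define p r where "p = bd_data_perp \<alpha> (Fp 0) (?Dp 0)" and "r = bd_data \<alpha> (Fp 0) (?Dp 0)"
  have W2: "(\<lambda>n. wronskian Fp ?Dp (G n) (D n) 0) \<longlonglongrightarrow> p $ 1 * (\<i> * \<sigma>1) + p $ 2 * (\<i> * \<sigma>2) - r $ 1 * 0 - r $ 2 * 0"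
    unfolding wronskian_boundary[where \<alpha> = \<alpha>] LPG p_def r_def by (intro tendsto_intros L1 L2 dlim')
  have "p $ 1 * (\<i> * \<sigma>1) + p $ 2 * (\<i> * \<sigma>2) - r $ 1 * 0 - r $ 2 * 0 = 0"
    by (rule LIMSEQ_unique[OF W2 W1])
  then have "\<i> * (p $ 1 * \<sigma>1 + p $ 2 * \<sigma>2) = 0" by (simp add: algebra_simps)
  then have p\<sigma>: "p $ 1 * \<sigma>1 + p $ 2 * \<sigma>2 = 0" by simp
  have "wronskian Fp ?Dp Fm ?Dm 0 = 0" by (rule wronskian_bounded_decays[OF Ps Bp F(3,2)])
  then have pl: "p $ 1 * cnj l = p $ 2 * l"
    unfolding wronskian_boundary[where \<alpha> = \<alpha>] bc Lm by (simp add: p_def)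
  have "p \<noteq> 0" unfolding p_def by (rule jost_plus_boundary_nonzero[OF k Fp])
  then have p2: "p $ 2 \<noteq> 0" using pl l0 by (auto simp: vec_eq_iff forall_2)
  \<comment> \<open>Both (\<sigma>1, \<sigma>2) and the boundary data (conj l, -l) of F_{-1} are
    annihilated by the nonzero vector \<open>p\<close>, hence they are parallel; p1 is
    eliminated.\<close>
  have "p $ 2 * (cnj l * \<sigma>2 + l * \<sigma>1) = cnj l * (p $ 1 * \<sigma>1 + p $ 2 * \<sigma>2) - \<sigma>1 * (p $ 1 * cnj l - p $ 2 * l)"
    by (simp add: algebra_simps)
  then have "p $ 2 * (cnj l * \<sigma>2 + l * \<sigma>1) = 0" unfolding p\<sigma> pl by simp
  then have "cnj l * \<sigma>2 + l * \<sigma>1 = 0" using p2 by simp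
  then show s2: "cnj l * \<sigma>2 = - l * \<sigma>1" by (simp add: eq_neg_iff_add_eq_0)
  \<comment> \<open>The factor for which c F_{-1} has the limiting boundary data; \<open>H\<close>
    below is the limit of \<open>G n\<close>.\<close>
  define c where "c = \<i> * \<sigma>1 / cnj l"
  have c: "\<i> * \<sigma>1 - c * cnj l = 0" "\<i> * \<sigma>2 + c * l = 0"
  proof -
    show "\<i> * \<sigma>1 - c * cnj l = 0" using l0 by (simp add: c_def)
    have "cnj l * (\<i> * \<sigma>2 + c * l) = \<i> * (cnj l * \<sigma>2 + l * \<sigma>1)" using l0 by (simp add: c_def algebra_simps)
    then show "\<i> * \<sigma>2 + c * l = 0" using l0 s2 by simp
  qed
  define H where "H x = c *s Fm x" for x
  define DH where "DH x = c *s ?Dm x" for x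
  have Hs: "cauchy_sol q (of_real (k\<^sup>2)) H DH" unfolding H_def[abs_def] DH_def[abs_def] by (rule cauchy_sol_scale[OF F(3)])
  have HB: "data_norm (H x) (DH x) \<le> cmod c * Bm" if "x \<ge> 0" for x
    unfolding H_def DH_def data_norm_scale using Bm[OF that] by (intro mult_left_mono) auto
  have V0: "(\<lambda>n. data_norm (G n 0 - H 0) (D n 0 - DH 0)) \<longlonglongrightarrow> 0"
  proof (rule tendsto_sandwich[OF _ _ tendsto_const])
    have eq: "G n 0 - H 0 = 1 *s G n 0 + (- c) *s Fm 0" "D n 0 - DH 0 = 1 *s D n 0 + (- c) *s ?Dm 0" for n
      by (simp_all add: H_def DH_def)
    have "data_norm (G n 0 - H 0) (D n 0 - DH 0) \<le> 2 * (cmod (bd_data \<alpha> (G n 0) (D n 0) $ 1 - c * cnj l)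
        + cmod (bd_data \<alpha> (G n 0) (D n 0) $ 2 + c * l) + 0 + cmod (of_real (d n)))" for n
      using data_norm_boundary[of "G n 0 - H 0" "D n 0 - DH 0" \<alpha>] unfolding eq bd_data_lin bd_data_perp_lin bc
      by (simp add: Lm LPG)
    then show "\<forall>\<^sub>F n in sequentially. data_norm (G n 0 - H 0) (D n 0 - DH 0) \<le> 2 * (cmod (bd_data \<alpha> (G n 0) (D n 0) $ 1 - c * cnj l)
        + cmod (bd_data \<alpha> (G n 0) (D n 0) $ 2 + c * l) + 0 + cmod (of_real (d n)))" by simp
    have "(\<lambda>n. 2 * (cmod (bd_data \<alpha> (G n 0) (D n 0) $ 1 - c * cnj l)
        + cmod (bd_data \<alpha> (G n 0) (D n 0) $ 2 + c * l) + 0 + cmod (of_real (d n)))) \<longlonglongrightarrow>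
        2 * (cmod (\<i> * \<sigma>1 - c * cnj l) + cmod (\<i> * \<sigma>2 + c * l) + 0 + cmod 0)"
      by (intro tendsto_intros L1 L2 dlim')
    then show "(\<lambda>n. 2 * (cmod (bd_data \<alpha> (G n 0) (D n 0) $ 1 - c * cnj l)
        + cmod (bd_data \<alpha> (G n 0) (D n 0) $ 2 + c * l) + 0 + cmod (of_real (d n)))) \<longlonglongrightarrow> 0"
      unfolding c by simp
  qed (simp add: data_norm_nonneg)
  have ptw: "(\<lambda>n. G n x $ i) \<longlonglongrightarrow> c * Fm x $ i" if x: "x \<ge> 0" for x i
  proof -
    obtain C where C: "C \<ge> 1" "\<And>z w F D G E B s t. \<lbrakk>cmod z \<le> k\<^sup>2 + 1; cauchy_sol q z F D; cauchy_sol q w G E; B \<ge> 0; \<And>y. y\<in>{0..x} \<Longrightarrow> data_norm (G y) (E y) \<le> B;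
       s\<in>{0..x}; t\<in>{0..x}\<rbrakk> \<Longrightarrow> data_norm (F s - G s) (D s - E s) + cmod (z - w) * B \<le>
           C * (data_norm (F t - G t) (D t - E t) + cmod (z - w) * B)"
      using cauchy_sol_diff_gronwall[of "k\<^sup>2 + 1" x] by (metis (no_types, lifting))
    have B0': "cmod c * Bm \<ge> 0" using HB[OF order_refl] data_norm_nonneg[of "H 0" "DH 0"] by linarith
    have zb: "cmod (z n) \<le> k\<^sup>2 + 1" for n
      using cmod_le[of "z n"] d[of n] by (simp add: z_def)
    have le: "norm (G n x $ i - c * Fm x $ i) \<le> C * (data_norm (G n 0 - H 0) (D n 0 - DH 0) + d n * (cmod c * Bm))" for n
    proof -
      have "data_norm (G n x - H x) (D n x - DH x) + cmod (z n - of_real (k\<^sup>2)) * (cmod c * Bm) \<le>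
           C * (data_norm (G n 0 - H 0) (D n 0 - DH 0) + cmod (z n - of_real (k\<^sup>2)) * (cmod c * Bm))"
        by (rule C(2)[OF zb G(1) Hs B0']) (use HB x in auto)
      moreover have "cmod (G n x $ i - c * Fm x $ i) \<le> data_norm (G n x - H x) (D n x - DH x)"
        using data_norm_bounds(1)[of "G n x - H x" i "D n x - DH x"] by (simp add: H_def)
      moreover have "0 \<le> d n * (cmod c * Bm)" using d[of n] B0' by simp
      ultimately show ?thesis unfolding zn by linarith
    qed
    have "(\<lambda>n. C * (data_norm (G n 0 - H 0) (D n 0 - DH 0) + d n * (cmod c * Bm))) \<longlonglongrightarrow> C * (0 + 0 * (cmod c * Bm))"
      by (intro tendsto_intros V0 dlim)
    then have l0: "(\<lambda>n. C * (data_norm (G n 0 - H 0) (D n 0 - DH 0) + d n * (cmod c * Bm))) \<longlonglongrightarrow> 0" by simp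
    have "(\<lambda>n. G n x $ i - c * Fm x $ i) \<longlonglongrightarrow> 0"
      by (rule Lim_null_comparison[OF always_eventually l0]) (use le in blast)
    then show ?thesis by (simp add: LIM_zero_iff)
  qed
  obtain C1 where C1: "C1 \<ge> 1" "\<And>z F D x. cmod (z - of_real (k\<^sup>2)) \<le> k\<^sup>2 / 2 \<Longrightarrow> Im z \<ge> 0 \<Longrightarrow> cauchy_sol q z F D \<Longrightarrow> decays F D \<Longrightarrow>
     x \<ge> 0 \<Longrightarrow> data_norm (F x) (D x) \<le> C1 * data_norm (F 0) (D 0)"
    using decaying_bound_near[OF k] by (metis (no_types, lifting))
  have "k\<^sup>2 / 2 > 0" using k by simp
  with dlim have "\<forall>\<^sub>F n in sequentially. d n < k\<^sup>2 / 2" by (rule order_tendstoD)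
  \<comment> \<open>The uniform bound on decaying solutions holds for |z - k^2| <= k^2 / 2 only, so
    the dominated arguments start at \<open>N0\<close>.\<close>
  then obtain N0 where N0: "\<And>n. n \<ge> N0 \<Longrightarrow> d n < k\<^sup>2 / 2" unfolding eventually_sequentially by blast
  define B1 where "B1 = C1 * B0"
  have B1: "B1 \<ge> 0" using C1(1) B0(1) by (simp add: B1_def)
  have GB: "data_norm (G n x) (D n x) \<le> B1" if "n \<ge> N0" "x \<ge> 0" for n x
  proof -
    have "data_norm (G n x) (D n x) \<le> C1 * data_norm (G n 0) (D n 0)"
      by (rule C1(2)[OF _ z(2)[of n] G that(2)]) (simp only: zn less_imp_le[OF N0[OF that(1)]])
    also have "\<dots> \<le> B1" unfolding B1_def using N C1(1) by (intro mult_left_mono) auto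
    finally show ?thesis .
  qed
  obtain Be where Be: "\<And>x. x \<ge> 0 \<Longrightarrow> cmod (e x) \<le> Be * exp (- (k * x))"
    using scalar_jost_asymptotics(3)[OF k e] by blast
  have FmB: "cmod (Fm x $ i) \<le> Be * exp (- (k * x))" if "x \<ge> 0" for x i
    using Be[OF that] Fme[OF that] exhaust_2[of i] by auto
  define h where "h n x = Fm x $ 1 * G n x $ 2 + Fm x $ 2 * G n x $ 1" for n x
  \<comment> \<open>A majorant independent of n: F_{-1} decays exponentially, and the
    \<open>G n\<close> are bounded uniformly in n on the half-line.\<close>
  define K where "K x = 2 * B1 * Be * exp (- k * x)" for x
  have Kint: "K integrable_on {0..}"
    unfolding K_def using integrable_on_exp_minus_to_infinity[OF k, of 0] by (rule integrable_on_mult_right)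
  have hK: "norm (h n x) \<le> K x" if "n \<ge> N0" "x \<ge> 0" for n x
  proof -
    have E0: "0 \<le> Be * exp (- (k * x))" using FmB[OF that(2), of 1] norm_ge_zero order_trans by blast
    have "norm (h n x) \<le> cmod (Fm x $ 1) * cmod (G n x $ 2) + cmod (Fm x $ 2) * cmod (G n x $ 1)"
      unfolding h_def norm_mult[symmetric] by (rule norm_triangle_ineq)
    also have "\<dots> \<le> (Be * exp (- (k * x))) * B1 + (Be * exp (- (k * x))) * B1"
      by (intro add_mono mult_mono FmB that order_trans[OF data_norm_bounds(1) GB[OF that]] E0 norm_ge_zero)
    finally show ?thesis by (simp add: K_def algebra_simps)
  qed
  have hcont: "continuous_on {0..} (h n)" for n
    unfolding h_def by (intro continuous_intros cauchy_sol_cont[OF F(3)] cauchy_sol_cont[OF G(1)])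
  \<comment> \<open>The Wronskian of F_{-1} with \<open>G n\<close> equals l d at 0 and vanishes at
    infinity. Its derivative carries the factor k^2 - z = - i d, so d cancels and an identity
    independent of d remains.\<close>
  have hint: "h n integrable_on {0..}" and lh: "l = \<i> * integral {0..} (h n)" if n: "n \<ge> N0" for n
  proof -
    define hm where "hm m x = (if x \<in> {0..real m} then h n x else 0)" for m x
    have hi: "h n integrable_on {0..real m}" for m
      by (intro integrable_continuous_interval continuous_on_subset[OF hcont]) auto
    have hm: "(hm m has_integral integral {0..real m} (h n)) {0..}" for m
      unfolding hm_def using integrable_integral[OF hi[of m]]
      by (subst has_integral_restrict) auto
    have hm1: "hm m integrable_on {0..}" for m using hm by blast
    have hm2: "norm (hm m x) \<le> K x" if "x \<in> {0..}" for m x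
    proof -
      have "norm (hm m x) \<le> norm (h n x)" by (simp add: hm_def)
      also have "\<dots> \<le> K x" using hK[OF n] that by simp
      finally show ?thesis .
    qed
    have hm3: "(\<lambda>m. hm m x) \<longlonglongrightarrow> h n x" if "x \<in> {0..}" for x
    proof (rule tendsto_eventually)
      obtain m0 :: nat where "x \<le> m0" using real_arch_simple by blast
      then have "hm m x = h n x" if "m \<ge> m0" for m
        using \<open>x \<in> {0..}\<close> that unfolding hm_def by simp
      then show "\<forall>\<^sub>F m in sequentially. hm m x = h n x"
        unfolding eventually_sequentially by blast
    qed
    have "h n integrable_on {0..} \<and> (\<lambda>m. integral {0..} (hm m)) \<longlonglongrightarrow> integral {0..} (h n)"
      using dominated_convergence[OF hm1 Kint hm2 hm3] by blast
    then have hi': "h n integrable_on {0..}" and hl: "(\<lambda>m. integral {0..real m} (h n)) \<longlonglongrightarrow> integral {0..} (h n)"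
      using integral_unique[OF hm] by auto
    show "h n integrable_on {0..}" by (rule hi')
    have W0: "wronskian Fm ?Dm (G n) (D n) 0 = l * of_real (d n)"
      unfolding wronskian_boundary[where \<alpha> = \<alpha>] bc Lm LPG by simp
    have W: "wronskian Fm ?Dm (G n) (D n) (real m) - l * of_real (d n) = - \<i> * of_real (d n) * integral {0..real m} (h n)" for m
    proof -
      have "((\<lambda>x. (of_real (k\<^sup>2) - z n) * h n x) has_integral wronskian Fm ?Dm (G n) (D n) (real m) - wronskian Fm ?Dm (G n) (D n) 0) {0..real m}"
        unfolding h_def by (rule wronskian_has_integral[OF F(3) G(1)]) auto
      then have "integral {0..real m} (\<lambda>x. (of_real (k\<^sup>2) - z n) * h n x) = wronskian Fm ?Dm (G n) (D n) (real m) - l * of_real (d n)"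
        unfolding W0 by (rule integral_unique)
      moreover have "of_real (k\<^sup>2) - z n = - \<i> * of_real (d n)" using zd[of n] by (simp add: algebra_simps)
      ultimately show ?thesis by simp
    qed
    have "((\<lambda>x. data_norm (Fm x) (?Dm x) * B1) \<longlongrightarrow> 0 * B1) at_top"
      using F(2) unfolding decays_def by (intro tendsto_mult tendsto_const)
    from filterlim_compose[OF this filterlim_real_sequentially]
    have dec: "(\<lambda>m. data_norm (Fm (real m)) (?Dm (real m)) * B1) \<longlonglongrightarrow> 0" by simp
    have Wle: "cmod (wronskian Fm ?Dm (G n) (D n) (real m)) \<le> data_norm (Fm (real m)) (?Dm (real m)) * B1" for m
      by (rule order_trans[OF wronskian_bound mult_left_mono[OF GB[OF n] data_norm_nonneg]]) simp
    have "(\<lambda>m. wronskian Fm ?Dm (G n) (D n) (real m)) \<longlonglongrightarrow> 0"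
      by (rule Lim_null_comparison[OF always_eventually dec]) (use Wle in blast)
    then have "(\<lambda>m. wronskian Fm ?Dm (G n) (D n) (real m) - l * of_real (d n)) \<longlonglongrightarrow> 0 - l * of_real (d n)"
      by (intro tendsto_diff tendsto_const)
    then have "(\<lambda>m. - \<i> * of_real (d n) * integral {0..real m} (h n)) \<longlonglongrightarrow> 0 - l * of_real (d n)"
      unfolding W .
    moreover have "(\<lambda>m. - \<i> * of_real (d n) * integral {0..real m} (h n)) \<longlonglongrightarrow> - \<i> * of_real (d n) * integral {0..} (h n)"
      by (intro tendsto_mult tendsto_const hl)
    ultimately have "0 - l * of_real (d n) = - \<i> * of_real (d n) * integral {0..} (h n)"
      by (rule LIMSEQ_unique)
    then have "of_real (d n) * l = of_real (d n) * (\<i> * integral {0..} (h n))" by (simp add: algebra_simps)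
    then show "l = \<i> * integral {0..} (h n)" using d(1)[of n] by simp
  qed
  \<comment> \<open>The pointwise limit of \<open>h n\<close>. By the form of F_{-1} it equals - 2 c
    |e|^2, which brings in the norm of the scalar Jost solution.\<close>
  define g where "g x = c * (2 * (Fm x $ 1 * Fm x $ 2))" for x
  have "(\<lambda>n. integral {0..} (h (n + N0))) \<longlonglongrightarrow> integral {0..} g"
  proof (rule dominated_convergence(2)[where h = K])
    show "h (n + N0) integrable_on {0..}" for n by (rule hint) simp
    show "norm (h (n + N0) x) \<le> K x" if "x \<in> {0..}" for n x using hK[of "n + N0" x] that by simp
    show "(\<lambda>n. h (n + N0) x) \<longlonglongrightarrow> g x" if "x \<in> {0..}" for x
    proof (rule LIMSEQ_ignore_initial_segment)
      have "(\<lambda>n. Fm x $ 1 * G n x $ 2 + Fm x $ 2 * G n x $ 1) \<longlonglongrightarrow> Fm x $ 1 * (c * Fm x $ 2) + Fm x $ 2 * (c * Fm x $ 1)"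
        using that by (intro tendsto_intros ptw) auto
      then show "(\<lambda>n. h n x) \<longlonglongrightarrow> g x" by (simp add: h_def g_def algebra_simps)
    qed
  qed (rule Kint)
  then have "(\<lambda>n. \<i> * integral {0..} (h (n + N0))) \<longlonglongrightarrow> \<i> * integral {0..} g"
    by (intro tendsto_mult tendsto_const)
  moreover have "(\<lambda>n. \<i> * integral {0..} (h (n + N0))) \<longlonglongrightarrow> l" using lh[symmetric] by simp
  ultimately have lg: "l = \<i> * integral {0..} g" by (rule LIMSEQ_unique[symmetric])
  have "integral {0..} g = integral {0..} (\<lambda>x. (- 2 * c) * of_real ((cmod (e x))\<^sup>2))"
    by (intro integral_cong) (simp add: g_def Fme complex_norm_square del: of_real_power)
  also have "\<dots> = (- 2 * c) * integral {0..} (\<lambda>x. complex_of_real ((cmod (e x))\<^sup>2))"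
    by (rule integral_mult_right)
  also have "integral {0..} (\<lambda>x. complex_of_real ((cmod (e x))\<^sup>2)) = of_real E"
  proof -
    have "set_integrable lebesgue {0<..} (\<lambda>x. (cmod (e x))\<^sup>2)"
      using exp_decay_square_integrable(1)[OF k scalar_jost_asymptotics(2)[OF k e] Be]
        absolutely_integrable_on_open_halfline by blast
    then have "set_integrable lebesgue {0<..} (\<lambda>x. complex_of_real ((cmod (e x))\<^sup>2))"
      unfolding set_integrable_def by (rule integrable_of_real[THEN Bochner_Integration.integrable_cong[THEN iffD1, rotated 2]]) (simp_all add: indicator_def)
    then have "(LINT x:{0<..}|lebesgue. complex_of_real ((cmod (e x))\<^sup>2)) = integral {0<..} (\<lambda>x. complex_of_real ((cmod (e x))\<^sup>2))"
      by (rule set_lebesgue_integral_eq_integral(2))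
    moreover have "integral {0<..} (\<lambda>x. complex_of_real ((cmod (e x))\<^sup>2)) = integral {0..} (\<lambda>x. complex_of_real ((cmod (e x))\<^sup>2))"
      by (rule integral_spike_set) (auto intro: negligible_subset[of "{0}"])
    ultimately show ?thesis by (simp only: E_def set_integral_complex_of_real)
  qed
  finally have "l = \<i> * ((- 2 * c) * of_real E)" using lg by simp
  then have "l * cnj l = - 2 * \<i> * of_real E * (c * cnj l)" by (simp add: algebra_simps)
  also have "c * cnj l = \<i> * \<sigma>1" using c(1) by simp
  finally show "2 * of_real E * \<sigma>1 = l * cnj l" by (simp add: algebra_simps)
qed

end

section \<open>The spectral matrix\<close>

lemma spectral_mat_nth [simp]:
  "spectral_mat c $ 1 $ 1 = 1" "spectral_mat c $ 1 $ 2 = c"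
  "spectral_mat c $ 2 $ 1 = cnj c" "spectral_mat c $ 2 $ 2 = 1"
  by (simp_all add: spectral_mat_def vector_2)

lemma spectral_mat_hermitian: "cnj (spectral_mat c $ j $ i) = spectral_mat c $ i $ j"
  using exhaust_2[of i] exhaust_2[of j] by auto

lemma spectral_mat_entry_bound: "cmod c \<le> 1 \<Longrightarrow> cmod (spectral_mat c $ i $ j) \<le> 1"
  using exhaust_2[of i] exhaust_2[of j] by auto

lemma norm_matrix2_le:
  fixes A :: "complex^2^2"
  shows "norm A \<le> cmod (A $ 1 $ 1) + cmod (A $ 1 $ 2) + cmod (A $ 2 $ 1) + cmod (A $ 2 $ 2)"
proof -
  have row: "norm v \<le> cmod (v $ 1) + cmod (v $ 2)" for v :: "complex^2"
    unfolding norm_vec_def by (rule order_trans[OF L2_set_le_sum]) (auto simp: sum_2)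
  have "norm A \<le> norm (A $ 1) + norm (A $ 2)"
    unfolding norm_vec_def[of A] by (rule order_trans[OF L2_set_le_sum]) (auto simp: sum_2)
  then show ?thesis using row[of "A $ 1"] row[of "A $ 2"] by linarith
qed

lemma spectral_mat_entry_continuous: "continuous_on UNIV (\<lambda>c. spectral_mat c $ i $ j)"
  using exhaust_2[of i] exhaust_2[of j]
  by (elim disjE) (simp_all add: continuous_on_cnj continuous_on_id)

lemma spectral_mat_entry_measurable:
  "\<psi> \<in> borel_measurable borel \<Longrightarrow> (\<lambda>t. spectral_mat (\<psi> t) $ i $ j) \<in> borel_measurable borel"
  by (rule measurable_compose[OF _ borel_measurable_continuous_onI[OF spectral_mat_entry_continuous]])

lemma spectral_mat_measurable [measurable]: "spectral_mat \<in> borel_measurable borel"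
proof (rule borel_measurable_continuous_onI)
  have "continuous_on UNIV (\<lambda>c. \<chi> i j. spectral_mat c $ i $ j)"
    by (intro continuous_on_vec_lambda spectral_mat_entry_continuous)
  then show "continuous_on UNIV spectral_mat" by (simp add: vec_lambda_eta)
qed

lemma set_integral_entry:
  fixes F :: "'a \<Rightarrow> complex^2^2"
  assumes "set_integrable M B F"
  shows "(LINT t:B|M. F t $ i $ j) = (LINT t:B|M. F t) $ i $ j"
proof -
  have "bounded_linear (\<lambda>A :: complex^2^2. A $ i $ j)"
    by (rule bounded_linear_compose[OF bounded_linear_vec_nth bounded_linear_vec_nth])
  from integral_bounded_linear[OF this assms[unfolded set_integrable_def]]
  show ?thesis by (simp add: set_lebesgue_integral_def)
qed

lemma mat_Re_hermitian: "cnj (mat_Re M $ j $ i) = mat_Re M $ i $ j"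
  by (simp add: mat_Re_def add.commute)

context herglotz_measure
begin

text \<open>The constant term is hermitian and cancels in M - M*; as the density matrix is hermitian
  too, the kernels subtract entrywise and leave the Poisson kernel.\<close>

lemma herglotz_imaginary_part:
  fixes M :: "complex^2^2"
  assumes \<psi>: "\<psi> \<in> borel_measurable borel" "AE t in \<nu>. cmod (\<psi> t) \<le> 1" and d: "d > 0"
    and M: "\<And>i j. M $ i $ j = mat_Re M0 $ i $ j + (LINT t|\<nu>. herglotz_kernel (Complex x d) t * spectral_mat (\<psi> t) $ i $ j)"
  shows "M $ i $ j - cnj (M $ j $ i) = 2 * \<i> * (LINT t|\<nu>. poisson_kernel x d t *\<^sub>R spectral_mat (\<psi> t) $ i $ j)"
proof -
  let ?K = "herglotz_kernel (Complex x d)" and ?s = "\<lambda>i j t. spectral_mat (\<psi> t) $ i $ j"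
  have s: "?s i j \<in> borel_measurable borel" for i j
    using \<psi>(1) by (rule spectral_mat_entry_measurable)
  have s1: "AE t in \<nu>. cmod (?s i j t) \<le> 1" for i j
    using \<psi>(2) by eventually_elim (rule spectral_mat_entry_bound)
  have int: "integrable \<nu> (\<lambda>t. ?K t * ?s i j t)" for i j
    by (rule integrable_kernel[OF _ s s1]) (use d in simp)
  have "M $ i $ j - cnj (M $ j $ i) = (LINT t|\<nu>. ?K t * ?s i j t) - (LINT t|\<nu>. cnj (?K t * ?s j i t))"
    unfolding M[of i j] M[of j i] complex_cnj_add mat_Re_hermitian Bochner_Integration.integral_cnj by simp
  also have "\<dots> = (LINT t|\<nu>. ?K t * ?s i j t - cnj (?K t * ?s j i t))"
    by (rule Bochner_Integration.integral_diff[symmetric, OF int integrable_cnj[OF int]])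
  also have "(\<lambda>t. ?K t * ?s i j t - cnj (?K t * ?s j i t)) = (\<lambda>t. 2 * \<i> * (poisson_kernel x d t *\<^sub>R ?s i j t))"
  proof
    fix t
    have "?K t * ?s i j t - cnj (?K t * ?s j i t) = (?K t - cnj (?K t)) * ?s i j t"
      unfolding complex_cnj_mult spectral_mat_hermitian by (rule left_diff_distrib[symmetric])
    then show "?K t * ?s i j t - cnj (?K t * ?s j i t) = 2 * \<i> * (poisson_kernel x d t *\<^sub>R ?s i j t)"
      unfolding poisson_kernel_eq[OF d, symmetric] by (simp add: scaleR_conv_of_real)
  qed
  finally show ?thesis unfolding integral_mult_right_zero .
qed

text \<open>Integrability of the matrix integrands on both sides is what allows an entry to be taken
  under the integral. The entries have modulus at most 1, whence the bound 4.\<close>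

lemma density_entry:
  fixes D :: "real \<Rightarrow> complex^2^2"
  assumes \<psi>: "\<psi> \<in> borel_measurable borel" "AE t in \<nu>. cmod (\<psi> t) \<le> 1"
    and B: "B \<in> sets borel" "B \<subseteq> {a..b}" and D: "set_integrable lborel B D"
    and eq: "(LINT t:B|\<nu>. spectral_mat (\<psi> t)) = (LINT t:B|lborel. D t)"
  shows "(LINT t:B|\<nu>. spectral_mat (\<psi> t) $ i $ j) = (LINT t:B|lborel. D t $ i $ j)"
proof -
  have "set_integrable \<nu> B (\<lambda>t. spectral_mat (\<psi> t))"
  proof (rule bounded_integrable[OF _ _ B, where C = 4])
    show "(\<lambda>t. spectral_mat (\<psi> t)) \<in> borel_measurable borel" using \<psi>(1) by measurable
    show "AE t in \<nu>. norm (spectral_mat (\<psi> t)) \<le> 4"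
      using \<psi>(2)
    proof eventually_elim
      case (elim t)
      then show ?case using norm_matrix2_le[of "spectral_mat (\<psi> t)"] by simp
    qed
  qed
  then show ?thesis using eq D by (simp add: set_integral_entry)
qed

end

text \<open>
  The three relations between the boundary data \<open>p\<close>, \<open>r\<close> of the outgoing Jost solution and \<open>(U, - u)\<close>,
  \<open>(L, - l)\<close> of the decaying one are Wronskian identities; capital letters stand for complex conjugates.
\<close>

lemma weyl_jump_identities:
  fixes p1 p2 P1 P2 r1 r2 R1 R2 u U l L K :: complex
  assumes A: "p1 * L - p2 * l - r1 * U + r2 * u = 0" and B: "P1 * l - P2 * L - R1 * u + R2 * U = 0"
    and C: "P2 * r1 + P1 * r2 - R2 * p1 - R1 * p2 = K"
  shows "(- u * r2 + p2 * l) * (- P1 * U - u * P2) - (- U * R2 + P2 * L) * (- p1 * u - U * p2) = K * (u * U)"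
    "(- u * r1 - p2 * L) * (- P1 * U - u * P2) - (- P1 * L - u * R2) * (- p1 * u - U * p2) = K * u\<^sup>2"
proof -
  have "(- u * r2 + p2 * l) * (- P1 * U - u * P2) - (- U * R2 + P2 * L) * (- p1 * u - U * p2)
      = (P2 * r1 + P1 * r2 - R2 * p1 - R1 * p2) * (u * U)
        + u * P2 * (p1 * L - p2 * l - r1 * U + r2 * u) - p2 * U * (P1 * l - P2 * L - R1 * u + R2 * U)"
    by (simp add: algebra_simps)
  then show "(- u * r2 + p2 * l) * (- P1 * U - u * P2) - (- U * R2 + P2 * L) * (- p1 * u - U * p2) = K * (u * U)"
    unfolding A B C by simp
  have "(- u * r1 - p2 * L) * (- P1 * U - u * P2) - (- P1 * L - u * R2) * (- p1 * u - U * p2)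
      = (P2 * r1 + P1 * r2 - R2 * p1 - R1 * p2) * u\<^sup>2
        - u * P1 * (p1 * L - p2 * l - r1 * U + r2 * u) - p2 * u * (P1 * l - P2 * L - R1 * u + R2 * U)"
    by (simp add: algebra_simps power2_eq_square)
  then show "(- u * r1 - p2 * L) * (- P1 * U - u * P2) - (- P1 * L - u * R2) * (- p1 * u - U * p2) = K * u\<^sup>2"
    unfolding A B C by simp
qed

section \<open>From boundary values to the density and the point mass\<close>

theorem theorem3p5:
  fixes q :: "real \<Rightarrow> complex" and \<alpha> :: "complex option" and k :: real
    and \<nu> :: "real measure" and \<psi> :: "real \<Rightarrow> complex"
    and Fp Fm :: "real \<Rightarrow> complex^2" and e :: "real \<Rightarrow> complex"
  assumes "set_integrable lebesgue {0<..} q"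
    and "k > 0"
    and "jost_plus_i q k Fp"
    and "jost_minus1 q k Fm"
    and "scalar_jost q k e"
    and "spectral_pair q \<alpha> \<nu> \<psi>"
  shows
    "(\<not> hermitisation_eigenvalue q \<alpha> (of_real (k\<^sup>2)) \<longrightarrow>
        (\<forall>n p. continuous_spectral_density q \<alpha> \<nu> \<psi> n p \<longrightarrow>
           n (k\<^sup>2) = 2 * k / pi * ((cmod (bd_ell_perp \<alpha> e))\<^sup>2
                      / (cmod (det (cols2 (bd_L_perp \<alpha> Fp) (bd_L_perp \<alpha> Fm))))\<^sup>2) \<and>
           p (k\<^sup>2) = bd_ell_perp \<alpha> e / cnj (bd_ell_perp \<alpha> e)) \<and>
        (\<forall>Fp'. jost_plus_i q k Fp' \<longrightarrow>
           det (cols2 (bd_L_perp \<alpha> Fp') (bd_L_perp \<alpha> Fm))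
             = det (cols2 (bd_L_perp \<alpha> Fp) (bd_L_perp \<alpha> Fm))) \<and>
        det (cols2 (bd_L_perp \<alpha> Fp) (bd_L_perp \<alpha> Fm)) \<noteq> 0)
     \<and>
     (hermitisation_eigenvalue q \<alpha> (of_real (k\<^sup>2)) \<longrightarrow>
        bd_ell \<alpha> e \<noteq> 0 \<and>
        measure \<nu> {k\<^sup>2} = (cmod (bd_ell \<alpha> e))\<^sup>2
                      / (2 * (LINT x:{0<..}|lebesgue. (cmod (e x))\<^sup>2)) \<and>
        \<psi> (k\<^sup>2) = - (cnj (bd_ell \<alpha> e) / bd_ell \<alpha> e))"
proof -
  note k = assms(2) and Fp = assms(3) and Fm = assms(4) and e = assms(5)
  interpret potential q by unfold_locales (rule assms(1))
  have sp: "sets \<nu> = sets borel" "integrable \<nu> (\<lambda>t. 1 / (1 + t\<^sup>2))"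
    and \<psi>: "\<psi> \<in> borel_measurable borel" "AE t in \<nu>. cmod (\<psi> t) \<le> 1"
    using assms(6) by (simp_all add: spectral_pair_def)
  obtain M where M: "\<And>z. z \<notin> \<real> \<Longrightarrow> weyl_matrix q \<alpha> z (M z)"
    and rep: "\<And>z i j. Im z > 0 \<Longrightarrow> M z $ i $ j = mat_Re (M \<i>) $ i $ j +
               (LINT t|\<nu>. herglotz_kernel z t * spectral_mat (\<psi> t) $ i $ j)"
    using assms(6) unfolding spectral_pair_def herglotz_kernel_def by blast
  interpret herglotz_measure \<nu> by unfold_locales (rule sp)+
  let ?Dp = "hl_deriv Fp" and ?Dm = "hl_deriv Fm"
  note F = jost_minus_asymptotics[OF k Fm]
  have P: "outgoing q k Fp ?Dp" by (rule jost_plus_outgoing[OF k Fp])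
  have Q: "outgoing q k Fm ?Dm" by (rule decays_outgoing[OF F(3,2)])
  have Ps: "cauchy_sol q (of_real (k\<^sup>2)) Fp ?Dp" using P by (simp add: outgoing_def)
  define p m r s where "p = bd_data_perp \<alpha> (Fp 0) (?Dp 0)" and "m = bd_data_perp \<alpha> (Fm 0) (?Dm 0)"
    and "r = bd_data \<alpha> (Fp 0) (?Dp 0)" and "s = bd_data \<alpha> (Fm 0) (?Dm 0)"
  define u l where "u = bd_ell_perp \<alpha> e" and "l = bd_ell \<alpha> e"
  have bdp: "bd_L_perp \<alpha> Fp = p" "bd_L_perp \<alpha> Fm = m"
    unfolding p_def m_def by (rule bd_L_sol(2)[OF Ps] bd_L_sol(2)[OF F(3)])+
  have m: "m $ 1 = cnj u" "m $ 2 = - u" and s: "s $ 1 = cnj l" "s $ 2 = - l"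
    unfolding m_def s_def jost_minus_eq_scalar[OF k Fm e order_refl] jost_pair_boundary
    by (simp_all add: u_def l_def vector_2)
  define \<delta> where "\<delta> = p $ 1 * m $ 2 - m $ 1 * p $ 2"
  have det: "det (cols2 p m) = \<delta>" by (simp add: det_cols2 \<delta>_def)
  show ?thesis
  proof (intro conjI impI)
    assume ne: "\<not> hermitisation_eigenvalue q \<alpha> (of_real (k\<^sup>2))"
    have m0: "m \<noteq> 0" using jost_minus_eigenvalue[OF k Fm e] ne unfolding m_def by blast
    then have u0: "u \<noteq> 0" using m by (auto simp: vec_eq_iff forall_2)
    have \<delta>0: "\<delta> \<noteq> 0"
      using jost_det_nonzero[OF k Fp Fm m0[unfolded m_def]] unfolding p_def[symmetric] m_def[symmetric] det .
    then show "det (cols2 (bd_L_perp \<alpha> Fp) (bd_L_perp \<alpha> Fm)) \<noteq> 0" unfolding bdp det .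
    show "\<forall>Fp'. jost_plus_i q k Fp' \<longrightarrow> det (cols2 (bd_L_perp \<alpha> Fp') (bd_L_perp \<alpha> Fm))
             = det (cols2 (bd_L_perp \<alpha> Fp) (bd_L_perp \<alpha> Fm))"
    proof (intro allI impI)
      fix Fp' assume Fp': "jost_plus_i q k Fp'"
      then have "cauchy_sol q (of_real (k\<^sup>2)) Fp' (hl_deriv Fp')" using jost_plus_outgoing[OF k] by (simp add: outgoing_def)
      from bd_L_sol(2)[OF this] show "det (cols2 (bd_L_perp \<alpha> Fp') (bd_L_perp \<alpha> Fm))
             = det (cols2 (bd_L_perp \<alpha> Fp) (bd_L_perp \<alpha> Fm))"
        unfolding bdp using jost_det_independent[OF k Fp Fp' Fm, of \<alpha>] unfolding p_def m_def by simp
    qed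
    show "\<forall>n p. continuous_spectral_density q \<alpha> \<nu> \<psi> n p \<longrightarrow>
           n (k\<^sup>2) = 2 * k / pi * ((cmod (bd_ell_perp \<alpha> e))\<^sup>2
                      / (cmod (det (cols2 (bd_L_perp \<alpha> Fp) (bd_L_perp \<alpha> Fm))))\<^sup>2) \<and>
           p (k\<^sup>2) = bd_ell_perp \<alpha> e / cnj (bd_ell_perp \<alpha> e)"
    proof (intro allI impI)
      \<comment> \<open>\<open>w\<close> is the pointwise phase, since \<open>p\<close> denotes
        boundary data in this proof.\<close>
      fix n w assume csd: "continuous_spectral_density q \<alpha> \<nu> \<psi> n w"
      define S where "S = {t. t > 0 \<and> \<not> hermitisation_eigenvalue q \<alpha> (of_real t)}"
      define D where "D t = n t *\<^sub>R spectral_mat (w t)" for t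
      have Dc: "continuous_on S D" and Dint: "\<And>B. B \<in> sets borel \<Longrightarrow> B \<subseteq> S \<Longrightarrow> bounded B \<Longrightarrow> set_integrable lborel B D"
        and Deq: "\<And>B. B \<in> sets borel \<Longrightarrow> B \<subseteq> S \<Longrightarrow> bounded B \<Longrightarrow> (LINT t:B|\<nu>. spectral_mat (\<psi> t)) = (LINT t:B|lborel. D t)"
        using csd unfolding continuous_spectral_density_def Let_def S_def D_def by blast+
      have "det (cols2 (bd_data_perp \<alpha> (Fp 0) (?Dp 0)) (bd_data_perp \<alpha> (Fm 0) (?Dm 0))) \<noteq> 0"
        using \<delta>0 det unfolding p_def m_def by simp
      from no_eigenvalue_near[OF k P Q this]
      obtain \<rho> where \<rho>: "\<rho> > 0" "\<And>t. \<bar>t - k\<^sup>2\<bar> < \<rho> \<Longrightarrow> \<not> hermitisation_eigenvalue q \<alpha> (of_real t)" by blast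
      \<comment> \<open>Halving keeps the closed interval around k^2 inside the eigenvalue-free
        neighbourhood and inside the positive axis.\<close>
      define r0 where "r0 = min \<rho> (k\<^sup>2) / 2"
      have r0: "r0 > 0" "r0 < \<rho>" "r0 < k\<^sup>2" using \<rho>(1) k by (auto simp: r0_def min_def)
      have I: "{k\<^sup>2-r0..k\<^sup>2+r0} \<subseteq> S"
        unfolding S_def
      proof
        fix t assume t: "t \<in> {k\<^sup>2-r0..k\<^sup>2+r0}"
        then have "\<bar>t - k\<^sup>2\<bar> < \<rho>" "t > 0" using r0 unfolding atLeastAtMost_iff by linarith+
        then show "t \<in> {t. t > 0 \<and> \<not> hermitisation_eigenvalue q \<alpha> (of_real t)}" using \<rho>(2) by blast
      qed
      have lim: "((\<lambda>d. LINT t|\<nu>. poisson_kernel (k\<^sup>2) d t *\<^sub>R spectral_mat (\<psi> t) $ i $ j) \<longlongrightarrow> of_real pi * D (k\<^sup>2) $ i $ j) (at_right 0)" for i j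
      proof (rule poisson_limit[OF _ _ r0(1)])
        show "(\<lambda>t. spectral_mat (\<psi> t) $ i $ j) \<in> borel_measurable borel"
          using \<psi>(1) by (rule spectral_mat_entry_measurable)
        show "AE t in \<nu>. cmod (spectral_mat (\<psi> t) $ i $ j) \<le> 1"
          using \<psi>(2) by eventually_elim (rule spectral_mat_entry_bound)
        show "continuous_on {k\<^sup>2-r0..k\<^sup>2+r0} (\<lambda>t. D t $ i $ j)"
          by (intro continuous_intros continuous_on_subset[OF Dc I])
        show "(LINT t:B|\<nu>. spectral_mat (\<psi> t) $ i $ j) = (LINT t:B|lborel. D t $ i $ j)"
          if B: "B \<in> sets borel" "B \<subseteq> {k\<^sup>2-r0..k\<^sup>2+r0}" for B
        proof -
          have "B \<subseteq> S" "bounded B" using B(2) I bounded_subset[OF bounded_closed_interval B(2)] by auto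
          then show ?thesis using density_entry[OF \<psi> B Dint[OF B(1)] Deq[OF B(1)]] by blast
        qed
      qed
      \<comment> \<open>The jump of M is computed from the measure here and from the boundary data
        below; uniqueness of limits equates the two.\<close>
      have jump: "((\<lambda>d. M (Complex (k\<^sup>2) d) $ i $ j - cnj (M (Complex (k\<^sup>2) d) $ j $ i)) \<longlongrightarrow> 2 * \<i> * (of_real pi * D (k\<^sup>2) $ i $ j)) (at_right 0)" for i j
      proof -
        have "((\<lambda>d. 2 * \<i> * (LINT t|\<nu>. poisson_kernel (k\<^sup>2) d t *\<^sub>R spectral_mat (\<psi> t) $ i $ j)) \<longlongrightarrow> 2 * \<i> * (of_real pi * D (k\<^sup>2) $ i $ j)) (at_right 0)"
          by (intro tendsto_mult tendsto_const lim)
        moreover have "\<forall>\<^sub>F d in at_right 0. d > (0::real)" by (simp add: eventually_at_right_less)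
        then have "\<forall>\<^sub>F d in at_right 0. M (Complex (k\<^sup>2) d) $ i $ j - cnj (M (Complex (k\<^sup>2) d) $ j $ i)
            = 2 * \<i> * (LINT t|\<nu>. poisson_kernel (k\<^sup>2) d t *\<^sub>R spectral_mat (\<psi> t) $ i $ j)"
          by eventually_elim (rule herglotz_imaginary_part[OF \<psi> _ rep]; simp)
        ultimately show ?thesis by (subst tendsto_cong)
      qed
      note wl = weyl_matrix_limit[OF k P Q \<delta>0[unfolded \<delta>_def p_def m_def] M]
      note wl = wl[folded p_def m_def r_def s_def, folded \<delta>_def]
      have j11: "(m $ 2 * r $ 2 - p $ 2 * s $ 2) / \<delta> - cnj ((m $ 2 * r $ 2 - p $ 2 * s $ 2) / \<delta>) = 2 * \<i> * (of_real pi * D (k\<^sup>2) $ 1 $ 1)"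
        by (rule tendsto_unique[OF trivial_limit_at_right_real tendsto_diff[OF wl(1) tendsto_cnj[OF wl(1)]] jump[of 1 1]])
      have j12: "(m $ 2 * r $ 1 - p $ 2 * s $ 1) / \<delta> - cnj ((p $ 1 * s $ 2 - m $ 1 * r $ 2) / \<delta>) = 2 * \<i> * (of_real pi * D (k\<^sup>2) $ 1 $ 2)"
        by (rule tendsto_unique[OF trivial_limit_at_right_real tendsto_diff[OF wl(3) tendsto_cnj[OF wl(2)]] jump[of 1 2]])
      obtain Bp where Bp: "\<And>x. x \<ge> 0 \<Longrightarrow> data_norm (Fp x) (?Dp x) \<le> Bp" using P by (auto simp: outgoing_def)
      have "wronskian Fp ?Dp Fm ?Dm 0 = 0" by (rule wronskian_bounded_decays[OF Ps Bp F(3,2)])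
      \<comment> \<open>The three inputs of the algebra: \<open>A\<close> is the vanishing Wronskian
        of the Jost solutions, \<open>B\<close> its conjugate, and \<open>C\<close> the flux of
        F_{+i}.\<close>
      then have A: "p $ 1 * cnj l - p $ 2 * l - r $ 1 * cnj u + r $ 2 * u = 0"
        unfolding wronskian_boundary[where \<alpha> = \<alpha>] p_def[symmetric] m_def[symmetric] r_def[symmetric] s_def[symmetric] m s by simp
      have "cnj (p $ 1 * cnj l - p $ 2 * l - r $ 1 * cnj u + r $ 2 * u) = 0" unfolding A by simp
      then have B: "cnj (p $ 1) * l - cnj (p $ 2) * cnj l - cnj (r $ 1) * u + cnj (r $ 2) * cnj u = 0" by simp
      have C: "cnj (p $ 2) * r $ 1 + cnj (p $ 1) * r $ 2 - cnj (r $ 2) * p $ 1 - cnj (r $ 1) * p $ 2 = 4 * \<i> * of_real k"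
        using wronskian_dag_jost_plus[OF k Fp]
        unfolding wronskian_boundary[where \<alpha> = \<alpha>] bd_data_perp_dag bd_data_dag p_def[symmetric] r_def[symmetric] by simp
      note id = weyl_jump_identities[OF A B C]
      have \<delta>': "\<delta> = - p $ 1 * u - cnj u * p $ 2" "cnj \<delta> = - cnj (p $ 1) * cnj u - u * cnj (p $ 2)"
        by (simp_all add: \<delta>_def m)
      have dd: "\<delta> * cnj \<delta> = of_real ((cmod \<delta>)\<^sup>2)" "u * cnj u = of_real ((cmod u)\<^sup>2)"
        by (simp_all only: complex_norm_square)
      have cd: "cnj \<delta> \<noteq> 0" using \<delta>0 by simp
      have frac: "X / \<delta> - cnj (Y / \<delta>) = (X * cnj \<delta> - cnj Y * \<delta>) / (\<delta> * cnj \<delta>)" for X Y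
        using \<delta>0 cd by (simp add: divide_simps)
      have j11': "2 * \<i> * (of_real pi * D (k\<^sup>2) $ 1 $ 1) = 4 * \<i> * of_real k * (u * cnj u) / (\<delta> * cnj \<delta>)"
        unfolding j11[symmetric] frac using id(1) unfolding \<delta>'[symmetric] by (simp add: m s)
      have j12': "2 * \<i> * (of_real pi * D (k\<^sup>2) $ 1 $ 2) = 4 * \<i> * of_real k * u\<^sup>2 / (\<delta> * cnj \<delta>)"
        unfolding j12[symmetric] frac using id(2) unfolding \<delta>'[symmetric] by (simp add: m s)
      have D: "D (k\<^sup>2) $ 1 $ 1 = of_real (n (k\<^sup>2))" "D (k\<^sup>2) $ 1 $ 2 = of_real (n (k\<^sup>2)) * w (k\<^sup>2)"
        by (simp_all add: D_def) (simp_all add: scaleR_conv_of_real)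
      have "4 * \<i> * of_real k * A / B = 2 * \<i> * (2 * of_real k * (A / B))" for A B :: complex by simp
      with j11' have "2 * \<i> * (of_real pi * D (k\<^sup>2) $ 1 $ 1) = 2 * \<i> * (2 * of_real k * (u * cnj u / (\<delta> * cnj \<delta>)))"
        by (rule trans)
      then have "of_real pi * D (k\<^sup>2) $ 1 $ 1 = 2 * of_real k * (u * cnj u / (\<delta> * cnj \<delta>))"
        by (rule mult_left_cancel[THEN iffD1, rotated]) simp
      then have "complex_of_real (pi * n (k\<^sup>2)) = of_real (2 * k * ((cmod u)\<^sup>2 / (cmod \<delta>)\<^sup>2))"
        unfolding D dd by simp
      then have "pi * n (k\<^sup>2) = 2 * k * ((cmod u)\<^sup>2 / (cmod \<delta>)\<^sup>2)" by (simp only: of_real_eq_iff)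
      then have "pi * n (k\<^sup>2) / pi = 2 * k * ((cmod u)\<^sup>2 / (cmod \<delta>)\<^sup>2) / pi" by (rule arg_cong)
      then have n: "n (k\<^sup>2) = 2 * k / pi * ((cmod u)\<^sup>2 / (cmod \<delta>)\<^sup>2)" by simp
      \<comment> \<open>Comparing the off-diagonal with the diagonal entry isolates the phase; it
        can be divided out because the density is nonzero at k^2.\<close>
      have "2 * \<i> * (of_real pi * D (k\<^sup>2) $ 1 $ 2) * cnj u = 2 * \<i> * (of_real pi * D (k\<^sup>2) $ 1 $ 1) * u"
        unfolding j11' j12' by (simp add: power2_eq_square)
      then have "of_real (n (k\<^sup>2)) * (w (k\<^sup>2) * cnj u) = of_real (n (k\<^sup>2)) * u"
        unfolding D by simp
      moreover have "n (k\<^sup>2) \<noteq> 0" unfolding n using k u0 \<delta>0 by simp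
      ultimately have "w (k\<^sup>2) * cnj u = u" by simp
      then have "w (k\<^sup>2) = u / cnj u" using u0 by (simp add: field_simps)
      then show "n (k\<^sup>2) = 2 * k / pi * ((cmod (bd_ell_perp \<alpha> e))\<^sup>2
                      / (cmod (det (cols2 (bd_L_perp \<alpha> Fp) (bd_L_perp \<alpha> Fm))))\<^sup>2) \<and>
           w (k\<^sup>2) = bd_ell_perp \<alpha> e / cnj (bd_ell_perp \<alpha> e)"
        using n unfolding bdp det u_def by blast
    qed
  next
    assume ev: "hermitisation_eigenvalue q \<alpha> (of_real (k\<^sup>2))"
    have bc: "bd_data_perp \<alpha> (Fm 0) (?Dm 0) = 0" by (rule eigenvalue_jost_minus[OF k Fm ev])
    define \<mu> where "\<mu> = measure \<nu> {k\<^sup>2}"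
    \<comment> \<open>The mass limit for the Herglotz integral carries over to M, since the constant
      term is killed by the factor d.\<close>
    have mass: "(\<lambda>n. of_real (1 / real (Suc n)) * M (Complex (k\<^sup>2) (1 / real (Suc n))) $ i $ j)
        \<longlonglongrightarrow> \<i> * (spectral_mat (\<psi> (k\<^sup>2)) $ i $ j * of_real \<mu>)" for i j
    proof -
      let ?d = "\<lambda>n. 1 / real (Suc n)"
      let ?K = "\<lambda>n. LINT t|\<nu>. herglotz_kernel (Complex (k\<^sup>2) (?d n)) t * spectral_mat (\<psi> t) $ i $ j"
      have "(\<lambda>t. spectral_mat (\<psi> t) $ i $ j) \<in> borel_measurable borel"
        using \<psi>(1) by (rule spectral_mat_entry_measurable)
      moreover have "AE t in \<nu>. cmod (spectral_mat (\<psi> t) $ i $ j) \<le> 1"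
        using \<psi>(2) by eventually_elim (rule spectral_mat_entry_bound)
      ultimately have 1: "(\<lambda>n. - \<i> * of_real (?d n) * ?K n) \<longlonglongrightarrow> spectral_mat (\<psi> (k\<^sup>2)) $ i $ j * of_real \<mu>"
        unfolding \<mu>_def by (rule herglotz_mass_limit)
      have "?d \<longlonglongrightarrow> 0" by (rule LIMSEQ_Suc[OF lim_1_over_n])
      then have 2: "(\<lambda>n. of_real (?d n) * mat_Re (M \<i>) $ i $ j) \<longlonglongrightarrow> of_real 0 * mat_Re (M \<i>) $ i $ j"
        by (intro tendsto_mult tendsto_of_real tendsto_const)
      have "(\<lambda>n. of_real (?d n) * mat_Re (M \<i>) $ i $ j + \<i> * (- \<i> * of_real (?d n) * ?K n))
        \<longlonglongrightarrow> of_real 0 * mat_Re (M \<i>) $ i $ j + \<i> * (spectral_mat (\<psi> (k\<^sup>2)) $ i $ j * of_real \<mu>)"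
        by (intro tendsto_add tendsto_mult[OF tendsto_const 1] 2)
      moreover have "of_real (?d n) * mat_Re (M \<i>) $ i $ j + \<i> * (- \<i> * of_real (?d n) * ?K n)
          = of_real (?d n) * M (Complex (k\<^sup>2) (?d n)) $ i $ j" for n
      proof -
        have Im: "Im (Complex (k\<^sup>2) (?d n)) > 0" by simp
        show ?thesis unfolding rep[OF Im] by (simp add: distrib_left)
      qed
      ultimately show ?thesis by simp
    qed
    note lim = weyl_matrix_eigenvalue_limit[OF k Fp Fm e bc M mass[of 1 1] mass[of 2 1], folded l_def]
    show "bd_ell \<alpha> e \<noteq> 0" using lim(1) unfolding l_def .
    have l0: "l \<noteq> 0" by (rule lim(1))
    define E where "E = (LINT x:{0<..}|lebesgue. (cmod (e x))\<^sup>2)"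
    have "complex_of_real (2 * E * \<mu>) = of_real ((cmod l)\<^sup>2)"
      using lim(2) unfolding E_def[symmetric] complex_norm_square by simp
    then have E\<mu>: "2 * E * \<mu> = (cmod l)\<^sup>2" by (simp only: of_real_eq_iff)
    \<comment> \<open>Positivity of both factors is read off from their product. The nonzero mass
      also makes \<psi> at k^2 a determined value, although \<psi> is given only up to null
      sets.\<close>
    then have E0: "E \<noteq> 0" and \<mu>0: "\<mu> \<noteq> 0" using l0 by auto
    then have "\<mu> = (cmod l)\<^sup>2 / (2 * E)" using E\<mu> by (simp add: field_simps)
    then show "measure \<nu> {k\<^sup>2} = (cmod (bd_ell \<alpha> e))\<^sup>2 / (2 * (LINT x:{0<..}|lebesgue. (cmod (e x))\<^sup>2))"
      unfolding \<mu>_def E_def l_def .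
    \<comment> \<open>The first column of the density matrix contains the conjugate of \<psi>, so
      the relation is conjugated at the end.\<close>
    have "cnj l * cnj (\<psi> (k\<^sup>2)) * of_real \<mu> = - l * of_real \<mu>" using lim(3) by (simp add: mult.assoc)
    then have "cnj l * cnj (\<psi> (k\<^sup>2)) = - l" using \<mu>0 by (metis mult_right_cancel of_real_eq_0_iff)
    then have "cnj (cnj l * cnj (\<psi> (k\<^sup>2))) = cnj (- l)" by (rule arg_cong)
    then have "l * \<psi> (k\<^sup>2) = - cnj l" by simp
    then have "\<psi> (k\<^sup>2) = - (cnj l / l)" using l0 by (simp add: field_simps)
    then show "\<psi> (k\<^sup>2) = - (cnj (bd_ell \<alpha> e) / bd_ell \<alpha> e)" unfolding l_def .
  qed
qed

end
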